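(* The following problem is PSPACE-hard: given a saturated duo-normalized FDFA $\mathcal F$ and a positive integer $k$, determine whether the diameter measure of $\mathcal F$ is at least $k$. Here the diameter measure may be taken as the positive measure $|\mathcal F|_{\leadsto}^{+}$ or as the negative measure $|\mathcal F|_{\leadsto}^{-}$.
   Context: $\Sigma$ is a finite alphabet (part of the input). For a (complete deterministic) automaton $\mathcal A$ and $w\in\Sigma^*$, $\mathcal A(w)$ is the state reached from the initial state on reading $w$; $[\![\mathcal D]\!]$ is the language of a DFA $\mathcal D$. An FDFA is a pair $\mathcal F=(\mathcal Q,\{\mathcal P_q\}_{q\in Q})$ of a leading automaton structure $\mathcal Q$ (a complete deterministic automaton without acceptance, with state set $Q$) and a complete progress DFA $\mathcal P_q$ for each $q\in Q$; write $\mathcal P_u=\mathcal P_{\mathcal Q(u)}$ for $u\in\Sigma^*$. For $u\in\Sigma^*,v\in\Sigma^+$: $(u,v)$ is a decomposition of $w$ if $uv^\omega=w$; normalized if $\mathcal Q(uv)=\mathcal Q(u)$; duo-normalized if normalized and $\mathcal P_u(vv)=\mathcal P_u(v)$. With duo-normalized acceptance, $(u,v)\in[\![\mathcal F]\!]$ iff there is a duo-normalized decomposition $(x,y)$ of $uv^\omega$ with $y\in[\![\mathcal P_x]\!]$. $\mathcal F$ is saturated if, for every ultimately periodic word $w$, all duo-normalized decompositions $(x,y)$ of $w$ agree on whether $y\in[\![\mathcal P_x]\!]$. $(u,v)$ is persistent (wrt $\mathcal F$) if it is duo-normalized and for every $z\in\Sigma^*$ there is $i\ge 2$ with $\mathcal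 P_u(zv)=\mathcal P_u(zv^i)$. With $\prec$ the strict prefix relation, $v_1\prec v_2\prec\dots\prec v_k$ is a persistent chain of length $k$ wrt $u$ in $\mathcal F$ if $(u,v_i)$ is persistent for all $1\le i\le k$ and $(u,v_{i+1})\in[\![\mathcal F]\!]$ iff $(u,v_i)\notin[\![\mathcal F]\!]$ for all $1\le i<k$; it is positive if $(u,v_1)\in[\![\mathcal F]\!]$ and negative otherwise. $|\mathcal F|_{\leadsto}^{+}$ (resp. $|\mathcal F|_{\leadsto}^{-}$) is the maximal $k$ such that there are $u\in\Sigma^*$ and a positive (resp. negative) persistent chain of length $k$ wrt $u$ in $\mathcal F$ ($0$ if there is none). *)

theory Defs
  imports
    "HOL-Library.Omega_Words_Fun"
    "HOL-Library.Sublist"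
    "HOL-Library.Extended_Nat"
    "HOL-Computational_Algebra.Polynomial"
begin

section \<open>Families of DFAs\<close>

record ('a, 'q) automaton =
  states :: "'q set"
  initial :: 'q
  transition :: "'q \<Rightarrow> 'a \<Rightarrow> 'q"

record ('a, 'q) dfa = "('a, 'q) automaton" +
  accepting :: "'q set"

definition complete_automaton :: "'a set \<Rightarrow> ('a, 'q, 'm) automaton_scheme \<Rightarrow> bool" where
  "complete_automaton \<Sigma> A \<longleftrightarrow>
     finite (states A) \<and> initial A \<in> states A \<and>
     (\<forall>q \<in> states A. \<forall>a \<in> \<Sigma>. transition A q a \<in> states A)"

definition complete_dfa :: "'a set \<Rightarrow> ('a, 'q) dfa \<Rightarrow> bool" where
  "complete_dfa \<Sigma> D \<longleftrightarrow> complete_automaton \<Sigma> D \<and> accepting D \<subseteq> states D"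

definition reach :: "('a, 'q, 'm) automaton_scheme \<Rightarrow> 'a list \<Rightarrow> 'q" where
  "reach A w = foldl (transition A) (initial A) w"

definition accepts :: "('a, 'q) dfa \<Rightarrow> 'a list \<Rightarrow> bool" where
  "accepts D w \<longleftrightarrow> reach D w \<in> accepting D"

record ('a, 'q, 'p) fdfa =
  alphabet :: "'a set"
  leading :: "('a, 'q) automaton"
  progress :: "'q \<Rightarrow> ('a, 'p) dfa"

definition wf_fdfa :: "('a, 'q, 'p) fdfa \<Rightarrow> bool" where
  "wf_fdfa F \<longleftrightarrow>
     finite (alphabet F) \<and> alphabet F \<noteq> {} \<and>
     complete_automaton (alphabet F) (leading F) \<and>
     (\<forall>q \<in> states (leading F). complete_dfa (alphabet F) (progress F q))"

definition progress_of :: "('a, 'q, 'p) fdfa \<Rightarrow> 'a list \<Rightarrow> ('a, 'p) dfa" where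
  "progress_of F u = progress F (reach (leading F) u)"

definition is_pair :: "('a, 'q, 'p) fdfa \<Rightarrow> 'a list \<Rightarrow> 'a list \<Rightarrow> bool" where
  "is_pair F u v \<longleftrightarrow> u \<in> lists (alphabet F) \<and> v \<in> lists (alphabet F) \<and> v \<noteq> []"

definition decomposition :: "('a, 'q, 'p) fdfa \<Rightarrow> 'a word \<Rightarrow> 'a list \<Rightarrow> 'a list \<Rightarrow> bool" where
  "decomposition F w u v \<longleftrightarrow> is_pair F u v \<and> u \<frown> v\<^sup>\<omega> = w"

definition normalized :: "('a, 'q, 'p) fdfa \<Rightarrow> 'a list \<Rightarrow> 'a list \<Rightarrow> bool" where
  "normalized F u v \<longleftrightarrow>
     is_pair F u v \<and> reach (leading F) (u @ v) = reach (leading F) u"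

definition duo_normalized :: "('a, 'q, 'p) fdfa \<Rightarrow> 'a list \<Rightarrow> 'a list \<Rightarrow> bool" where
  "duo_normalized F u v \<longleftrightarrow>
     normalized F u v \<and> reach (progress_of F u) (v @ v) = reach (progress_of F u) v"

definition fdfa_accepts :: "('a, 'q, 'p) fdfa \<Rightarrow> 'a list \<Rightarrow> 'a list \<Rightarrow> bool" where
  "fdfa_accepts F u v \<longleftrightarrow>
     (\<exists>x y. decomposition F (u \<frown> v\<^sup>\<omega>) x y \<and> duo_normalized F x y \<and>
            accepts (progress_of F x) y)"

definition saturated :: "('a, 'q, 'p) fdfa \<Rightarrow> bool" where
  "saturated F \<longleftrightarrow>
     (\<forall>w x y x' y'.
        decomposition F w x y \<and> duo_normalized F x y \<and>
        decomposition F w x' y' \<and> duo_normalized F x' y' \<longrightarrow>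
        (accepts (progress_of F x) y \<longleftrightarrow> accepts (progress_of F x') y'))"

definition word_power :: "'a list \<Rightarrow> nat \<Rightarrow> 'a list" where
  "word_power v i = concat (replicate i v)"

definition persistent :: "('a, 'q, 'p) fdfa \<Rightarrow> 'a list \<Rightarrow> 'a list \<Rightarrow> bool" where
  "persistent F u v \<longleftrightarrow>
     duo_normalized F u v \<and>
     (\<forall>z \<in> lists (alphabet F). \<exists>i\<ge>2.
        reach (progress_of F u) (z @ v) = reach (progress_of F u) (z @ word_power v i))"

definition persistent_chain :: "('a, 'q, 'p) fdfa \<Rightarrow> 'a list \<Rightarrow> 'a list list \<Rightarrow> bool" where
  "persistent_chain F u vs \<longleftrightarrow>
     vs \<noteq> [] \<and>
     (\<forall>v \<in> set vs. persistent F u v) \<and>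
     (\<forall>i. Suc i < length vs \<longrightarrow>
        strict_prefix (vs ! i) (vs ! Suc i) \<and>
        (fdfa_accepts F u (vs ! Suc i) \<longleftrightarrow> \<not> fdfa_accepts F u (vs ! i)))"

text \<open>In \<^typ>\<open>enat\<close> the supremum of the empty set is 0, and the supremum of a nonempty
  bounded set is its maximum.\<close>

definition positive_measure :: "('a, 'q, 'p) fdfa \<Rightarrow> enat" where
  "positive_measure F =
     (SUP (u, vs) \<in> {(u, vs). u \<in> lists (alphabet F) \<and> persistent_chain F u vs \<and>
                              fdfa_accepts F u (hd vs)}. enat (length vs))"

definition negative_measure :: "('a, 'q, 'p) fdfa \<Rightarrow> enat" where
  "negative_measure F =
     (SUP (u, vs) \<in> {(u, vs). u \<in> lists (alphabet F) \<and> persistent_chain F u vs \<and>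
                              \<not> fdfa_accepts F u (hd vs)}. enat (length vs))"


section \<open>Turing machines, PSPACE and polynomial-time reductions\<close>

text \<open>Deterministic multi-tape machines with two-way infinite tapes. The tape alphabet is an
  initial segment of the natural numbers, where 0 is the blank and 1, 2 are the input letters;
  so is the set of control states, with start state 0. The machine halts when \<open>tm_trans\<close> returns
  \<^const>\<open>None\<close>; otherwise it returns the new state and, for each tape, the symbol to write and
  the head movement. The input is on the first tape and the output on the last one.\<close>

datatype move = Left | Stay | Right

record tm =
  tm_tapes :: nat
  tm_symbols :: nat
  tm_states :: nat
  tm_accepting :: "nat set"
  tm_trans :: "nat \<Rightarrow> nat list \<Rightarrow> (nat \<times> (nat \<times> move) list) option"

definition wf_tm :: "tm \<Rightarrow> bool" where
  "wf_tm M \<longleftrightarrow>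
     1 \<le> tm_tapes M \<and> 3 \<le> tm_symbols M \<and> 1 \<le> tm_states M \<and>
     (\<forall>q ss q' acts.
        q < tm_states M \<and> length ss = tm_tapes M \<and> (\<forall>s \<in> set ss. s < tm_symbols M) \<and>
        tm_trans M q ss = Some (q', acts) \<longrightarrow>
        q' < tm_states M \<and> length acts = tm_tapes M \<and>
        (\<forall>(s, d) \<in> set acts. s < tm_symbols M))"

text \<open>A tape consists of its contents and the head position.\<close>

type_synonym tape = "(int \<Rightarrow> nat) \<times> int"
type_synonym config = "nat \<times> tape list"

fun tape_read :: "tape \<Rightarrow> nat" where
  "tape_read (t, h) = t h"

fun move_head :: "move \<Rightarrow> int \<Rightarrow> int" where
  "move_head Left h = h - 1"
| "move_head Stay h = h"
| "move_head Right h = h + 1"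

fun tape_act :: "nat \<times> move \<Rightarrow> tape \<Rightarrow> tape" where
  "tape_act (s, d) (t, h) = (t(h := s), move_head d h)"

fun tm_step :: "tm \<Rightarrow> config \<Rightarrow> config option" where
  "tm_step M (q, ts) =
     (case tm_trans M q (map tape_read ts) of
        None \<Rightarrow> None
      | Some (q', acts) \<Rightarrow> Some (q', map2 tape_act acts ts))"

definition tape_contents :: "bool list \<Rightarrow> int \<Rightarrow> nat" where
  "tape_contents w j =
     (if 0 \<le> j \<and> j < int (length w) then (if w ! nat j then 2 else 1) else 0)"

definition tm_initial :: "tm \<Rightarrow> bool list \<Rightarrow> config" where
  "tm_initial M w = (0, (tape_contents w, 0) # replicate (tm_tapes M - 1) (tape_contents [], 0))"

text \<open>The configuration after \<open>n\<close> steps; a halted machine stays where it is.\<close>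

fun tm_run :: "tm \<Rightarrow> bool list \<Rightarrow> nat \<Rightarrow> config" where
  "tm_run M w 0 = tm_initial M w"
| "tm_run M w (Suc n) =
     (case tm_step M (tm_run M w n) of None \<Rightarrow> tm_run M w n | Some c \<Rightarrow> c)"

definition tm_halted :: "tm \<Rightarrow> bool list \<Rightarrow> nat \<Rightarrow> bool" where
  "tm_halted M w n \<longleftrightarrow> tm_step M (tm_run M w n) = None"

definition tm_visited :: "tm \<Rightarrow> bool list \<Rightarrow> nat \<Rightarrow> int set" where
  "tm_visited M w i = {snd (snd (tm_run M w n) ! i) | n. True}"

definition tm_decides :: "tm \<Rightarrow> bool list set \<Rightarrow> bool" where
  "tm_decides M L \<longleftrightarrow>
     (\<forall>w. \<exists>n. tm_halted M w n \<and> (fst (tm_run M w n) \<in> tm_accepting M \<longleftrightarrow> w \<in> L))"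

definition tm_space_bounded :: "tm \<Rightarrow> (nat \<Rightarrow> nat) \<Rightarrow> bool" where
  "tm_space_bounded M s \<longleftrightarrow>
     (\<forall>w. \<forall>i < tm_tapes M.
        finite (tm_visited M w i) \<and> card (tm_visited M w i) \<le> s (length w))"

definition PSPACE :: "bool list set set" where
  "PSPACE =
     {L. \<exists>M (p :: nat poly). wf_tm M \<and> tm_decides M L \<and> tm_space_bounded M (poly p)}"

definition poly_time_computable :: "(bool list \<Rightarrow> bool list) \<Rightarrow> bool" where
  "poly_time_computable f \<longleftrightarrow>
     (\<exists>M (p :: nat poly). wf_tm M \<and>
        (\<forall>w. \<exists>n \<le> poly p (length w).
           tm_halted M w n \<and> fst (last (snd (tm_run M w n))) = tape_contents (f w)))"

text \<open>A decision problem is given by its set of instances, an encoding of instances as bit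
  strings, and the property to be decided. Reductions must only produce (encodings of) genuine
  instances.\<close>

definition PSPACE_hard :: "'i set \<Rightarrow> ('i \<Rightarrow> bool list) \<Rightarrow> ('i \<Rightarrow> bool) \<Rightarrow> bool" where
  "PSPACE_hard instances enc yes \<longleftrightarrow>
     (\<forall>L \<in> PSPACE. \<exists>f. poly_time_computable f \<and>
        (\<forall>w. \<exists>x \<in> instances. f w = enc x \<and> (w \<in> L \<longleftrightarrow> yes x)))"


section \<open>The diameter measure problems\<close>

text \<open>As problem inputs, the letters and the states of each automaton are numbered consecutively
  from 0.\<close>

type_synonym input_fdfa = "(nat, nat, nat) fdfa"

definition numbered_fdfa :: "input_fdfa \<Rightarrow> bool" where
  "numbered_fdfa F \<longleftrightarrow>
     alphabet F = {..<card (alphabet F)} \<and>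
     states (leading F) = {..<card (states (leading F))} \<and>
     (\<forall>q \<in> states (leading F).
        states (progress F q) = {..<card (states (progress F q))})"

text \<open>Automata are encoded by explicit transition tables. The entries are written as
  self-delimiting unary numbers; they are smaller than the number of rows, so this changes the
  length at most polynomially compared to binary entries. The threshold is written in binary,
  least significant bit first.\<close>

definition unary :: "nat \<Rightarrow> bool list" where
  "unary n = replicate n True @ [False]"

fun binary :: "nat \<Rightarrow> bool list" where
  "binary n = (if n = 0 then [] else odd n # binary (n div 2))"

declare binary.simps [simp del]

definition encode_automaton :: "nat \<Rightarrow> (nat, nat, 'm) automaton_scheme \<Rightarrow> bool list" where
  "encode_automaton m A =
     unary (card (states A)) @ unary (initial A) @
     concat [unary (transition A q a). q \<leftarrow> [0..<card (states A)], a \<leftarrow> [0..<m]]"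

definition encode_dfa :: "nat \<Rightarrow> (nat, nat) dfa \<Rightarrow> bool list" where
  "encode_dfa m D =
     encode_automaton m D @ [q \<in> accepting D. q \<leftarrow> [0..<card (states D)]]"

definition encode_fdfa :: "input_fdfa \<Rightarrow> bool list" where
  "encode_fdfa F =
     (let m = card (alphabet F) in
        unary m @ encode_automaton m (leading F) @
        concat [encode_dfa m (progress F q). q \<leftarrow> [0..<card (states (leading F))]])"

definition encode_instance :: "input_fdfa \<times> nat \<Rightarrow> bool list" where
  "encode_instance = (\<lambda>(F, k). encode_fdfa F @ binary k)"

text \<open>An encoding determines the instance, up to the irrelevant values of the functions
  outside the state sets and the alphabet.\<close>

lemma unary_append_eq: "unary a @ xs = unary b @ ys \<longleftrightarrow> a = b \<and> xs = ys"
proof (induction a arbitrary: b)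
  case 0 then show ?case by (cases b) (auto simp: unary_def)
next
  case (Suc a) then show ?case by (cases b) (auto simp: unary_def)
qed

lemma unary_list_append_eq:
  assumes "concat (map unary ns) @ xs = concat (map unary ms) @ ys" "length ns = length ms"
  shows "ns = ms \<and> xs = ys"
  using assms(2,1)
  by (induction rule: list_induct2) (simp_all add: unary_append_eq)

lemma encode_automaton_append_eq:
  assumes "encode_automaton m A @ xs = encode_automaton m B @ ys"
  shows "card (states A) = card (states B) \<and> initial A = initial B \<and>
    (\<forall>q < card (states A). \<forall>a < m. transition A q a = transition B q a) \<and> xs = ys"
proof -
  define n where "n = card (states A)"
  define qas where "qas = List.product [0..<n] [0..<m]"
  have table: "concat (map (\<lambda>q. map (\<lambda>a. unary (t q a)) [0..<m]) qs) =
      map unary (map (\<lambda>(q, a). t q a) (List.product qs [0..<m]))"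
    for t :: "nat \<Rightarrow> nat \<Rightarrow> nat" and qs
    by (induction qs) (simp_all add: comp_def)
  have eq: "unary n @ unary (initial A) @
      concat (map unary (map (\<lambda>(q, a). transition A q a) qas)) @ xs =
    unary (card (states B)) @ unary (initial B) @
      concat (map unary (map (\<lambda>(q, a). transition B q a)
        (List.product [0..<card (states B)] [0..<m]))) @ ys"
    using assms unfolding encode_automaton_def table n_def qas_def append_assoc .
  then have n: "n = card (states B)" and init: "initial A = initial B"
    unfolding unary_append_eq by blast+
  have "concat (map unary (map (\<lambda>(q, a). transition A q a) qas)) @ xs =
      concat (map unary (map (\<lambda>(q, a). transition B q a) qas)) @ ys"
    using eq[folded n, folded qas_def] unfolding unary_append_eq by blast
  note T = unary_list_append_eq[OF this, unfolded length_map, OF refl]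
  have "transition A q a = transition B q a" if "q < n" "a < m" for q a
  proof -
    have "(q, a) \<in> set qas"
      using that by (simp add: qas_def)
    then show ?thesis
      using T unfolding map_eq_conv by fastforce
  qed
  with n init T show ?thesis
    unfolding n_def by blast
qed

lemma encode_dfa_append_eq:
  assumes "encode_dfa m D @ xs = encode_dfa m E @ ys"
  shows "card (states D) = card (states E) \<and> initial D = initial E \<and>
    (\<forall>q < card (states D). (\<forall>a < m. transition D q a = transition E q a) \<and>
       (q \<in> accepting D \<longleftrightarrow> q \<in> accepting E)) \<and> xs = ys"
proof -
  have "encode_automaton m D @ map (\<lambda>q. q \<in> accepting D) [0..<card (states D)] @ xs =
      encode_automaton m E @ map (\<lambda>q. q \<in> accepting E) [0..<card (states E)] @ ys"
    using assms by (simp add: encode_dfa_def)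
  note A = encode_automaton_append_eq[OF this]
  then have "card (states D) = card (states E)"
    by blast
  with A have "map (\<lambda>q. q \<in> accepting D) [0..<card (states D)] =
      map (\<lambda>q. q \<in> accepting E) [0..<card (states D)]" and "xs = ys"
    by simp_all
  from this(1) have "\<forall>q < card (states D). q \<in> accepting D \<longleftrightarrow> q \<in> accepting E"
    unfolding map_eq_conv by simp
  with A \<open>xs = ys\<close> show ?thesis
    by blast
qed

lemma binary_inj: "binary k = binary l \<Longrightarrow> k = l"
proof (induction k arbitrary: l rule: less_induct)
  case (less k)
  show ?case
  proof (cases "k = 0 \<or> l = 0")
    case True
    with less.prems show ?thesis
      by (simp add: binary.simps[of k] binary.simps[of l] split: if_splits)
  next
    case False
    then have "binary k = odd k # binary (k div 2)" "binary l = odd l # binary (l div 2)"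
      by (simp_all add: binary.simps[of k] binary.simps[of l])
    with less.prems have parity: "odd k = odd l" and "binary (k div 2) = binary (l div 2)"
      by simp_all
    with less.IH[of "k div 2" "l div 2"] False have "k div 2 = l div 2"
      by simp
    with parity show ?thesis
      by presburger
  qed
qed

lemma encode_dfas_append_eq:
  assumes "concat (map (\<lambda>q. encode_dfa m (d q)) qs) @ xs =
    concat (map (\<lambda>q. encode_dfa m (e q)) qs) @ ys"
  shows "(\<forall>q \<in> set qs. encode_dfa m (d q) = encode_dfa m (e q)) \<and> xs = ys"
  using assms
proof (induction qs)
  case (Cons q qs)
  from Cons.prems have eq: "encode_dfa m (d q) @ concat (map (\<lambda>q. encode_dfa m (d q)) qs) @ xs =
      encode_dfa m (e q) @ concat (map (\<lambda>q. encode_dfa m (e q)) qs) @ ys"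
    by (simp only: list.map concat.simps append_assoc)
  then have rest: "concat (map (\<lambda>q. encode_dfa m (d q)) qs) @ xs =
      concat (map (\<lambda>q. encode_dfa m (e q)) qs) @ ys"
    using encode_dfa_append_eq by blast
  have "encode_dfa m (d q) = encode_dfa m (e q)"
    using eq unfolding rest append_same_eq .
  with Cons.IH[OF rest] show ?case
    by (simp only: list.set insert_iff) blast
qed simp

lemma encode_instance_determines:
  assumes "encode_instance (F, k) = encode_instance (G, l)"
  defines "m \<equiv> card (alphabet F)" and "n \<equiv> card (states (leading F))"
  shows "k = l" "card (alphabet G) = m" "card (states (leading G)) = n"
    "initial (leading F) = initial (leading G)"
    "\<forall>q < n. \<forall>a < m. transition (leading F) q a = transition (leading G) q a"
    "\<forall>q < n. encode_dfa m (progress F q) = encode_dfa m (progress G q)"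
proof -
  have eq: "unary m @ encode_automaton m (leading F) @
      concat (map (\<lambda>q. encode_dfa m (progress F q)) [0..<n]) @ binary k =
    unary (card (alphabet G)) @ encode_automaton (card (alphabet G)) (leading G) @
      concat (map (\<lambda>q. encode_dfa (card (alphabet G)) (progress G q))
        [0..<card (states (leading G))]) @ binary l"
    using assms(1)
    by (simp only: encode_instance_def encode_fdfa_def Let_def prod.case append_assoc m_def n_def)
  from eq[unfolded unary_append_eq] show m: "card (alphabet G) = m"
    by blast
  from eq[unfolded m unary_append_eq] have "encode_automaton m (leading F) @
      concat (map (\<lambda>q. encode_dfa m (progress F q)) [0..<n]) @ binary k =
    encode_automaton m (leading G) @
      concat (map (\<lambda>q. encode_dfa m (progress G q)) [0..<card (states (leading G))]) @ binary l"
    by blast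
  note L = encode_automaton_append_eq[OF this, folded n_def]
  from L show n: "card (states (leading G)) = n"
    and "initial (leading F) = initial (leading G)"
    and "\<forall>q < n. \<forall>a < m. transition (leading F) q a = transition (leading G) q a"
    by simp_all
  from L have "concat (map (\<lambda>q. encode_dfa m (progress F q)) [0..<n]) @ binary k =
      concat (map (\<lambda>q. encode_dfa m (progress G q)) [0..<n]) @ binary l"
    unfolding n by blast
  note P = encode_dfas_append_eq[OF this]
  then show "k = l"
    using binary_inj by blast
  from P show "\<forall>q < n. encode_dfa m (progress F q) = encode_dfa m (progress G q)"
    by (simp only: set_upt) simp
qed

definition diameter_instances :: "(input_fdfa \<times> nat) set" where
  "diameter_instances = {(F, k). wf_fdfa F \<and> numbered_fdfa F \<and> saturated F \<and> 1 \<le> k}"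

definition measure_at_least :: "(input_fdfa \<Rightarrow> enat) \<Rightarrow> input_fdfa \<times> nat \<Rightarrow> bool" where
  "measure_at_least \<mu> = (\<lambda>(F, k). enat k \<le> \<mu> F)"

end

theory Submission
  imports Defs
begin

text \<open>
  Let a machine decide the language in space \<open>N\<close>, polynomial in the length of the input.
  A computation is written as a word of actions, one for each rule and tape, and each of the
  \<open>W = 2 N + 1\<close> tape columns is watched by a DFA of constant size, so the computation accepts
  iff some word is accepted by all columns.
  These DFAs are combined into one progress DFA over the actions and the priorities
  \<open>0, \<dots>, 2 W - 1\<close>. Its level is the largest priority seen so far; on level \<open>l\<close>
  it runs the DFA of column \<open>l div 2\<close> on the blocks between priorities, and fails until
  the level rises if one of the blocks is rejected. A word is positive iff its level is even and
  has not failed; this is invariant under powers and rotations, so the FDFA with one leading state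
  is saturated. A chain of length \<open>2 W\<close> must pass all even levels without failing, so a block
  of its first words is accepted by the columns; conversely, a commonly accepted word \<open>x\<close> gives
  the chain \<open>0 x\<close>, \<open>0 x 1 x\<close>, and so on. Complementing the acceptance
  exchanges the two measures.

  The transition table is written by a loop program over counters, and a counter is the position of
  a tape head, so that each step of the program is a single step of a Turing machine.
\<close>

section \<open>Counter programs on Turing machines\<close>

text \<open>The hard core is nonemptiness of the intersection of polynomially many DFAs, each of a
  size that depends on the machine alone. Their product is exponentially large, so the progress DFA
  runs one component at a time, and the chain has to force all of them onto the same word. Two facts
  do this. The words of a chain are prefixes of each other, so a block of an early word occurs in
  every later one. And a duo-normalized word returns to its state when it is read again from there;
  on that second reading the level is already at its maximum, so the component of that level gets to
  see the early block. The odd levels supply the negative words between two positive ones without a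
  failure; a failure would only be repaired by raising the level. So a chain with as many words as
  there are levels cannot skip an even level. The number \<open>2 * N + 1\<close> of columns comes
  from the cells \<open>-N\<close> to \<open>N\<close>: a head that starts in cell 0 and visits at
  most \<open>N\<close> cells stays strictly between them.\<close>

datatype act = Idle | Inc nat | Dec nat | Out bool | In move

datatype cmd = Skip | Do act | Seq cmd cmd | While nat cmd | Branch nat cmd cmd
  | WhileIn cmd | CaseIn cmd cmd cmd

type_synonym store = "(nat \<Rightarrow> nat) \<times> int \<times> bool list"

fun act_store :: "act \<Rightarrow> store \<Rightarrow> store" where
  "act_store Idle s = s"
| "act_store (Inc r) (g, i, out) = (g(r := g r + 1), i, out)"
| "act_store (Dec r) (g, i, out) = (g(r := g r - 1), i, out)"
| "act_store (Out b) (g, i, out) = (g, i, out @ [b])"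
| "act_store (In d) (g, i, out) = (g, move_head d i, out)"

text \<open>The residual command plays the role of the control state. The zero tests and the scanned
  input symbol enter as parameters because they are all that a machine sees of a store; the same
  function therefore drives the abstract semantics and the transition table.\<close>

fun next_cmd :: "(nat \<Rightarrow> bool) \<Rightarrow> nat \<Rightarrow> cmd \<Rightarrow> (act \<times> cmd) option" where
  "next_cmd z y Skip = None"
| "next_cmd z y (Do a) = Some (a, Skip)"
| "next_cmd z y (Seq c d) =
     (case next_cmd z y c of None \<Rightarrow> Some (Idle, d) | Some (a, c') \<Rightarrow> Some (a, Seq c' d))"
| "next_cmd z y (While r c) = Some (Idle, if z r then Skip else Seq c (While r c))"
| "next_cmd z y (Branch r c d) = Some (Idle, if z r then d else c)"
| "next_cmd z y (WhileIn c) = Some (Idle, if y = 0 then Skip else Seq c (WhileIn c))"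
| "next_cmd z y (CaseIn c0 c1 c2) = Some (Idle, if y = 0 then c0 else if y = 1 then c1 else c2)"

fun cmd_step :: "bool list \<Rightarrow> cmd \<times> store \<Rightarrow> (cmd \<times> store) option" where
  "cmd_step w (c, g, i, out) =
     (case next_cmd (\<lambda>r. g r = 0) (tape_contents w i) c of
        None \<Rightarrow> None | Some (a, c') \<Rightarrow> Some (c', act_store a (g, i, out)))"

inductive exec :: "bool list \<Rightarrow> nat \<Rightarrow> cmd \<times> store \<Rightarrow> cmd \<times> store \<Rightarrow> bool" for w where
  refl: "exec w 0 x x"
| step: "cmd_step w x = Some y \<Longrightarrow> exec w n y z \<Longrightarrow> exec w (Suc n) x z"

lemma exec_trans: "exec w n x y \<Longrightarrow> exec w m y z \<Longrightarrow> exec w (n + m) x z"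
  by (induction rule: exec.induct) (auto intro: exec.intros)

definition runs :: "bool list \<Rightarrow> cmd \<Rightarrow> store \<Rightarrow> nat \<Rightarrow> store \<Rightarrow> bool" where
  "runs w c s b s' \<longleftrightarrow> (\<exists>n\<le>b. exec w n (c, s) (Skip, s'))"

lemma runs_mono: "runs w c s b s' \<Longrightarrow> b \<le> b' \<Longrightarrow> runs w c s b' s'"
  unfolding runs_def by (meson le_trans)

lemma runs_step:
  assumes "cmd_step w (c, s) = Some (c', s')" "runs w c' s' b s''"
  shows "runs w c s (Suc b) s''"
  using assms unfolding runs_def by (meson Suc_le_mono exec.step)

lemma runs_Do: "act_store a s = s' \<Longrightarrow> runs w (Do a) s 1 s'"
  by (cases s) (auto simp: runs_def intro!: exI[of _ 1] exec.step[of w _ "(Skip, s')" 0, simplified] exec.refl)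

lemma exec_Seq_left:
  "exec w n x y \<Longrightarrow> x = (c, s) \<Longrightarrow> y = (c', s') \<Longrightarrow> exec w n (Seq c d, s) (Seq c' d, s')"
proof (induction arbitrary: c s rule: exec.induct)
  case (refl x)
  then show ?case by (auto intro: exec.refl)
next
  case (step x y n z)
  obtain c1 s1 where y: "y = (c1, s1)" by (cases y)
  have "cmd_step w (Seq c d, s) = Some (Seq c1 d, s1)"
    using step.hyps(1) step.prems(1) y by (cases s) (auto split: option.splits)
  then show ?case
    using step.IH[OF y step.prems(2)] by (rule exec.step)
qed

lemma runs_Seq:
  assumes "runs w c s b s1" "runs w d s1 b' s2"
  shows "runs w (Seq c d) s (b + b' + 1) s2"
proof -
  obtain n m where n: "n \<le> b" "exec w n (c, s) (Skip, s1)"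
    and m: "m \<le> b'" "exec w m (d, s1) (Skip, s2)"
    using assms unfolding runs_def by blast
  have "cmd_step w (Seq Skip d, s1) = Some (d, s1)"
    by (cases s1) simp
  then have "exec w (Suc m) (Seq Skip d, s1) (Skip, s2)"
    using m(2) by (rule exec.step)
  with exec_Seq_left[OF n(2) HOL.refl HOL.refl, of d]
  have "exec w (n + Suc m) (Seq c d, s) (Skip, s2)"
    by (rule exec_trans)
  then show ?thesis
    unfolding runs_def using n(1) m(1) by (intro exI[of _ "n + Suc m"]) simp
qed

text \<open>\<open>f\<close> lists the stores at the loop tests. An iteration costs the body plus
  two steps, one for the test and one for leaving the exhausted \<open>Seq\<close>; the final test
  accounts for the last 1.\<close>

lemma runs_While:
  assumes "\<And>i. i < n \<Longrightarrow> fst (f i) r \<noteq> 0 \<and> runs w c (f i) b (f (Suc i))"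
    and "fst (f n) r = 0"
  shows "runs w (While r c) (f 0) (n * (b + 2) + 1) (f n)"
  using assms
proof (induction n arbitrary: f)
  case 0
  then have "cmd_step w (While r c, f 0) = Some (Skip, f 0)"
    by (cases "f 0") simp
  then show ?case
    by (auto simp: runs_def intro!: exI[of _ 1] exec.step[of w _ "(Skip, f 0)" 0, simplified] exec.refl)
next
  case (Suc n)
  have "runs w (While r c) (f (Suc 0)) (n * (b + 2) + 1) (f (Suc n))"
    using Suc.IH[of "\<lambda>i. f (Suc i)"] Suc.prems by simp
  moreover have "runs w c (f 0) b (f (Suc 0))" "fst (f 0) r \<noteq> 0"
    using Suc.prems(1)[of 0] by simp_all
  ultimately have "runs w (Seq c (While r c)) (f 0) (b + (n * (b + 2) + 1) + 1) (f (Suc n))"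
    using runs_Seq by blast
  moreover have "cmd_step w (While r c, f 0) = Some (Seq c (While r c), f 0)"
    using \<open>fst (f 0) r \<noteq> 0\<close> by (cases "f 0") simp
  ultimately show ?case
    using runs_step by (fastforce elim: runs_mono)
qed

lemma runs_Branch_zero: "runs w d s b s' \<Longrightarrow> fst s r = 0 \<Longrightarrow> runs w (Branch r c d) s (Suc b) s'"
  by (cases s) (auto intro!: runs_step[of w _ _ d s])

lemma runs_Branch_nonzero: "runs w c s b s' \<Longrightarrow> fst s r \<noteq> 0 \<Longrightarrow> runs w (Branch r c d) s (Suc b) s'"
  by (cases s) (auto intro!: runs_step[of w _ _ c s])

lemma runs_WhileIn:
  assumes "\<And>i. i < n \<Longrightarrow> tape_contents w (fst (snd (f i))) \<noteq> 0 \<and> runs w c (f i) b (f (Suc i))"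
    and "tape_contents w (fst (snd (f n))) = 0"
  shows "runs w (WhileIn c) (f 0) (n * (b + 2) + 1) (f n)"
  using assms
proof (induction n arbitrary: f)
  case 0
  then have "cmd_step w (WhileIn c, f 0) = Some (Skip, f 0)"
    by (cases "f 0") simp
  then show ?case
    by (auto simp: runs_def intro!: exI[of _ 1] exec.step[of w _ "(Skip, f 0)" 0, simplified] exec.refl)
next
  case (Suc n)
  have "runs w (WhileIn c) (f (Suc 0)) (n * (b + 2) + 1) (f (Suc n))"
    using Suc.IH[of "\<lambda>i. f (Suc i)"] Suc.prems by simp
  moreover have "runs w c (f 0) b (f (Suc 0))" "tape_contents w (fst (snd (f 0))) \<noteq> 0"
    using Suc.prems(1)[of 0] by simp_all
  ultimately have "runs w (Seq c (WhileIn c)) (f 0) (b + (n * (b + 2) + 1) + 1) (f (Suc n))"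
    using runs_Seq by blast
  moreover have "cmd_step w (WhileIn c, f 0) = Some (Seq c (WhileIn c), f 0)"
    using \<open>tape_contents w (fst (snd (f 0))) \<noteq> 0\<close> by (cases "f 0") simp
  ultimately show ?case
    using runs_step by (fastforce elim: runs_mono)
qed

lemma runs_CaseIn:
  assumes "runs w (if tape_contents w (fst (snd s)) = 0 then c0
      else if tape_contents w (fst (snd s)) = 1 then c1 else c2) s b s'"
  shows "runs w (CaseIn c0 c1 c2) s (Suc b) s'"
  using assms by (cases s) (auto intro!: runs_step)

subsection \<open>Turing machines for commands\<close>

text \<open>Analogue of the partial derivatives of a regular expression: an unfolded loop only ever
  stands behind a residual of its own body, so finitely many residuals suffice as control
  states.\<close>

fun derivs :: "cmd \<Rightarrow> cmd set" where
  "derivs Skip = {Skip}"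
| "derivs (Do a) = {Do a, Skip}"
| "derivs (Seq c d) = (\<lambda>c'. Seq c' d) ` derivs c \<union> derivs d"
| "derivs (While r c) = {While r c, Skip} \<union> (\<lambda>c'. Seq c' (While r c)) ` derivs c"
| "derivs (Branch r c d) = {Branch r c d} \<union> derivs c \<union> derivs d"
| "derivs (WhileIn c) = {WhileIn c, Skip} \<union> (\<lambda>c'. Seq c' (WhileIn c)) ` derivs c"
| "derivs (CaseIn c0 c1 c2) = {CaseIn c0 c1 c2} \<union> derivs c0 \<union> derivs c1 \<union> derivs c2"

lemma finite_derivs: "finite (derivs c)"
  by (induction c) auto

lemma derivs_self: "c \<in> derivs c"
  by (induction c) auto

lemma derivs_next:
  "c' \<in> derivs c \<Longrightarrow> next_cmd z y c' = Some (a, c'') \<Longrightarrow> c'' \<in> derivs c"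
  by (induction c arbitrary: c' c'' a)
    (auto simp: derivs_self split: option.splits if_splits)

fun act_regs :: "act \<Rightarrow> nat set" where
  "act_regs (Inc r) = {r}"
| "act_regs (Dec r) = {r}"
| "act_regs _ = {}"

fun regs :: "cmd \<Rightarrow> nat set" where
  "regs Skip = {}"
| "regs (Do a) = act_regs a"
| "regs (Seq c d) = regs c \<union> regs d"
| "regs (While r c) = insert r (regs c)"
| "regs (Branch r c d) = insert r (regs c \<union> regs d)"
| "regs (WhileIn c) = regs c"
| "regs (CaseIn c0 c1 c2) = regs c0 \<union> regs c1 \<union> regs c2"

lemma finite_regs: "finite (regs c)"
proof (induction c)
  case (Do a) then show ?case by (cases a) auto
qed auto

lemma derivs_regs: "c' \<in> derivs c \<Longrightarrow> regs c' \<subseteq> regs c"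
  by (induction c arbitrary: c') (auto; blast)+

lemma next_cmd_regs: "next_cmd z y c = Some (a, c') \<Longrightarrow> act_regs a \<subseteq> regs c"
  by (induction c arbitrary: c') (auto split: option.splits)

lemma next_cmd_cong:
  "(\<And>r. r \<in> regs c \<Longrightarrow> z r = z' r) \<Longrightarrow> next_cmd z y c = next_cmd z' y c"
  by (induction c) auto

text \<open>A register tape is blank except for a mark in cell 0, which makes zero recognizable; the
  machine spends its first step on writing the marks.\<close>

definition reg_tape :: "nat \<Rightarrow> tape" where
  "reg_tape n = ((\<lambda>j. if j = 0 then 1 else 0), int n)"

text \<open>Register heads move without altering their tapes, since each cell is rewritten with the
  symbol just read. Decrementing on the mark does not move, in agreement with truncated subtraction.
  The output head rests on the blank after the last bit, ready for the next one.\<close>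

definition tape_acts :: "nat \<Rightarrow> act \<Rightarrow> nat list \<Rightarrow> (nat \<times> move) list" where
  "tape_acts k a ss =
     (ss ! 0, case a of In d \<Rightarrow> d | _ \<Rightarrow> Stay) #
     map (\<lambda>r. (ss ! Suc r, if a = Inc r then Right else
                 if a = Dec r \<and> ss ! Suc r \<noteq> 1 then Left else Stay)) [0..<k] @
     [case a of Out b \<Rightarrow> (if b then 2 else 1, Right) | _ \<Rightarrow> (ss ! Suc k, Stay)]"

definition cmd_tm :: "nat \<Rightarrow> cmd \<Rightarrow> (cmd \<Rightarrow> nat) \<Rightarrow> tm" where
  "cmd_tm k c num = \<lparr>tm_tapes = k + 2, tm_symbols = 3, tm_states = Suc (card (derivs c)),
     tm_accepting = {},
     tm_trans = (\<lambda>q ss.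
       if q = 0 then Some (Suc (num c), (ss ! 0, Stay) # replicate k (1, Stay) @ [(ss ! Suc k, Stay)])
       else case next_cmd (\<lambda>r. ss ! Suc r = 1) (ss ! 0) (the_inv_into (derivs c) num (q - 1)) of
           None \<Rightarrow> None
         | Some (a, c') \<Rightarrow> Some (Suc (num c'), tape_acts k a ss))\<rparr>"

fun cmd_config :: "bool list \<Rightarrow> nat \<Rightarrow> (cmd \<Rightarrow> nat) \<Rightarrow> cmd \<times> store \<Rightarrow> config" where
  "cmd_config w k num (c, g, i, out) =
     (Suc (num c), (tape_contents w, i) # map (\<lambda>r. reg_tape (g r)) [0..<k] @
        [(tape_contents out, int (length out))])"

lemma tape_contents_snoc:
  "(tape_contents out)(int (length out) := if b then 2 else 1) = tape_contents (out @ [b])"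
  by (rule ext) (auto simp: tape_contents_def nth_append)

lemma tape_acts_correct:
  assumes "act_regs a \<subseteq> {..<k}"
  shows "map2 tape_act (tape_acts k a (tape_contents w i # map (\<lambda>r. if g r = 0 then 1 else 0) [0..<k] @ [0]))
     ((tape_contents w, i) # map (\<lambda>r. reg_tape (g r)) [0..<k] @ [(tape_contents out, int (length out))])
   = snd (cmd_config w k num (c, act_store a (g, i, out)))"
proof -
  have out: "(tape_contents out)(int (length out) := 0) = tape_contents out"
    by (rule ext) (simp add: tape_contents_def)
  have regs: "tape_act (if g r = 0 then 1 else 0, if a = Inc r then Right else
       if a = Dec r \<and> g r \<noteq> 0 then Left else Stay) (reg_tape (g r)) =
     reg_tape (fst (act_store a (g, i, out)) r)" for r
    by (cases a) (auto simp: reg_tape_def)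
  have zip: "map2 tape_act (map F [0..<k]) (map G [0..<k]) = map (\<lambda>r. tape_act (F r) (G r)) [0..<k]" for F G
    by (simp add: zip_map_map map_zip_map map_zip_map2 zip_same_conv_map comp_def)
  have nth: "(tape_contents w i # map (\<lambda>r. if g r = 0 then 1 else 0) [0..<k] @ [0]) ! Suc r =
     (if r < k then (if g r = 0 then 1 else 0) else 0)" if "r \<le> k" for r
    using that by (auto simp: nth_append)
  have mid: "map (\<lambda>r. ((tape_contents w i # map (\<lambda>r. if g r = 0 then 1 else 0) [0..<k] @ [0]) ! Suc r,
       if a = Inc r then Right else if a = Dec r \<and>
       (tape_contents w i # map (\<lambda>r. if g r = 0 then 1 else 0) [0..<k] @ [0]) ! Suc r \<noteq> 1 then Left else Stay)) [0..<k]
    = map (\<lambda>r. (if g r = 0 then 1 else 0, if a = Inc r then Right else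
       if a = Dec r \<and> g r \<noteq> 0 then Left else Stay)) [0..<k]"
    by (rule map_cong) (use nth in \<open>auto simp: nth_append\<close>)
  have head: "tape_act (tape_contents w i, case a of In d \<Rightarrow> d | _ \<Rightarrow> Stay) (tape_contents w, i) =
      (tape_contents w, fst (snd (act_store a (g, i, out))))"
    by (cases a) auto
  have last: "tape_act (case a of Out b \<Rightarrow> (if b then 2 else 1, Right) | _ \<Rightarrow> (0, Stay))
      (tape_contents out, int (length out)) =
      (let out' = snd (snd (act_store a (g, i, out))) in (tape_contents out', int (length out')))"
    using tape_contents_snoc[of out] out by (cases a) (auto simp: Let_def)
  obtain g' i' out' where s': "act_store a (g, i, out) = (g', i', out')"
    by (cases "act_store a (g, i, out)")
  have k: "(tape_contents w i # map (\<lambda>r. if g r = 0 then 1 else 0) [0..<k] @ [0]) ! Suc k = 0"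
    by (simp add: nth_append)
  show ?thesis
    unfolding tape_acts_def mid k s' cmd_config.simps snd_conv
    by (simp only: zip_Cons_Cons list.map zip_append length_map map_append zip prod.case zip_Nil
        regs nth_Cons_0 head last) (simp add: s' Let_def del: tape_act.simps)
qed

definition num_fun :: "cmd \<Rightarrow> cmd \<Rightarrow> nat" where
  "num_fun c = (SOME f. bij_betw f (derivs c) {..<card (derivs c)})"

lemma num_fun: "bij_betw (num_fun c) (derivs c) {..<card (derivs c)}"
  unfolding num_fun_def
  by (rule someI_ex[of "\<lambda>f. bij_betw f (derivs c) {..<card (derivs c)}"]) (use ex_bij_betw_finite_nat[OF finite_derivs, of c] in \<open>simp add: atLeast0LessThan\<close>)

lemma cmd_config_reads:
  "map tape_read (snd (cmd_config w k num (c, g, i, out))) =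
   tape_contents w i # map (\<lambda>r. if g r = 0 then 1 else 0) [0..<k] @ [0]"
  by (simp add: reg_tape_def tape_contents_def)

text \<open>Exact lock-step, halting included: a register tape shows 1 iff its counter is 0, so
  \<open>next_cmd\<close> gets arguments on both sides that agree on all registers of the
  command.\<close>

lemma cmd_tm_step:
  assumes "c' \<in> derivs c" "regs c \<subseteq> {..<k}"
  defines "M \<equiv> cmd_tm k c (num_fun c)"
  shows "tm_step M (cmd_config w k (num_fun c) (c', s)) =
    map_option (cmd_config w k (num_fun c)) (cmd_step w (c', s))"
proof -
  obtain g i out where s: "s = (g, i, out)" by (cases s)
  define ss where "ss = tape_contents w i # map (\<lambda>r. if g r = 0 then 1 else 0) [0..<k] @ [0::nat]"
  have inv: "the_inv_into (derivs c) (num_fun c) (num_fun c c') = c'"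
    using num_fun assms(1) by (metis bij_betw_imp_inj_on the_inv_into_f_f)
  have nx: "next_cmd (\<lambda>r. ss ! Suc r = 1) (ss ! 0) c' = next_cmd (\<lambda>r. g r = 0) (tape_contents w i) c'"
  proof (simp add: ss_def, rule next_cmd_cong)
    fix r assume "r \<in> regs c'"
    with derivs_regs[OF assms(1)] assms(2) have "r < k" by blast
    then show "((map (\<lambda>r. if g r = 0 then 1 else 0) [0..<k] @ [0]) ! r = Suc 0) = (g r = 0)"
      by (simp add: nth_append)
  qed
  have reads: "map tape_read (snd (cmd_config w k (num_fun c) (c', s))) = ss"
    unfolding s cmd_config_reads ss_def ..
  show ?thesis
  proof (cases "next_cmd (\<lambda>r. g r = 0) (tape_contents w i) c'")
    case None
    then show ?thesis
      using reads nx inv by (simp add: s M_def cmd_tm_def)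
  next
    case (Some x)
    then obtain a c'' where x: "next_cmd (\<lambda>r. g r = 0) (tape_contents w i) c' = Some (a, c'')"
      by (cases x) auto
    have "act_regs a \<subseteq> {..<k}"
      using next_cmd_regs[OF x] derivs_regs[OF assms(1)] assms(2) by blast
    from tape_acts_correct[OF this, of w i g out, folded ss_def]
    show ?thesis
      using reads nx inv x by (cases "act_store a (g, i, out)") (simp add: s M_def cmd_tm_def)
  qed
qed

lemma cmd_tm_run:
  assumes "exec w n x y"
  assumes "fst x \<in> derivs c" "regs c \<subseteq> {..<k}"
  defines "M \<equiv> cmd_tm k c (num_fun c)"
  assumes "tm_run M w n0 = cmd_config w k (num_fun c) x"
  shows "tm_run M w (n0 + n) = cmd_config w k (num_fun c) y"
  using assms(1,2,5)
proof (induction arbitrary: n0 rule: exec.induct)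
  case (step x y n z)
  obtain c' s where x: "x = (c', s)" by (cases x)
  have "fst y \<in> derivs c"
    using step.hyps(1) step.prems(1) derivs_next unfolding x
    by (cases s) (fastforce split: option.splits)
  moreover have "tm_run M w (Suc n0) = cmd_config w k (num_fun c) y"
    using step.prems(2) step.hyps(1) cmd_tm_step[OF _ assms(3), of c' w s] step.prems(1)
    unfolding x M_def by simp
  ultimately show ?case
    using step.IH[of "Suc n0"] by simp
qed simp

lemma cmd_tm_initial:
  "tm_run (cmd_tm k c (num_fun c)) w 1 = cmd_config w k (num_fun c) (c, (\<lambda>_. 0), 0, [])"
proof -
  have rep: "replicate (Suc k) a = replicate k a @ [a]" for a :: tape
    by (simp add: replicate_append_same)
  have init: "tm_initial (cmd_tm k c (num_fun c)) w =
      (0, (tape_contents w, 0) # replicate k (tape_contents [], 0) @ [(tape_contents [], 0)])"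
    by (simp only: tm_initial_def cmd_tm_def tm.simps add_2_eq_Suc' diff_Suc_1 rep)
  have blank: "tape_contents [] = (\<lambda>_. 0)"
    by (rule ext) (simp add: tape_contents_def)
  have mark: "(\<lambda>_. 0 :: nat)(0 := 1) = (\<lambda>j. if j = 0 then 1 else (0 :: nat))"
    by (rule ext) simp
  have trans: "tm_trans (cmd_tm k c (num_fun c)) 0 ss =
      Some (Suc (num_fun c c), (ss ! 0, Stay) # replicate k (1, Stay) @ [(ss ! Suc k, Stay)])" for ss
    by (simp add: cmd_tm_def)
  have zip: "map2 tape_act (replicate k a) (replicate k b) = replicate k (tape_act a b)" for a b
    by (simp add: zip_replicate map_replicate)
  show ?thesis
    unfolding One_nat_def tm_run.simps init tm_step.simps trans
    by (simp add: zip blank mark reg_tape_def zip_append map_replicate_const nth_append fun_eq_iff del: zip_replicate)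
qed

lemma wf_cmd_tm: "wf_tm (cmd_tm k c (num_fun c))"
proof -
  have sym: "ss ! r < 3" if "length ss = k + 2" "\<forall>s\<in>set ss. s < 3" "r < k + 2" for ss :: "nat list" and r
    using that by simp
  have lt: "num_fun c c' < card (derivs c)" if "c' \<in> derivs c" for c'
    using num_fun[of c] that by (auto simp: bij_betw_def)
  have inv: "the_inv_into (derivs c) (num_fun c) q \<in> derivs c" if "q < card (derivs c)" for q
    using num_fun[of c] that by (auto simp: bij_betw_def intro!: the_inv_into_into)
  define M where M: "M = cmd_tm k c (num_fun c)"
  have tapes: "tm_tapes M = k + 2" "tm_symbols M = 3" "tm_states M = Suc (card (derivs c))"
    by (simp_all add: M cmd_tm_def)
  have "q' < tm_states M \<and> length acts = k + 2 \<and> (\<forall>(s, d) \<in> set acts. s < 3)"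
    if q: "q < tm_states M" and ss: "length ss = k + 2" "\<forall>s\<in>set ss. s < 3"
      and tr: "tm_trans M q ss = Some (q', acts)" for q ss q' acts
  proof (cases "q = 0")
    case True
    then show ?thesis
      using tr ss sym[OF ss, of 0] sym[OF ss, of "Suc k"] lt[OF derivs_self] unfolding M cmd_tm_def by auto
  next
    case False
    let ?c = "the_inv_into (derivs c) (num_fun c) (q - 1)"
    obtain a c' where nx: "next_cmd (\<lambda>r. ss ! Suc r = 1) (ss ! 0) ?c = Some (a, c')"
      and acts: "q' = Suc (num_fun c c')" "acts = tape_acts k a ss"
      using tr False unfolding M cmd_tm_def by (auto split: option.splits)
    have "?c \<in> derivs c"
      by (rule inv) (use q False in \<open>auto simp: M cmd_tm_def\<close>)
    from derivs_next[OF this nx] have "c' \<in> derivs c" .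
    moreover have "\<forall>(s, d) \<in> set acts. s < 3"
      using sym[OF ss] unfolding acts tape_acts_def by (auto split: act.splits)
    ultimately show ?thesis
      using lt by (simp add: acts tape_acts_def M cmd_tm_def)
  qed
  note step = this
  have "q' < tm_states M \<and> length acts = tm_tapes M \<and> (\<forall>(s, d) \<in> set acts. s < tm_symbols M)"
    if "q < tm_states M \<and> length ss = tm_tapes M \<and> (\<forall>s \<in> set ss. s < tm_symbols M) \<and>
      tm_trans M q ss = Some (q', acts)" for q ss q' acts
    using step[of q ss q' acts] that unfolding tapes(1,2) by blast
  moreover have "1 \<le> tm_tapes M" "3 \<le> tm_symbols M" "1 \<le> tm_states M"
    by (simp_all add: tapes)
  ultimately show ?thesis
    unfolding wf_tm_def M[symmetric] by blast
qed

theorem runs_poly_time_computable: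
  assumes "\<And>w. \<exists>g i. runs w c ((\<lambda>_. 0), 0, []) (poly p (length w)) (g, i, f w)"
  shows "poly_time_computable f"
proof -
  obtain k where k: "regs c \<subseteq> {..<k}"
    using finite_nat_set_iff_bounded[of "regs c"] finite_regs by blast
  define M where "M = cmd_tm k c (num_fun c)"
  \<comment> \<open>The added step is the one that writes the marks.\<close>
  have "\<exists>n \<le> poly (p + 1) (length w).
      tm_halted M w n \<and> fst (last (snd (tm_run M w n))) = tape_contents (f w)" for w
  proof -
    obtain n g i where n: "n \<le> poly p (length w)"
      and ex: "exec w n (c, (\<lambda>_. 0), 0, []) (Skip, g, i, f w)"
      using assms unfolding runs_def by blast
    have run: "tm_run M w (1 + n) = cmd_config w k (num_fun c) (Skip, g, i, f w)"
      unfolding M_def by (rule cmd_tm_run[OF ex _ k]) (simp_all only: derivs_self cmd_tm_initial fst_conv)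
    have "Skip \<in> derivs c"
      by (induction c) auto
    from cmd_tm_step[OF this k, of w "(g, i, f w)"] have "tm_halted M w (1 + n)"
      unfolding tm_halted_def run unfolding M_def by simp
    then show ?thesis
      using run n by (intro exI[of _ "1 + n"]) simp
  qed
  then show ?thesis
    unfolding poly_time_computable_def using wf_cmd_tm M_def by blast
qed

section \<open>Arithmetic expressions as counter programs\<close>

datatype exp = Const nat | Var nat | Add exp exp | Mul exp exp | Sub exp exp

fun eval :: "exp \<Rightarrow> (nat \<Rightarrow> nat) \<Rightarrow> nat" where
  "eval (Const n) g = n"
| "eval (Var v) g = g v"
| "eval (Add e1 e2) g = eval e1 g + eval e2 g"
| "eval (Mul e1 e2) g = eval e1 g * eval e2 g"
| "eval (Sub e1 e2) g = eval e1 g - eval e2 g"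

fun vars :: "exp \<Rightarrow> nat set" where
  "vars (Const n) = {}"
| "vars (Var v) = {v}"
| "vars (Add e1 e2) = vars e1 \<union> vars e2"
| "vars (Mul e1 e2) = vars e1 \<union> vars e2"
| "vars (Sub e1 e2) = vars e1 \<union> vars e2"

lemma eval_cong: "(\<And>v. v \<in> vars e \<Longrightarrow> g v = h v) \<Longrightarrow> eval e g = eval e h"
  by (induction e) auto

text \<open>Values of expressions become loop counts, so polynomial running time needs them to be
  polynomial in the variables. For \<open>Sub\<close> the bound of the minuend is enough.\<close>

lemma eval_poly_bound: "\<exists>p :: nat poly. \<forall>g m. (\<forall>v \<in> vars e. g v \<le> m) \<longrightarrow> eval e g \<le> poly p m"
proof (induction e)
  case (Const n)
  show ?case by (rule exI[of _ "[:n:]"]) simp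
next
  case (Var v)
  show ?case by (rule exI[of _ "[:0, 1:]"]) simp
next
  case (Add e1 e2)
  then obtain p q :: "nat poly" where "\<forall>g m. (\<forall>v \<in> vars e1. g v \<le> m) \<longrightarrow> eval e1 g \<le> poly p m"
    "\<forall>g m. (\<forall>v \<in> vars e2. g v \<le> m) \<longrightarrow> eval e2 g \<le> poly q m" by blast
  then show ?case by (intro exI[of _ "p + q"]) (auto intro: add_mono)
next
  case (Mul e1 e2)
  then obtain p q :: "nat poly" where "\<forall>g m. (\<forall>v \<in> vars e1. g v \<le> m) \<longrightarrow> eval e1 g \<le> poly p m"
    "\<forall>g m. (\<forall>v \<in> vars e2. g v \<le> m) \<longrightarrow> eval e2 g \<le> poly q m" by blast
  then show ?case by (intro exI[of _ "p * q"]) (auto intro: mult_mono)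
next
  case (Sub e1 e2)
  then obtain p :: "nat poly" where "\<forall>g m. (\<forall>v \<in> vars e1. g v \<le> m) \<longrightarrow> eval e1 g \<le> poly p m" by blast
  then show ?case by (intro exI[of _ p]) (auto intro: le_trans[OF diff_le_self])
qed

definition move_reg :: "nat \<Rightarrow> cmd \<Rightarrow> cmd" where
  "move_reg r c = While r (Seq (Do (Dec r)) c)"

lemma runs_move_reg:
  assumes step: "\<And>j. j < fst s r \<Longrightarrow> runs w c (act_store (Dec r) (f j)) b (f (Suc j))"
    and r: "\<And>j. j \<le> fst s r \<Longrightarrow> fst (f j) r = fst s r - j"
    and f: "f 0 = s" "f (fst s r) = s'"
  shows "runs w (move_reg r c) s (fst s r * (b + 4) + 1) s'"
proof -
  have "runs w (move_reg r c) (f 0) (fst s r * ((1 + b + 1) + 2) + 1) (f (fst s r))"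
    unfolding move_reg_def
  proof (rule runs_While)
    fix i assume "i < fst s r"
    then show "fst (f i) r \<noteq> 0 \<and> runs w (Seq (Do (Dec r)) c) (f i) (1 + b + 1) (f (Suc i))"
      using r[of i] runs_Seq[OF runs_Do[OF HOL.refl] step] by simp
  qed (use r in simp)
  then show ?thesis
    using f by (auto elim!: runs_mono simp: algebra_simps)
qed

text \<open>Adds the value to \<open>t\<close>, using the registers from \<open>k\<close> on as zero
  scratch space and leaving them zero. Reading a counter destroys it, hence a variable is moved to
  \<open>k\<close> and then back while \<open>t\<close> is incremented. Products are repeated
  additions; for a difference the second operand is counted down together with the first.\<close>

fun comp_exp :: "exp \<Rightarrow> nat \<Rightarrow> nat \<Rightarrow> cmd" where
  "comp_exp (Const n) t k = foldr (\<lambda>_ c. Seq (Do (Inc t)) c) [0..<n] (Do Idle)"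
| "comp_exp (Var v) t k = Seq (move_reg v (Do (Inc k))) (move_reg k (Seq (Do (Inc v)) (Do (Inc t))))"
| "comp_exp (Add e1 e2) t k = Seq (comp_exp e1 t k) (comp_exp e2 t k)"
| "comp_exp (Mul e1 e2) t k = Seq (comp_exp e1 k (k + 1)) (move_reg k (comp_exp e2 t (k + 1)))"
| "comp_exp (Sub e1 e2) t k = Seq (comp_exp e1 k (k + 2)) (Seq (comp_exp e2 (k + 1) (k + 2))
     (Seq (move_reg (k + 1) (Do (Dec k))) (move_reg k (Do (Inc t)))))"

lemma runs_const:
  "runs w (foldr (\<lambda>_ c. Seq (Do (Inc t)) c) xs (Do Idle)) (g, io) (2 * length xs + 1)
     (g(t := g t + length xs), io)"
proof (induction xs arbitrary: g)
  case Nil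
  then show ?case using runs_Do[of Idle] by simp
next
  case (Cons a xs)
  have "runs w (Seq (Do (Inc t)) (foldr (\<lambda>_ c. Seq (Do (Inc t)) c) xs (Do Idle))) (g, io)
     (1 + (2 * length xs + 1) + 1) ((g(t := g t + 1))(t := (g(t := g t + 1)) t + length xs), io)"
    by (rule runs_Seq[OF _ Cons]) (cases io, rule runs_Do, simp add: fun_upd_def)
  then show ?case by (simp del: fun_upd_apply add: fun_upd_same)
qed

text \<open>\<open>m\<close> bounds the variables below \<open>n\<close> only: the running time must
  not depend on what \<open>t\<close> already contains, because a product calls the code of its
  second factor repeatedly on a growing \<open>t\<close>.\<close>

definition adds_value :: "nat \<Rightarrow> exp \<Rightarrow> nat \<Rightarrow> nat \<Rightarrow> nat poly \<Rightarrow> bool" where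
  "adds_value n e t k p \<longleftrightarrow> (\<forall>w g io m. (\<forall>v<n. g v \<le> m) \<longrightarrow> (\<forall>r\<ge>k. g r = 0) \<longrightarrow>
     runs w (comp_exp e t k) (g, io) (poly p m) (g(t := g t + eval e g), io))"

lemma adds_valueD:
  assumes "adds_value n e t k p" "\<And>v. v < n \<Longrightarrow> g v \<le> m" "\<And>r. r \<ge> k \<Longrightarrow> g r = 0"
  shows "runs w (comp_exp e t k) (g, io) (poly p m) (g(t := g t + eval e g), io)"
  using assms unfolding adds_value_def by blast

lemma comp_exp_correct:
  assumes "vars e \<subseteq> {..<n}" "n \<le> t" "t < k"
  shows "\<exists>p. adds_value n e t k p"
  using assms
proof (induction e arbitrary: t k)
  case (Const c)
  show ?case
    using runs_const[of _ t "[0..<c]"]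
    by (intro exI[of _ "[:2 * c + 1:]"]) (simp add: adds_value_def del: fun_upd_apply)
next
  case (Var v)
  show ?case
  proof (rule exI[of _ "[:3, 12:]"], unfold adds_value_def, intro allI impI)
    fix w m and g :: "nat \<Rightarrow> nat" and io :: "int \<times> bool list"
    assume h: "\<forall>v<n. g v \<le> m" "\<forall>r\<ge>k. g r = 0"
    note a = Var.prems h
    from a have d: "v \<noteq> t" "t \<noteq> k" "v \<noteq> k" "g k = 0" and le: "g v \<le> m" by auto
    have 1: "runs w (move_reg v (Do (Inc k))) (g, io) (fst (g, io) v * (1 + 4) + 1) (g(v := 0, k := g v), io)"
      by (rule runs_move_reg[where f = "\<lambda>j. (g(v := g v - j, k := j), io)"])
        (cases io, rule runs_Do, use d in \<open>auto simp: fun_eq_iff\<close>)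
    have 2: "runs w (move_reg k (Seq (Do (Inc v)) (Do (Inc t)))) (g(v := 0, k := g v), io)
       (fst (g(v := 0, k := g v), io) k * ((1 + 1 + 1) + 4) + 1) (g(t := g t + g v), io)"
      by (rule runs_move_reg[where f = "\<lambda>j. (g(v := j, k := g v - j, t := g t + j), io)"])
        (cases io, rule runs_Seq[OF runs_Do[OF HOL.refl] runs_Do], use d in \<open>auto simp: fun_eq_iff\<close>)
    show "runs w (comp_exp (Var v) t k) (g, io) (poly [:3, 12:] m) (g(t := g t + eval (Var v) g), io)"
      unfolding comp_exp.simps eval.simps by (rule runs_mono[OF runs_Seq[OF 1 2]]) (use le d in simp)
  qed
next
  case (Add e1 e2)
  obtain p q where p: "adds_value n e1 t k p" and q: "adds_value n e2 t k q"
    using Add.IH(1)[of t k] Add.IH(2)[of t k] Add.prems by auto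
  show ?case
  proof (rule exI[of _ "p + q + 1"], unfold adds_value_def, intro allI impI)
    fix w m and g :: "nat \<Rightarrow> nat" and io :: "int \<times> bool list"
    assume h: "\<forall>v<n. g v \<le> m" "\<forall>r\<ge>k. g r = 0"
    note a = Add.prems h
    let ?g = "g(t := g t + eval e1 g)"
    have e2: "eval e2 ?g = eval e2 g"
      by (rule eval_cong) (use a in auto)
    have 1: "runs w (comp_exp e1 t k) (g, io) (poly p m) (?g, io)"
      using adds_valueD[OF p, of g m w io] a by simp
    have "runs w (comp_exp e2 t k) (?g, io) (poly q m) (?g(t := ?g t + eval e2 ?g), io)"
      by (rule adds_valueD[OF q]) (use a in auto)
    from runs_Seq[OF 1 this]
    show "runs w (comp_exp (Add e1 e2) t k) (g, io) (poly (p + q + 1) m) (g(t := g t + eval (Add e1 e2) g), io)"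
      unfolding e2 by (simp add: add.assoc)
  qed
next
  case (Mul e1 e2)
  obtain p q where p: "adds_value n e1 k (k + 1) p" and q: "adds_value n e2 t (k + 1) q"
    using Mul.IH(1)[of k "k + 1"] Mul.IH(2)[of t "k + 1"] Mul.prems by auto
  obtain b where b: "\<And>g m. (\<forall>v \<in> vars e1. g v \<le> m) \<Longrightarrow> eval e1 g \<le> poly b m"
    using eval_poly_bound[of e1] by blast
  show ?case
  proof (rule exI[of _ "p + b * (q + 4) + 2"], unfold adds_value_def, intro allI impI)
    fix w m and g :: "nat \<Rightarrow> nat" and io :: "int \<times> bool list"
    assume h: "\<forall>v<n. g v \<le> m" "\<forall>r\<ge>k. g r = 0"
    note a = Mul.prems h
    let ?x = "eval e1 g" and ?y = "eval e2 g"
    have x: "?x \<le> poly b m"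
      by (rule b) (use a in auto)
    have 1: "runs w (comp_exp e1 k (k+1)) (g, io) (poly p m) (g(k := ?x), io)"
      using adds_valueD[OF p, of g m w io] a by simp
    have 2: "runs w (move_reg k (comp_exp e2 t (k + 1))) (g(k := ?x), io)
       (fst (g(k := ?x), io) k * (poly q m + 4) + 1) (g(t := g t + ?x * ?y), io)"
    proof (rule runs_move_reg[where f = "\<lambda>j. (g(k := ?x - j, t := g t + j * ?y), io)"])
      fix j assume "j < fst (g(k := ?x), io) k"
      let ?g = "g(k := ?x - Suc j, t := g t + j * ?y)"
      have y: "eval e2 ?g = ?y"
        by (rule eval_cong) (use a in auto)
      have "runs w (comp_exp e2 t (k + 1)) (?g, io) (poly q m) (?g(t := ?g t + eval e2 ?g), io)"
        by (rule adds_valueD[OF q]) (use a in auto)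
      then show "runs w (comp_exp e2 t (k + 1)) (act_store (Dec k) (g(k := ?x - j, t := g t + j * ?y), io))
        (poly q m) (g(k := ?x - Suc j, t := g t + Suc j * ?y), io)"
        using a by (cases io) (simp add: y fun_upd_twist algebra_simps)
    qed (use a in \<open>auto simp: fun_eq_iff\<close>)
    have "?x * (poly q m + 4) \<le> poly b m * (poly q m + 4)"
      using x by (rule mult_right_mono) simp
    note x = this
    show "runs w (comp_exp (Mul e1 e2) t k) (g, io) (poly (p + b * (q + 4) + 2) m)
        (g(t := g t + eval (Mul e1 e2) g), io)"
      unfolding comp_exp.simps eval.simps by (rule runs_mono[OF runs_Seq[OF 1 2]]) (use x in simp)
  qed
next
  case (Sub e1 e2)
  obtain p q where p: "adds_value n e1 k (k + 2) p" and q: "adds_value n e2 (k + 1) (k + 2) q"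
    using Sub.IH(1)[of k "k + 2"] Sub.IH(2)[of "k + 1" "k + 2"] Sub.prems by auto
  obtain b c where b: "\<And>g m. (\<forall>v \<in> vars e1. g v \<le> m) \<Longrightarrow> eval e1 g \<le> poly b m"
    and c: "\<And>g m. (\<forall>v \<in> vars e2. g v \<le> m) \<Longrightarrow> eval e2 g \<le> poly c m"
    using eval_poly_bound[of e1] eval_poly_bound[of e2] by blast
  show ?case
  proof (rule exI[of _ "p + q + 5 * c + 5 * b + 6"], unfold adds_value_def, intro allI impI)
    fix w m and g :: "nat \<Rightarrow> nat" and io :: "int \<times> bool list"
    assume h: "\<forall>v<n. g v \<le> m" "\<forall>r\<ge>k. g r = 0"
    note a = Sub.prems h
    let ?x = "eval e1 g" and ?y = "eval e2 g"
    have x: "?x \<le> poly b m" and y: "?y \<le> poly c m"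
      by (rule b c; use a in auto)+
    have 1: "runs w (comp_exp e1 k (k+2)) (g, io) (poly p m) (g(k := ?x), io)"
      using adds_valueD[OF p, of g m w io] a by simp
    have y': "eval e2 (g(k := ?x)) = ?y"
      by (rule eval_cong) (use a in auto)
    have 2: "runs w (comp_exp e2 (k+1) (k+2)) (g(k := ?x), io) (poly q m) (g(k := ?x, k+1 := ?y), io)"
      using adds_valueD[OF q, of "g(k := ?x)" m w io] a y' by simp
    have 3: "runs w (move_reg (k+1) (Do (Dec k))) (g(k := ?x, k+1 := ?y), io)
       (fst (g(k := ?x, k+1 := ?y), io) (k+1) * (1 + 4) + 1) (g(k := ?x - ?y), io)"
      by (rule runs_move_reg[where f = "\<lambda>j. (g(k := ?x - j, k+1 := ?y - j), io)"])
        (cases io, rule runs_Do, use a in \<open>auto simp: fun_eq_iff\<close>)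
    have 4: "runs w (move_reg k (Do (Inc t))) (g(k := ?x - ?y), io)
       (fst (g(k := ?x - ?y), io) k * (1 + 4) + 1) (g(t := g t + (?x - ?y)), io)"
      by (rule runs_move_reg[where f = "\<lambda>j. (g(k := ?x - ?y - j, t := g t + j), io)"])
        (cases io, rule runs_Do, use a in \<open>auto simp: fun_eq_iff\<close>)
    show "runs w (comp_exp (Sub e1 e2) t k) (g, io) (poly (p + q + 5 * c + 5 * b + 6) m)
        (g(t := g t + eval (Sub e1 e2) g), io)"
      unfolding comp_exp.simps eval.simps
      by (rule runs_mono[OF runs_Seq[OF 1 runs_Seq[OF 2 runs_Seq[OF 3 4]]]]) (use x y in simp)
  qed
qed


text \<open>A program with parameter \<open>k\<close> uses the registers below \<open>k\<close> as variables. In the body of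
  a loop, register \<open>k\<close> is the index and register \<open>k + 1\<close> counts the iterations still to be
  done.\<close>

datatype prog = Emit "bool list" | Cat prog prog | Loop exp prog | IfZero exp prog prog
  | IfSym exp prog prog prog | Bin exp

fun out :: "prog \<Rightarrow> bool list \<Rightarrow> nat \<Rightarrow> (nat \<Rightarrow> nat) \<Rightarrow> bool list" where
  "out (Emit bs) w k g = bs"
| "out (Cat p q) w k g = out p w k g @ out q w k g"
| "out (Loop e p) w k g = concat (map (\<lambda>i. out p w (k + 2) (g(k := i, k + 1 := eval e g - i))) [0..<eval e g])"
| "out (IfZero e p q) w k g = (if eval e g = 0 then out p w k g else out q w k g)"
| "out (IfSym e p0 p1 p2) w k g =
     (if tape_contents w (int (eval e g)) = 0 then out p0 w k g
      else if tape_contents w (int (eval e g)) = 1 then out p1 w k g else out p2 w k g)"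
| "out (Bin e) w k g = binary (eval e g)"

fun scoped :: "nat \<Rightarrow> prog \<Rightarrow> bool" where
  "scoped k (Emit bs) \<longleftrightarrow> True"
| "scoped k (Cat p q) \<longleftrightarrow> scoped k p \<and> scoped k q"
| "scoped k (Loop e p) \<longleftrightarrow> vars e \<subseteq> {..<k} \<and> scoped (k + 2) p"
| "scoped k (IfZero e p q) \<longleftrightarrow> vars e \<subseteq> {..<k} \<and> scoped k p \<and> scoped k q"
| "scoped k (IfSym e p0 p1 p2) \<longleftrightarrow> vars e \<subseteq> {..<k} \<and> scoped k p0 \<and> scoped k p1 \<and> scoped k p2"
| "scoped k (Bin e) \<longleftrightarrow> vars e \<subseteq> {..<k}"

section \<open>Translating output programs into commands\<close>

fun emit_bits :: "bool list \<Rightarrow> cmd" where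
  "emit_bits [] = Do Idle"
| "emit_bits (b # bs) = Seq (Do (Out b)) (emit_bits bs)"

definition clear :: "nat \<Rightarrow> cmd" where
  "clear r = While r (Do (Dec r))"

definition halve :: "nat \<Rightarrow> cmd" where
  "halve k = While k (Seq (Do (Dec k))
     (Branch k (Seq (Do (Dec k)) (Do (Inc (k + 1)))) (Do (Inc (k + 2)))))"

definition emit_digit :: "nat \<Rightarrow> cmd" where
  "emit_digit k = Seq (halve k) (Seq (Branch (k + 2) (Seq (Do (Dec (k + 2))) (Do (Out True))) (Do (Out False)))
     (move_reg (k + 1) (Do (Inc k))))"

definition comp_bin :: "nat \<Rightarrow> cmd" where
  "comp_bin k = While k (emit_digit k)"

text \<open>In \<open>IfSym\<close> the symbol has to be inspected while the head is at its cell,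
  and afterwards only the control remembers it; so the rewinding, measured by the distance kept in
  \<open>k + 1\<close>, is repeated in all three branches.\<close>

fun comp_prog :: "prog \<Rightarrow> nat \<Rightarrow> cmd" where
  "comp_prog (Emit bs) k = emit_bits bs"
| "comp_prog (Cat p q) k = Seq (comp_prog p k) (comp_prog q k)"
| "comp_prog (Loop e p) k = Seq (comp_exp e (k + 1) (k + 2))
     (Seq (While (k + 1) (Seq (comp_prog p (k + 2)) (Seq (Do (Dec (k + 1))) (Do (Inc k))))) (clear k))"
| "comp_prog (IfZero e p q) k = Seq (comp_exp e k (k + 1))
     (Branch k (Seq (clear k) (comp_prog q k)) (comp_prog p k))"
| "comp_prog (IfSym e p0 p1 p2) k = Seq (comp_exp e k (k + 2))
     (Seq (move_reg k (Seq (Do (Inc (k + 1))) (Do (In Right))))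
       (let rewind = move_reg (k + 1) (Do (In Left)) in
        CaseIn (Seq rewind (comp_prog p0 k)) (Seq rewind (comp_prog p1 k)) (Seq rewind (comp_prog p2 k))))"
| "comp_prog (Bin e) k = Seq (comp_exp e k (k + 3)) (comp_bin k)"

lemma runs_emit_bits: "runs w (emit_bits bs) (g, i, u) (2 * length bs + 1) (g, i, u @ bs)"
proof (induction bs arbitrary: u)
  case Nil
  then show ?case using runs_Do[of Idle] by simp
next
  case (Cons b bs)
  have "runs w (emit_bits (b # bs)) (g, i, u) (1 + (2 * length bs + 1) + 1) (g, i, (u @ [b]) @ bs)"
    unfolding emit_bits.simps by (rule runs_Seq[OF runs_Do Cons]) simp
  then show ?case by simp
qed

lemma runs_clear: "runs w (clear r) (g, io) (g r * 3 + 1) (g(r := 0), io)"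
proof -
  have "runs w (clear r) (g(r := g r - 0), io) (g r * (1 + 2) + 1) (g(r := g r - g r), io)"
    unfolding clear_def
    by (rule runs_While[where f = "\<lambda>j. (g(r := g r - j), io)"])
      (cases io, auto intro!: runs_Do[unfolded One_nat_def] simp: fun_eq_iff)
  then have "runs w (clear r) (g, io) (g r * (1 + 2) + 1) (g(r := 0), io)"
    by simp
  then show ?thesis
    by (rule runs_mono) simp
qed

lemma runs_halve:
  assumes "g (k + 1) = 0" "g (k + 2) = 0"
  shows "runs w (halve k) (g, io) (8 * g k + 1) (g(k := 0, k + 1 := g k div 2, k + 2 := g k mod 2), io)"
  using assms
proof -
  \<comment> \<open>Only the last pass of an odd number ends in the second case: there a single
    decrement succeeds and the remainder is recorded. The number \<open>n\<close> of passes is the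
    half rounded up.\<close>
  define f where "f j = (if 2 * j \<le> g k then (g(k := g k - 2 * j, k + 1 := j), io)
     else (g(k := 0, k + 1 := g k div 2, k + 2 := g k mod 2), io))" for j
  define n where "n = (g k + 1) div 2"
  have "runs w (halve k) (f 0) (n * (6 + 2) + 1) (f n)"
    unfolding halve_def
  proof (rule runs_While)
    fix j assume j: "j < n"
    let ?g = "g(k := g k - 2 * j, k + 1 := j)"
    have f: "f j = (?g, io)"
      using j unfolding f_def n_def by auto
    have dec: "runs w (Do (Dec k)) (f j) 1 (?g(k := g k - 2 * j - 1), io)"
      unfolding f by (rule runs_Do) (cases io, simp add: fun_eq_iff)
    have "runs w (Branch k (Seq (Do (Dec k)) (Do (Inc (k + 1)))) (Do (Inc (k + 2)))) (?g(k := g k - 2 * j - 1), io)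
        4 (f (Suc j))"
    proof (cases "g k - 2 * j - 1 = 0")
      case True
      then have n: "g k = 2 * j + 1" using j unfolding n_def by linarith
      then have "runs w (Do (Inc (k + 2))) (?g(k := g k - 2 * j - 1), io) 1 (f (Suc j))"
        using assms by (intro runs_Do, cases io) (auto simp: f_def fun_eq_iff)
      then show ?thesis
        by (rule runs_mono[OF runs_Branch_zero]) (use True in simp_all)
    next
      case False
      have "runs w (Seq (Do (Dec k)) (Do (Inc (k + 1)))) (?g(k := g k - 2 * j - 1), io) (1 + 1 + 1) (f (Suc j))"
        using False by (intro runs_Seq[OF runs_Do[OF HOL.refl] runs_Do], cases io) (auto simp: f_def fun_eq_iff)
      then show ?thesis
        by (rule runs_mono[OF runs_Branch_nonzero]) (use False in simp_all)
    qed
    from runs_Seq[OF dec this] show "fst (f j) k \<noteq> 0 \<and>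
      runs w (Seq (Do (Dec k)) (Branch k (Seq (Do (Dec k)) (Do (Inc (k + 1)))) (Do (Inc (k + 2))))) (f j) 6 (f (Suc j))"
      using j unfolding f n_def by auto
  next
    show "fst (f n) k = 0"
      by (auto simp: f_def n_def)
  qed
  moreover have "f 0 = (g, io)"
    using assms by (simp add: f_def fun_eq_iff)
  moreover have "f n = (g(k := 0, k + 1 := g k div 2, k + 2 := g k mod 2), io)"
  proof (cases "even (g k)")
    case True
    then show ?thesis
      using assms by (auto simp: f_def n_def fun_eq_iff elim!: evenE)
  next
    case False
    then show ?thesis
      by (auto simp: f_def n_def elim!: oddE)
  qed
  moreover have "n * (6 + 2) + 1 \<le> 8 * g k + 1"
    by (auto simp: n_def)
  ultimately show ?thesis
    by (metis runs_mono)
qed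

lemma runs_emit_digit:
  assumes "g (k + 1) = 0" "g (k + 2) = 0"
  shows "runs w (emit_digit k) (g, i, u) (13 * g k + 8) (g(k := g k div 2), i, u @ [odd (g k)])"
proof -
  let ?h = "g(k := 0, k + 1 := g k div 2)"
  have 1: "runs w (halve k) (g, i, u) (8 * g k + 1) (?h(k + 2 := g k mod 2), i, u)"
    using runs_halve[OF assms, of w "(i, u)"] by simp
  have 2: "runs w (Branch (k + 2) (Seq (Do (Dec (k + 2))) (Do (Out True))) (Do (Out False))) (?h(k + 2 := g k mod 2), i, u)
     4 (?h, i, u @ [odd (g k)])"
  proof (cases "even (g k)")
    case True
    then have "runs w (Do (Out False)) (?h(k + 2 := g k mod 2), i, u) 1 (?h, i, u @ [odd (g k)])"
      using assms by (intro runs_Do) (auto simp: fun_eq_iff)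
    then show ?thesis
      by (rule runs_mono[OF runs_Branch_zero]) (use True in simp_all)
  next
    case False
    then have "runs w (Seq (Do (Dec (k + 2))) (Do (Out True))) (?h(k + 2 := g k mod 2), i, u) (1 + 1 + 1) (?h, i, u @ [odd (g k)])"
      using assms by (intro runs_Seq[OF runs_Do[OF HOL.refl] runs_Do]) (auto simp: fun_eq_iff)
    then show ?thesis
      by (rule runs_mono[OF runs_Branch_nonzero]) (use False in \<open>simp_all add: odd_iff_mod_2_eq_one\<close>)
  qed
  have 3: "runs w (move_reg (k + 1) (Do (Inc k))) (?h, i, u @ [odd (g k)])
      (fst (?h, i, u @ [odd (g k)]) (k + 1) * (1 + 4) + 1) (g(k := g k div 2), i, u @ [odd (g k)])"
    by (rule runs_move_reg[where f = "\<lambda>j. (g(k := j, k + 1 := g k div 2 - j), i, u @ [odd (g k)])"])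
      (rule runs_Do, use assms in \<open>auto simp: fun_eq_iff\<close>)
  show ?thesis
    unfolding emit_digit_def by (rule runs_mono[OF runs_Seq[OF 1 runs_Seq[OF 2 3]]]) simp
qed

text \<open>The digits are counted crudely by the value itself, so the bound is quadratic in the
  value. This is harmless, as the values to be printed are polynomial in the input length.\<close>

lemma runs_comp_bin:
  assumes "g (k + 1) = 0" "g (k + 2) = 0"
  shows "runs w (comp_bin k) (g, i, u) ((g k + 1) * (13 * g k + 10) + 1) (g(k := 0), i, u @ binary (g k))"
  using assms
proof (induction "g k" arbitrary: g u rule: less_induct)
  case less
  show ?case
  proof (cases "g k = 0")
    case True
    then have "cmd_step w (comp_bin k, g, i, u) = Some (Skip, g, i, u)"
      by (simp add: comp_bin_def)
    then have "runs w (comp_bin k) (g, i, u) 1 (g, i, u)"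
      by (auto simp: runs_def intro!: exI[of _ 1] exec.step[of w _ "(Skip, g, i, u)" 0, simplified] exec.refl)
    moreover have "g(k := 0) = g" "binary (g k) = []"
      using True by (auto simp: fun_eq_iff binary.simps)
    ultimately show ?thesis
      by (auto elim: runs_mono)
  next
    case False
    let ?g = "g(k := g k div 2)"
    have bin: "binary (g k) = odd (g k) # binary (g k div 2)"
      using False by (simp add: binary.simps[of "g k"])
    have "runs w (comp_bin k) (?g, i, u @ [odd (g k)]) ((?g k + 1) * (13 * ?g k + 10) + 1)
       (?g(k := 0), i, (u @ [odd (g k)]) @ binary (?g k))"
      by (rule less.hyps) (use less.prems False in auto)
    moreover have "(?g k + 1) * (13 * ?g k + 10) + 1 \<le> g k * (13 * g k + 10) + 1"
      using False by (intro add_mono mult_mono) auto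
    ultimately have "runs w (comp_bin k) (?g, i, u @ [odd (g k)]) (g k * (13 * g k + 10) + 1)
       (g(k := 0), i, u @ binary (g k))"
      unfolding bin by (auto elim: runs_mono)
    from runs_Seq[OF runs_emit_digit[OF less.prems] this]
    have "runs w (Seq (emit_digit k) (comp_bin k)) (g, i, u) (13 * g k + 8 + (g k * (13 * g k + 10) + 1) + 1)
       (g(k := 0), i, u @ binary (g k))" .
    moreover have "cmd_step w (comp_bin k, g, i, u) = Some (Seq (emit_digit k) (comp_bin k), g, i, u)"
      using False by (simp add: comp_bin_def)
    ultimately have "runs w (comp_bin k) (g, i, u) (Suc (13 * g k + 8 + (g k * (13 * g k + 10) + 1) + 1))
       (g(k := 0), i, u @ binary (g k))"
      by (metis runs_step)
    then show ?thesis
      by (rule runs_mono) (simp add: algebra_simps)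
  qed
qed


definition emits :: "nat \<Rightarrow> prog \<Rightarrow> nat poly \<Rightarrow> bool" where
  "emits k p q \<longleftrightarrow> (\<forall>w g u m. (\<forall>r<k. g r \<le> m) \<longrightarrow> (\<forall>r\<ge>k. g r = 0) \<longrightarrow>
     runs w (comp_prog p k) (g, 0, u) (poly q m) (g, 0, u @ out p w k g))"

lemma emitsI:
  assumes "\<And>w g u m. (\<And>r. r < k \<Longrightarrow> g r \<le> m) \<Longrightarrow> (\<And>r. r \<ge> k \<Longrightarrow> g r = 0) \<Longrightarrow>
     runs w (comp_prog p k) (g, 0, u) (poly q m) (g, 0, u @ out p w k g)"
  shows "emits k p q"
  using assms unfolding emits_def by blast

lemma emitsD:
  assumes "emits k p q" "\<And>r. r < k \<Longrightarrow> g r \<le> m" "\<And>r. r \<ge> k \<Longrightarrow> g r = 0"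
  shows "runs w (comp_prog p k) (g, 0, u) (poly q m) (g, 0, u @ out p w k g)"
  using assms unfolding emits_def by blast

lemma comp_prog_correct: "scoped k p \<Longrightarrow> \<exists>q. emits k p q"
proof (induction p arbitrary: k)
  case (Emit bs)
  show ?case
    by (intro exI[of _ "[:2 * length bs + 1:]"] emitsI) (use runs_emit_bits in simp)
next
  case (Cat p1 p2)
  obtain q1 q2 where q: "emits k p1 q1" "emits k p2 q2"
    using Cat.IH(1)[of k] Cat.IH(2)[of k] Cat.prems by auto
  show ?case
  proof (rule exI[of _ "q1 + q2 + 1"], rule emitsI)
    fix w u m and g :: "nat \<Rightarrow> nat"
    assume a: "\<And>r. r < k \<Longrightarrow> g r \<le> m" "\<And>r. r \<ge> k \<Longrightarrow> g r = 0"
    from runs_Seq[OF emitsD[OF q(1) a] emitsD[OF q(2) a]]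
    show "runs w (comp_prog (Cat p1 p2) k) (g, 0, u) (poly (q1 + q2 + 1) m) (g, 0, u @ out (Cat p1 p2) w k g)"
      by simp
  qed
next
  case (Loop e p)
  obtain q where q: "emits (k + 2) p q"
    using Loop.IH[of "k + 2"] Loop.prems by auto
  obtain a where a: "adds_value k e (k + 1) (k + 2) a"
    using comp_exp_correct[of e k "k + 1" "k + 2"] Loop.prems by auto
  obtain b where b: "\<And>g m. (\<forall>v \<in> vars e. g v \<le> m) \<Longrightarrow> eval e g \<le> poly b m"
    using eval_poly_bound[of e] by blast
  \<comment> \<open>Inside the body the index and the countdown are variables too. Both are at most
    the loop count, so the bound for the variables grows from \<open>m\<close> to at most
    \<open>m + poly b m\<close>.\<close>
  define Q where "Q = pcompose q ([:0, 1:] + b)"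
  have Q: "poly Q m = poly q (m + poly b m)" for m
    by (simp add: Q_def poly_pcompose)
  show ?case
  proof (rule exI[of _ "a + b * (Q + 6) + 3 * b + 4"], rule emitsI)
    fix w u m and g :: "nat \<Rightarrow> nat"
    assume h: "\<And>r. r < k \<Longrightarrow> g r \<le> m" "\<And>r. r \<ge> k \<Longrightarrow> g r = 0"
    define x where "x = eval e g"
    have x: "x \<le> poly b m"
      unfolding x_def by (rule b) (use h Loop.prems in auto)
    define body where "body i = out p w (k + 2) (g(k := i, k + 1 := x - i))" for i
    define f :: "nat \<Rightarrow> store" where "f j = (g(k := j, k + 1 := x - j), 0, u @ concat (map body [0..<j]))" for j
    have 1: "runs w (comp_exp e (k + 1) (k + 2)) (g, 0, u) (poly a m) (f 0)"
    proof -
      have "g(k + 1 := g (k + 1) + eval e g) = g(k := 0, k + 1 := x - 0)"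
        using h by (auto simp: fun_eq_iff x_def)
      with adds_valueD[OF a, of g m w "(0, u)"] h show ?thesis
        by (simp add: f_def)
    qed
    have 2: "runs w (While (k + 1) (Seq (comp_prog p (k + 2)) (Seq (Do (Dec (k + 1))) (Do (Inc k))))) (f 0)
       (x * ((poly Q m + (1 + 1 + 1) + 1) + 2) + 1) (f x)"
    proof (rule runs_While)
      fix j assume j: "j < x"
      have body: "runs w (comp_prog p (k + 2)) (f j) (poly Q m) (g(k := j, k + 1 := x - j), 0, (u @ concat (map body [0..<j])) @ body j)"
        unfolding f_def body_def Q
      proof (rule emitsD[OF q])
        fix r assume "r < k + 2"
        then consider "r < k" | "r = k" | "r = k + 1" by linarith
        then show "(g(k := j, k + 1 := x - j)) r \<le> m + poly b m"
        proof cases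
          case 1
          then show ?thesis using h(1)[of r] by simp
        qed (use j x in auto)
      qed (use h in auto)
      have "runs w (Seq (Do (Dec (k + 1))) (Do (Inc k)))
        (g(k := j, k + 1 := x - j), 0, (u @ concat (map body [0..<j])) @ body j) (1 + 1 + 1) (f (Suc j))"
        by (rule runs_Seq[OF runs_Do[OF HOL.refl] runs_Do]) (simp add: f_def fun_eq_iff)
      from runs_Seq[OF body this] show "fst (f j) (k + 1) \<noteq> 0 \<and>
          runs w (Seq (comp_prog p (k + 2)) (Seq (Do (Dec (k + 1))) (Do (Inc k)))) (f j)
            (poly Q m + (1 + 1 + 1) + 1) (f (Suc j))"
        using j by (simp add: f_def)
    qed (simp add: f_def)
    have 3: "runs w (clear k) (f x) (x * 3 + 1) (g, 0, u @ out (Loop e p) w k g)"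
    proof -
      have "g(k := x, k + 1 := 0, k := 0) = g"
        using h by (auto simp: fun_eq_iff)
      with runs_clear[of w k "g(k := x, k + 1 := x - x)" "(0, u @ concat (map body [0..<x]))"] show ?thesis
        by (simp add: f_def body_def[abs_def] x_def)
    qed
    have le: "x * (poly Q m + 6) \<le> poly b m * (poly Q m + 6)"
      by (intro mult_right_mono x) simp
    show "runs w (comp_prog (Loop e p) k) (g, 0, u) (poly (a + b * (Q + 6) + 3 * b + 4) m)
        (g, 0, u @ out (Loop e p) w k g)"
      unfolding comp_prog.simps
      by (rule runs_mono[OF runs_Seq[OF 1 runs_Seq[OF 2 3]]]) (use x le in \<open>simp add: algebra_simps\<close>)
  qed
next
  case (IfZero e p1 p2)
  obtain q1 q2 where q: "emits k p1 q1" "emits k p2 q2"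
    using IfZero.IH(1)[of k] IfZero.IH(2)[of k] IfZero.prems by auto
  obtain a where a: "adds_value k e k (k + 1) a"
    using comp_exp_correct[of e k k "k + 1"] IfZero.prems by auto
  obtain b where b: "\<And>g m. (\<forall>v \<in> vars e. g v \<le> m) \<Longrightarrow> eval e g \<le> poly b m"
    using eval_poly_bound[of e] by blast
  show ?case
  proof (rule exI[of _ "a + q1 + q2 + 3 * b + 5"], rule emitsI)
    fix w u m and g :: "nat \<Rightarrow> nat"
    assume h: "\<And>r. r < k \<Longrightarrow> g r \<le> m" "\<And>r. r \<ge> k \<Longrightarrow> g r = 0"
    define x where "x = eval e g"
    have x: "x \<le> poly b m"
      unfolding x_def by (rule b) (use h IfZero.prems in auto)
    have 1: "runs w (comp_exp e k (k + 1)) (g, 0, u) (poly a m) (g(k := x), 0, u)"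
      using adds_valueD[OF a, of g m w "(0, u)"] h by (simp add: x_def)
    have 2: "runs w (Branch k (Seq (clear k) (comp_prog p2 k)) (comp_prog p1 k)) (g(k := x), 0, u)
       (poly q1 m + poly q2 m + 3 * x + 4) (g, 0, u @ out (IfZero e p1 p2) w k g)"
    proof (cases "x = 0")
      case True
      then have "g(k := x) = g"
        using h by (auto simp: fun_eq_iff)
      then have "runs w (comp_prog p1 k) (g(k := x), 0, u) (poly q1 m) (g, 0, u @ out (IfZero e p1 p2) w k g)"
        using emitsD[OF q(1) h] True by (simp add: x_def)
      then show ?thesis
        by (rule runs_mono[OF runs_Branch_zero]) (use True in simp_all)
    next
      case False
      have "g(k := x, k := 0) = g"
        using h by (auto simp: fun_eq_iff)
      then have "runs w (clear k) (g(k := x), 0, u) (x * 3 + 1) (g, 0, u)"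
        using runs_clear[of w k "g(k := x)" "(0, u)"] by simp
      moreover have "runs w (comp_prog p2 k) (g, 0, u) (poly q2 m) (g, 0, u @ out (IfZero e p1 p2) w k g)"
        using emitsD[OF q(2) h] False by (simp add: x_def)
      ultimately show ?thesis
        by (rule runs_mono[OF runs_Branch_nonzero[OF runs_Seq]]) (use False in simp_all)
    qed
    show "runs w (comp_prog (IfZero e p1 p2) k) (g, 0, u) (poly (a + q1 + q2 + 3 * b + 5) m)
        (g, 0, u @ out (IfZero e p1 p2) w k g)"
      unfolding comp_prog.simps by (rule runs_mono[OF runs_Seq[OF 1 2]]) (use x in simp)
  qed
next
  case (IfSym e p0 p1 p2)
  obtain q0 q1 q2 where q: "emits k p0 q0" "emits k p1 q1" "emits k p2 q2"
    using IfSym.IH(1)[of k] IfSym.IH(2)[of k] IfSym.IH(3)[of k] IfSym.prems by auto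
  obtain a where a: "adds_value k e k (k + 2) a"
    using comp_exp_correct[of e k k "k + 2"] IfSym.prems by auto
  obtain b where b: "\<And>g m. (\<forall>v \<in> vars e. g v \<le> m) \<Longrightarrow> eval e g \<le> poly b m"
    using eval_poly_bound[of e] by blast
  show ?case
  proof (rule exI[of _ "a + q0 + q1 + q2 + 12 * b + 6"], rule emitsI)
    fix w u m and g :: "nat \<Rightarrow> nat"
    assume h: "\<And>r. r < k \<Longrightarrow> g r \<le> m" "\<And>r. r \<ge> k \<Longrightarrow> g r = 0"
    define x where "x = eval e g"
    have x: "x \<le> poly b m"
      unfolding x_def by (rule b) (use h IfSym.prems in auto)
    have 1: "runs w (comp_exp e k (k + 2)) (g, 0, u) (poly a m) (g(k := x), 0, u)"
      using adds_valueD[OF a, of g m w "(0, u)"] h by (simp add: x_def)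
    have 2: "runs w (move_reg k (Seq (Do (Inc (k + 1))) (Do (In Right)))) (g(k := x), 0, u)
        (fst (g(k := x), 0 :: int, u) k * ((1 + 1 + 1) + 4) + 1) (g(k + 1 := x), int x, u)"
      by (rule runs_move_reg[where f = "\<lambda>j. (g(k := x - j, k + 1 := j), int j, u)"])
        (rule runs_Seq[OF runs_Do[OF HOL.refl] runs_Do], use h in \<open>auto simp: fun_eq_iff\<close>)
    define rewind where "rewind = move_reg (k + 1) (Do (In Left))"
    have 3: "runs w rewind (g(k + 1 := x), int x, u)
        (fst (g(k + 1 := x), int x, u) (k + 1) * (1 + 4) + 1) (g, 0, u)"
      unfolding rewind_def
      by (rule runs_move_reg[where f = "\<lambda>j. (g(k + 1 := x - j), int x - int j, u)"])
        (rule runs_Do, use h in \<open>auto simp: fun_eq_iff\<close>)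
    let ?s = "tape_contents w (int x)"
    have 4: "runs w (CaseIn (Seq rewind (comp_prog p0 k)) (Seq rewind (comp_prog p1 k)) (Seq rewind (comp_prog p2 k)))
      (g(k + 1 := x), int x, u) (Suc (x * 5 + 1 + (poly q0 m + poly q1 m + poly q2 m) + 1)) (g, 0, u @ out (IfSym e p0 p1 p2) w k g)"
    proof (rule runs_CaseIn)
      have runs: "runs w (comp_prog p0 k) (g, 0, u) (poly q0 m + poly q1 m + poly q2 m) (g, 0, u @ out p0 w k g)"
        "runs w (comp_prog p1 k) (g, 0, u) (poly q0 m + poly q1 m + poly q2 m) (g, 0, u @ out p1 w k g)"
        "runs w (comp_prog p2 k) (g, 0, u) (poly q0 m + poly q1 m + poly q2 m) (g, 0, u @ out p2 w k g)"
        by (rule runs_mono[OF emitsD[OF q(1) h]] runs_mono[OF emitsD[OF q(2) h]]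
            runs_mono[OF emitsD[OF q(3) h]]; simp)+
      have "runs w (if ?s = 0 then comp_prog p0 k else if ?s = 1 then comp_prog p1 k else comp_prog p2 k)
         (g, 0, u) (poly q0 m + poly q1 m + poly q2 m) (g, 0, u @ out (IfSym e p0 p1 p2) w k g)"
        using runs by (simp add: x_def)
      note seq = runs_Seq[OF 3 this]
      have push: "(if ?s = 0 then Seq rewind (comp_prog p0 k) else if ?s = 1 then Seq rewind (comp_prog p1 k)
          else Seq rewind (comp_prog p2 k)) =
        Seq rewind (if ?s = 0 then comp_prog p0 k else if ?s = 1 then comp_prog p1 k else comp_prog p2 k)"
        by simp
      show "runs w (if tape_contents w (fst (snd (g(k + 1 := x), int x, u))) = 0 then Seq rewind (comp_prog p0 k)
          else if tape_contents w (fst (snd (g(k + 1 := x), int x, u))) = 1 then Seq rewind (comp_prog p1 k)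
          else Seq rewind (comp_prog p2 k)) (g(k + 1 := x), int x, u)
          (x * 5 + 1 + (poly q0 m + poly q1 m + poly q2 m) + 1) (g, 0, u @ out (IfSym e p0 p1 p2) w k g)"
        unfolding fst_conv snd_conv push by (rule runs_mono[OF seq]) simp
    qed
    show "runs w (comp_prog (IfSym e p0 p1 p2) k) (g, 0, u) (poly (a + q0 + q1 + q2 + 12 * b + 6) m)
        (g, 0, u @ out (IfSym e p0 p1 p2) w k g)"
      unfolding comp_prog.simps Let_def rewind_def[symmetric]
      by (rule runs_mono[OF runs_Seq[OF 1 runs_Seq[OF 2 4]]]) (use x in simp)
  qed
next
  case (Bin e)
  obtain a where a: "adds_value k e k (k + 3) a"
    using comp_exp_correct[of e k k "k + 3"] Bin.prems by auto
  obtain b where b: "\<And>g m. (\<forall>v \<in> vars e. g v \<le> m) \<Longrightarrow> eval e g \<le> poly b m"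
    using eval_poly_bound[of e] by blast
  show ?case
  proof (rule exI[of _ "a + (b + 1) * (13 * b + 10) + 2"], rule emitsI)
    fix w u m and g :: "nat \<Rightarrow> nat"
    assume h: "\<And>r. r < k \<Longrightarrow> g r \<le> m" "\<And>r. r \<ge> k \<Longrightarrow> g r = 0"
    define x where "x = eval e g"
    have x: "x \<le> poly b m"
      unfolding x_def by (rule b) (use h Bin.prems in auto)
    have 1: "runs w (comp_exp e k (k + 3)) (g, 0, u) (poly a m) (g(k := x), 0, u)"
      using adds_valueD[OF a, of g m w "(0, u)"] h by (simp add: x_def)
    have "g(k := x, k := 0) = g"
      using h by (auto simp: fun_eq_iff)
    then have 2: "runs w (comp_bin k) (g(k := x), 0, u) ((x + 1) * (13 * x + 10) + 1) (g, 0, u @ binary x)"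
      using runs_comp_bin[of "g(k := x)" k w 0 u] h by simp
    have le: "(x + 1) * (13 * x + 10) \<le> (poly b m + 1) * (13 * poly b m + 10)"
      using x by (intro mult_mono add_mono) simp_all
    show "runs w (comp_prog (Bin e) k) (g, 0, u) (poly (a + (b + 1) * (13 * b + 10) + 2) m)
        (g, 0, u @ out (Bin e) w k g)"
      unfolding comp_prog.simps out.simps x_def[symmetric]
      by (rule runs_mono[OF runs_Seq[OF 1 2]]) (use le in simp)
  qed
qed

text \<open>Walking to the first blank counts the length into register 0. Walking back uses the
  counter up, so it is copied to register 1 on the way and returned afterwards.\<close>

definition measure_input :: cmd where
  "measure_input = Seq (WhileIn (Seq (Do (Inc 0)) (Do (In Right))))
     (Seq (move_reg 0 (Seq (Do (Inc 1)) (Do (In Left)))) (move_reg 1 (Do (Inc 0))))"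

lemma runs_measure_input:
  "runs w measure_input ((\<lambda>_. 0), 0, []) (17 * length w + 5) ((\<lambda>_. 0)(0 := length w), 0, [])"
proof -
  let ?n = "length w"
  let ?z = "(\<lambda>_. 0) :: nat \<Rightarrow> nat"
  have 1: "runs w (WhileIn (Seq (Do (Inc 0)) (Do (In Right)))) (?z(0 := 0), int 0, [])
      (?n * ((1 + 1 + 1) + 2) + 1) (?z(0 := ?n), int ?n, [])"
  proof (rule runs_WhileIn[where f = "\<lambda>j. (?z(0 := j), int j, [])"])
    fix j assume "j < ?n"
    moreover have "runs w (Seq (Do (Inc 0)) (Do (In Right))) (?z(0 := j), int j, []) (1 + 1 + 1)
        (?z(0 := Suc j), int (Suc j), [])"
      by (rule runs_Seq[OF runs_Do[OF HOL.refl] runs_Do]) (simp add: fun_eq_iff)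
    ultimately show "tape_contents w (fst (snd (?z(0 := j), int j, [] :: bool list))) \<noteq> 0 \<and>
        runs w (Seq (Do (Inc 0)) (Do (In Right))) (?z(0 := j), int j, []) (1 + 1 + 1)
        (?z(0 := Suc j), int (Suc j), [])"
      by (simp add: tape_contents_def)
  qed (simp add: tape_contents_def)
  have 2: "runs w (move_reg 0 (Seq (Do (Inc 1)) (Do (In Left)))) (?z(0 := ?n), int ?n, [])
      (fst (?z(0 := ?n), int ?n, [] :: bool list) 0 * ((1 + 1 + 1) + 4) + 1) (?z(1 := ?n), 0, [])"
    by (rule runs_move_reg[where f = "\<lambda>j. (?z(0 := ?n - j, 1 := j), int ?n - int j, [])"])
      (rule runs_Seq[OF runs_Do[OF HOL.refl] runs_Do], auto simp: fun_eq_iff)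
  have 3: "runs w (move_reg 1 (Do (Inc 0))) (?z(1 := ?n), 0, [])
      (fst (?z(1 := ?n), 0 :: int, [] :: bool list) 1 * (1 + 4) + 1) (?z(0 := ?n), 0, [])"
    by (rule runs_move_reg[where f = "\<lambda>j. (?z(1 := ?n - j, 0 := j), 0, [])"])
      (rule runs_Do, auto simp: fun_eq_iff)
  have "?z(0 := 0) = ?z"
    by (simp add: fun_eq_iff)
  with 1 have "runs w (WhileIn (Seq (Do (Inc 0)) (Do (In Right)))) (?z, 0, [])
      (?n * ((1 + 1 + 1) + 2) + 1) (?z(0 := ?n), int ?n, [])"
    by (simp only: of_nat_0)
  from runs_Seq[OF this runs_Seq[OF 2 3]] show ?thesis
    unfolding measure_input_def by (rule runs_mono) simp
qed

theorem prog_poly_time_computable: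
  assumes "scoped 1 p"
  shows "poly_time_computable (\<lambda>w. out p w 1 ((\<lambda>_. 0)(0 := length w)))"
proof -
  obtain q where q: "emits 1 p q"
    using comp_prog_correct[OF assms] by blast
  have "runs w (comp_prog p 1) ((\<lambda>_. 0)(0 := length w), 0, []) (poly q (length w))
    ((\<lambda>_. 0)(0 := length w), 0, [] @ out p w 1 ((\<lambda>_. 0)(0 := length w)))" for w
    by (rule emitsD[OF q]) auto
  then have "\<exists>g i. runs w (Seq measure_input (comp_prog p 1)) ((\<lambda>_. 0), 0, []) (poly ([:6, 17:] + q) (length w))
    (g, i, out p w 1 ((\<lambda>_. 0)(0 := length w)))" for w
    by (intro exI runs_mono[OF runs_Seq[OF runs_measure_input]]) auto
  then show ?thesis
    by (rule runs_poly_time_computable)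
qed

section \<open>Level automata\<close>

lemma fdfa_accepts_iff:
  assumes "saturated F" "duo_normalized F u v"
  shows "fdfa_accepts F u v \<longleftrightarrow> accepts (progress_of F u) v"
proof -
  have "decomposition F (u \<frown> v\<^sup>\<omega>) u v"
    using assms(2) by (simp add: decomposition_def duo_normalized_def normalized_def)
  then show ?thesis
    using assms unfolding fdfa_accepts_def saturated_def by blast
qed

lemma nth_concat_replicate:
  "j < k * length y \<Longrightarrow> concat (replicate k y) ! j = y ! (j mod length y)"
proof (induction k arbitrary: j)
  case (Suc k)
  show ?case
  proof (cases "j < length y")
    case False
    then have "concat (replicate k y) ! (j - length y) = y ! ((j - length y) mod length y)"
      using Suc.prems by (intro Suc.IH) auto
    then show ?thesis
      using False by (simp add: nth_append le_mod_geq)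
  qed (simp add: nth_append)
qed simp

lemma length_concat_replicate: "length (concat (replicate k y)) = k * length y"
  by (induction k) auto

text \<open>Both powers have length \<open>length y * length y'\<close>, a common multiple of the
  periods. The tails of the word from \<open>length x\<close> and from \<open>length x'\<close> are
  periodic with this length, so the second block is the first one rotated by
  \<open>length x' - length x\<close>.\<close>

lemma periods_conjugate:
  fixes x y x' y' :: "'a list"
  assumes "x \<frown> y\<^sup>\<omega> = x' \<frown> y'\<^sup>\<omega>" "y \<noteq> []" "y' \<noteq> []" "length x \<le> length x'"
  obtains \<alpha> \<beta> where "concat (replicate (length y') y) = \<alpha> @ \<beta>"
    "concat (replicate (length y) y') = \<beta> @ \<alpha>"
proof -
  define n n' K where "n = length y" and "n' = length y'" and "K = n * n'"
  define Y Y' where "Y = concat (replicate n' y)" and "Y' = concat (replicate n y')"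
  have pos: "0 < n" "0 < n'" "0 < K"
    using assms by (auto simp: n_def n'_def K_def)
  have len: "length Y = K" "length Y' = K"
    by (auto simp: Y_def Y'_def length_concat_replicate K_def n_def n'_def)
  have y: "(x \<frown> y\<^sup>\<omega>) (length x + j) = y ! (j mod n)" for j
    using assms(2) by (simp add: conc_def iter_def n_def)
  have y': "(x' \<frown> y'\<^sup>\<omega>) (length x' + j) = y' ! (j mod n')" for j
    using assms(3) by (simp add: conc_def iter_def n'_def)
  define d where "d = length x' - length x"
  have "Y' = rotate d Y"
  proof (rule nth_equalityI)
    fix j assume "j < length Y'"
    then have j: "j < K" using len by simp
    have "Y' ! j = y' ! (j mod n')"
      unfolding Y'_def n'_def using j by (intro nth_concat_replicate) (simp add: K_def n'_def)
    also have "\<dots> = (x \<frown> y\<^sup>\<omega>) (length x + (d + j))"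
      using y'[of j] assms by (simp add: d_def)
    also have "\<dots> = y ! ((d + j) mod n)"
      by (rule y)
    also have "(d + j) mod n = ((d + j) mod K) mod n"
      by (simp add: K_def mod_mod_cancel)
    also have "y ! (((d + j) mod K) mod n) = Y ! ((d + j) mod K)"
      unfolding Y_def n_def using pos
      by (intro nth_concat_replicate[symmetric]) (metis K_def mod_less_divisor mult.commute n_def)
    also have "\<dots> = rotate d Y ! j"
      using j len by (simp add: nth_rotate)
    finally show "Y' ! j = rotate d Y ! j" .
  qed (simp add: len)
  then have "Y' = drop (d mod K) Y @ take (d mod K) Y"
    by (simp add: rotate_drop_take len)
  then show ?thesis
    using that[of "take (d mod K) Y" "drop (d mod K) Y"] by (simp add: Y_def Y'_def n_def n'_def)
qed

datatype pstate = Start | At nat nat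

text \<open>The components share \<open>S\<close> as absorbing failure state. It doubles as the
  failure mark of a level, whether a component got stuck inside a block or a finished block was
  rejected. Letters below \<open>2 * W\<close> are priorities, the others actions.\<close>

locale level_automaton =
  fixes W S m :: nat and \<delta> :: "nat \<Rightarrow> nat \<Rightarrow> nat \<Rightarrow> nat" and \<iota> :: "nat \<Rightarrow> nat" and A :: "nat set"
  assumes \<delta>_le: "\<delta> c a s \<le> S"
    and \<delta>_fail: "\<delta> c a S = S"
    and \<iota>_less: "\<iota> c < S"
    and A_less: "s \<in> A \<Longrightarrow> s < S"
    and W_pos: "1 < W"
    and m_ge: "2 * W \<le> m"
begin

definition accepted :: "nat \<Rightarrow> nat list \<Rightarrow> bool" where
  "accepted c x \<longleftrightarrow> foldl (\<lambda>s a. \<delta> c a s) (\<iota> c) x \<in> A"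

text \<open>A priority up to the level closes a block, which is then judged; a larger one drops the
  open block without judging it, along with any earlier failure. Levels \<open>2 * c\<close> and
  \<open>2 * c + 1\<close> run the same component \<open>c\<close> and differ in the parity that
  \<open>status\<close> looks at.\<close>

fun pstep :: "pstate \<Rightarrow> nat \<Rightarrow> pstate" where
  "pstep Start a = (if a < 2 * W then At a (\<iota> (a div 2)) else Start)"
| "pstep (At l s) a =
    (if a < 2 * W then if l < a then At a (\<iota> (a div 2)) else At l (if s \<in> A then \<iota> (l div 2) else S)
     else At l (\<delta> (l div 2) a s))"

abbreviation prun :: "pstate \<Rightarrow> nat list \<Rightarrow> pstate" where
  "prun \<equiv> foldl pstep"

fun status :: "pstate \<Rightarrow> bool" where
  "status Start = False"
| "status (At l s) \<longleftrightarrow> even l \<and> s \<noteq> S"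

fun valid :: "pstate \<Rightarrow> bool" where
  "valid Start = True"
| "valid (At l s) \<longleftrightarrow> l < 2 * W \<and> s \<le> S"

lemma valid_pstep: "valid p \<Longrightarrow> valid (pstep p a)"
  using \<iota>_less \<delta>_le by (cases p) (auto simp: less_imp_le)

lemma valid_prun: "valid p \<Longrightarrow> valid (prun p v)"
  by (induction v arbitrary: p) (auto simp: valid_pstep)

lemma A_not_S: "S \<notin> A"
  using A_less by blast

lemma prun_fail: "\<forall>a \<in> set v. a < 2 * W \<longrightarrow> a \<le> l \<Longrightarrow> prun (At l S) v = At l S"
  by (induction v) (auto simp: \<delta>_fail A_not_S)

lemma prun_level: "\<forall>a \<in> set v. a < 2 * W \<longrightarrow> a \<le> l \<Longrightarrow> \<exists>s'. prun (At l s) v = At l s'"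
  by (induction v arbitrary: s) auto

lemma prun_At_mono: "prun (At l s) v = p \<Longrightarrow>
   \<exists>l' s'. p = At l' s' \<and> l \<le> l' \<and> (l' = l \<or> (l' \<in> set v \<and> l' < 2 * W)) \<and> (\<forall>a \<in> set v. a < 2 * W \<longrightarrow> a \<le> l')"
proof (induction v arbitrary: l s)
  case (Cons a v)
  obtain l1 s1 where 1: "pstep (At l s) a = At l1 s1" "l \<le> l1" "a < 2 * W \<Longrightarrow> a \<le> l1"
    "l1 = l \<or> (l1 = a \<and> a < 2 * W)"
    by (cases "a < 2 * W"; cases "l < a") auto
  with Cons.prems have "prun (At l1 s1) v = p"
    by simp
  from Cons.IH[OF this] 1 show ?case
    by fastforce
qed auto

lemma prun_Start:
  "prun Start v = At l s \<Longrightarrow> l \<in> set v \<and> l < 2 * W \<and> (\<forall>a \<in> set v. a < 2 * W \<longrightarrow> a \<le> l)"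
proof (induction v)
  case (Cons a v)
  show ?case
  proof (cases "a < 2 * W")
    case True
    with Cons.prems have "prun (At a (\<iota> (a div 2))) v = At l s"
      by simp
    from prun_At_mono[OF this] True show ?thesis by auto
  next
    case False
    with Cons show ?thesis by auto
  qed
qed simp

lemma prun_Start_no_priority: "prun Start v = Start \<longleftrightarrow> (\<forall>a \<in> set v. \<not> a < 2 * W)"
proof (induction v)
  case (Cons a v)
  show ?case
  proof (cases "a < 2 * W")
    case True
    then have "prun Start (a # v) = prun (At a (\<iota> (a div 2))) v" by simp
    then show ?thesis using prun_At_mono[OF HOL.refl, of a "\<iota> (a div 2)" v] True by force
  next
    case False
    then show ?thesis using Cons by simp
  qed
qed simp

text \<open>After the first occurrence of the maximal priority, a run does not depend on where it
  started, unless it fails.\<close>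

lemma prun_from_any:
  assumes "prun Start v = At l s" "p = Start \<or> (\<exists>k r. p = At k r \<and> k \<le> l)"
  shows "prun p v = At l s \<or> prun p v = At l S"
proof -
  have l: "l \<in> set v" "l < 2 * W" "\<forall>a \<in> set v. a < 2 * W \<longrightarrow> a \<le> l"
    using prun_Start[OF assms(1)] by auto
  obtain u z where v: "v = u @ l # z" "l \<notin> set u"
    using l(1) by (meson split_list_first)
  have u: "q = Start \<or> (\<exists>k r. q = At k r \<and> k \<le> l) \<Longrightarrow>
      prun q u = Start \<or> (\<exists>k r. prun q u = At k r \<and> k \<le> l)" for q
  proof (cases q)
    case Start
    then show ?thesis
      using prun_Start[of u] l(3) v(1) by (cases "prun Start u") auto
  next
    case (At k r)
    moreover assume "q = Start \<or> (\<exists>k r. q = At k r \<and> k \<le> l)"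
    ultimately have "k \<le> l"
      by simp
    obtain k' r' where "prun q u = At k' r'" "k' = k \<or> (k' \<in> set u \<and> k' < 2 * W)"
      using prun_At_mono[OF HOL.refl, of k r u] At by blast
    then show ?thesis
      using \<open>k \<le> l\<close> l(3) v(1) by auto
  qed
  have less: "prun Start u = Start \<or> (\<exists>k r. prun Start u = At k r \<and> k < l)"
  proof (cases "prun Start u")
    case (At k r)
    then have "k \<in> set u" "k < 2 * W"
      using prun_Start by auto
    moreover from this have "k \<le> l" "k \<noteq> l"
      using l(3) v by auto
    ultimately show ?thesis
      using At by simp
  qed simp
  then have "prun Start (u @ [l]) = At l (\<iota> (l div 2))"
    using l(2) by auto
  then have Start: "prun (At l (\<iota> (l div 2))) z = At l s"
    using assms(1) v(1) by simp
  \<comment> \<open>From \<open>p\<close> the level may already be \<open>l\<close>; then the letter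
    \<open>l\<close> closes a block and leaves either a fresh component or a failure, which no later
    letter of \<open>v\<close> can lift.\<close>
  from u[OF assms(2)] have "prun p (u @ [l]) = At l (\<iota> (l div 2)) \<or> prun p (u @ [l]) = At l S"
    using l(2) by auto
  moreover have "prun (At l S) z = At l S"
    by (rule prun_fail) (use l(3) v(1) in auto)
  ultimately show ?thesis
    using Start v(1) by auto
qed

text \<open>Reading \<open>\<beta> @ \<alpha>\<close> twice passes through
  \<open>\<alpha> @ \<beta>\<close> in the middle. Before that part the level, if any, is at most
  \<open>l\<close>, so the part fails as it does from \<open>Start\<close>, and the final
  \<open>\<alpha>\<close> contains no larger priority. Since \<open>q\<close> is stable, the double
  reading ends in \<open>q\<close>.\<close>

lemma prun_conjugate_fail:
  assumes "prun Start (\<alpha> @ \<beta>) = At l S" "prun Start (\<beta> @ \<alpha>) = q" "prun q (\<beta> @ \<alpha>) = q"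
  shows "q = At l S"
proof -
  have l: "l \<in> set (\<alpha> @ \<beta>)" "l < 2 * W" "\<forall>a \<in> set (\<alpha> @ \<beta>). a < 2 * W \<longrightarrow> a \<le> l"
    using prun_Start[OF assms(1)] by auto
  have "prun Start \<beta> = Start \<or> (\<exists>k r. prun Start \<beta> = At k r \<and> k \<le> l)"
    using prun_Start[of \<beta>] l(3) by (cases "prun Start \<beta>") auto
  from prun_from_any[OF assms(1) this] have "prun (prun Start \<beta>) (\<alpha> @ \<beta>) = At l S"
    by simp
  moreover have "prun (At l S) \<alpha> = At l S"
    by (rule prun_fail) (use l(3) in auto)
  ultimately have "prun Start (\<beta> @ (\<alpha> @ \<beta>) @ \<alpha>) = At l S"
    by simp
  then show ?thesis
    using assms(2,3) by simp
qed

text \<open>Rotations have the same letters, hence the same level, and failure carries over in both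
  directions by \<open>prun_conjugate_fail\<close>.\<close>

lemma status_conjugate:
  assumes "prun Start (\<alpha> @ \<beta>) = p" "prun p (\<alpha> @ \<beta>) = p"
    and "prun Start (\<beta> @ \<alpha>) = q" "prun q (\<beta> @ \<alpha>) = q"
  shows "status p = status q"
proof (cases p)
  case Start
  then have "\<forall>a \<in> set (\<alpha> @ \<beta>). \<not> a < 2 * W"
    using assms(1) prun_Start_no_priority by blast
  then have "prun Start (\<beta> @ \<alpha>) = Start"
    unfolding prun_Start_no_priority by auto
  then show ?thesis using Start assms(3) by simp
next
  case (At l s)
  have "q \<noteq> Start"
  proof
    assume "q = Start"
    then have "\<forall>a \<in> set (\<beta> @ \<alpha>). \<not> a < 2 * W"
      using assms(3) prun_Start_no_priority by blast
    then have "prun Start (\<alpha> @ \<beta>) = Start"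
      unfolding prun_Start_no_priority by auto
    then show False using At assms(1) by simp
  qed
  then obtain k r where q: "q = At k r" by (cases q) auto
  have "k = l"
    using prun_Start[of "\<alpha> @ \<beta>" l s] prun_Start[of "\<beta> @ \<alpha>" k r] assms(1,3) At q
    by (intro antisym) auto
  moreover have "s = S \<longleftrightarrow> r = S"
    using prun_conjugate_fail[of \<alpha> \<beta> l q] prun_conjugate_fail[of \<beta> \<alpha> k p] assms At q by auto
  ultimately show ?thesis
    using At q by simp
qed

subsection \<open>The FDFA\<close>

text \<open>Row-major numbering with \<open>Start\<close> last, so that the transition table can
  later be written by nested loops over levels and component states.\<close>

definition scode :: "pstate \<Rightarrow> nat" where
  "scode p = (case p of Start \<Rightarrow> 2 * W * Suc S | At l s \<Rightarrow> l * Suc S + s)"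

definition sdecode :: "nat \<Rightarrow> pstate" where
  "sdecode q = (if q < 2 * W * Suc S then At (q div Suc S) (q mod Suc S) else Start)"

lemma scode_less: "l < 2 * W \<Longrightarrow> s \<le> S \<Longrightarrow> l * Suc S + s < 2 * W * Suc S"
proof -
  assume "l < 2 * W" "s \<le> S"
  then have "l * Suc S + s < Suc l * Suc S" "Suc l * Suc S \<le> 2 * W * Suc S"
    by (simp, intro mult_right_mono) simp_all
  then show ?thesis by linarith
qed

lemma sdecode_scode: "valid p \<Longrightarrow> sdecode (scode p) = p"
proof (cases p)
  case (At l s)
  assume "valid p"
  then have *: "l < 2 * W" "s \<le> S" using At by auto
  then have "(l * Suc S + s) div Suc S = l" "(l * Suc S + s) mod Suc S = s"
    by (simp_all del: mult_Suc_right add: div_mult_self3 mod_mult_self3)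
  then show ?thesis
    using scode_less[OF *] At by (simp add: scode_def sdecode_def del: mult_Suc_right)
qed (simp add: scode_def sdecode_def)

lemma scode_le: "valid p \<Longrightarrow> scode p < Suc (2 * W * Suc S)"
  using scode_less by (cases p) (auto simp: scode_def less_Suc_eq)

lemma valid_sdecode: "valid (sdecode q)"
  by (auto simp: sdecode_def less_Suc_eq_le[symmetric] less_mult_imp_div_less)

definition pdfa :: "bool \<Rightarrow> (nat, nat) dfa" where
  "pdfa pol = \<lparr>states = {..<Suc (2 * W * Suc S)}, initial = 2 * W * Suc S,
     transition = (\<lambda>q a. scode (pstep (sdecode q) a)),
     accepting = {q. q < Suc (2 * W * Suc S) \<and> (status (sdecode q) \<longleftrightarrow> pol)}\<rparr>"

definition fdfa_of :: "bool \<Rightarrow> input_fdfa" where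
  "fdfa_of pol = \<lparr>alphabet = {..<m}, leading = \<lparr>states = {..<1}, initial = 0, transition = (\<lambda>_ _. 0)\<rparr>,
     progress = (\<lambda>_. pdfa pol)\<rparr>"

lemma reach_pdfa_from: "valid p \<Longrightarrow> foldl (transition (pdfa pol)) (scode p) v = scode (prun p v)"
  by (induction v arbitrary: p) (auto simp: pdfa_def sdecode_scode valid_pstep)

lemma reach_pdfa: "reach (pdfa pol) v = scode (prun Start v)"
  using reach_pdfa_from[of Start pol v] by (simp add: reach_def pdfa_def scode_def)

lemma reach_pdfa_eq_iff: "reach (pdfa pol) u = reach (pdfa pol) v \<longleftrightarrow> prun Start u = prun Start v"
  unfolding reach_pdfa using sdecode_scode[of "prun Start _", OF valid_prun] by (metis valid.simps(1))

lemma accepts_pdfa: "accepts (pdfa pol) v \<longleftrightarrow> (status (prun Start v) \<longleftrightarrow> pol)"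
  unfolding accepts_def reach_pdfa using scode_le[of "prun Start v"] valid_prun[of Start v]
  by (simp add: pdfa_def sdecode_scode)

lemma progress_fdfa_of: "progress_of (fdfa_of pol) u = pdfa pol"
  by (simp add: progress_of_def fdfa_of_def)

lemma reach_leading: "reach (leading (fdfa_of pol)) u = 0"
  by (induction u rule: rev_induct) (auto simp: reach_def fdfa_of_def)

lemma duo_normalized_fdfa_of:
  "duo_normalized (fdfa_of pol) u v \<longleftrightarrow> u \<in> lists {..<m} \<and> v \<in> lists {..<m} \<and> v \<noteq> [] \<and>
     prun (prun Start v) v = prun Start v"
  unfolding duo_normalized_def normalized_def reach_leading progress_fdfa_of reach_pdfa_eq_iff
  by (simp add: is_pair_def fdfa_of_def)

lemma prun_power:
  assumes "prun (prun Start v) v = prun Start v" "0 < k"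
  shows "prun Start (concat (replicate k v)) = prun Start v \<and>
    prun (prun Start v) (concat (replicate k v)) = prun Start v"
proof -
  have stay: "prun (prun Start v) (concat (replicate k v)) = prun Start v" for k
    by (induction k) (auto simp: assms(1))
  moreover obtain k' where "k = Suc k'"
    using assms(2) gr0_implies_Suc by blast
  ultimately show ?thesis
    by (simp add: assms(1))
qed

text \<open>A stable word reaches the same state as all its positive powers, so both periods can be
  replaced by powers that are rotations of each other.\<close>

lemma saturated_aux:
  assumes "x \<frown> y\<^sup>\<omega> = x' \<frown> y'\<^sup>\<omega>" "y \<noteq> []" "y' \<noteq> []" "length x \<le> length x'"
    and "prun (prun Start y) y = prun Start y" "prun (prun Start y') y' = prun Start y'"
  shows "status (prun Start y) = status (prun Start y')"
proof -
  obtain \<alpha> \<beta> where 1: "concat (replicate (length y') y) = \<alpha> @ \<beta>"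
    and 2: "concat (replicate (length y) y') = \<beta> @ \<alpha>"
    using periods_conjugate[OF assms(1-4)] .
  show ?thesis
    using prun_power[OF assms(5), of "length y'"] prun_power[OF assms(6), of "length y"] assms(2,3)
    unfolding 1 2 by (intro status_conjugate[of \<alpha> \<beta>]) auto
qed

lemma saturated_fdfa_of: "saturated (fdfa_of pol)"
  unfolding saturated_def
proof (intro allI impI)
  fix w x y x' y'
  let ?F = "fdfa_of pol"
  assume "decomposition ?F w x y \<and> duo_normalized ?F x y \<and>
        decomposition ?F w x' y' \<and> duo_normalized ?F x' y'"
  then have eq: "x \<frown> y\<^sup>\<omega> = x' \<frown> y'\<^sup>\<omega>" "y \<noteq> []" "y' \<noteq> []"
    and d: "prun (prun Start y) y = prun Start y" "prun (prun Start y') y' = prun Start y'"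
    unfolding duo_normalized_fdfa_of decomposition_def by auto
  have "status (prun Start y) = status (prun Start y')"
    using saturated_aux[OF eq _ d] saturated_aux[OF eq(1)[symmetric] eq(3,2) _ d(2,1)] nat_le_linear
    by metis
  then show "accepts (progress_of ?F x) y = accepts (progress_of ?F x') y'"
    unfolding progress_fdfa_of accepts_pdfa by simp
qed

lemma fdfa_of_instance: "1 \<le> k \<Longrightarrow> (fdfa_of pol, k) \<in> diameter_instances"
proof -
  assume "1 \<le> k"
  have "{..<m} \<noteq> {}"
    using W_pos m_ge by (simp add: lessThan_empty_iff)
  then have "wf_fdfa (fdfa_of pol)"
    using W_pos m_ge scode_le[OF valid_pstep[OF valid_sdecode]]
    by (auto simp: wf_fdfa_def fdfa_of_def complete_automaton_def complete_dfa_def pdfa_def)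
  moreover have "numbered_fdfa (fdfa_of pol)"
    by (auto simp: numbered_fdfa_def fdfa_of_def pdfa_def)
  ultimately show ?thesis
    using saturated_fdfa_of \<open>1 \<le> k\<close> by (simp add: diameter_instances_def)
qed

lemma fdfa_accepts_fdfa_of:
  "persistent (fdfa_of pol) u v \<Longrightarrow> fdfa_accepts (fdfa_of pol) u v \<longleftrightarrow> (status (prun Start v) \<longleftrightarrow> pol)"
  using fdfa_accepts_iff[OF saturated_fdfa_of] by (simp add: persistent_def progress_fdfa_of accepts_pdfa)

subsection \<open>Long chains from a commonly accepted word\<close>

definition ladder :: "nat list \<Rightarrow> nat \<Rightarrow> nat list" where
  "ladder x t = concat (map (\<lambda>i. i # x) [0..<Suc t])"

definition settled :: "nat list \<Rightarrow> nat \<Rightarrow> nat" where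
  "settled x l = foldl (\<lambda>s a. \<delta> (l div 2) a s) (\<iota> (l div 2)) x"

lemma prun_actions:
  "\<forall>a \<in> set x. 2 * W \<le> a \<Longrightarrow> prun (At l s) x = At l (foldl (\<lambda>s a. \<delta> (l div 2) a s) s x)"
  by (induction x arbitrary: s) auto

context
  fixes x
  assumes x: "\<forall>a \<in> set x. 2 * W \<le> a \<and> a < m" "\<And>c. c < W \<Longrightarrow> accepted c x"
begin

lemma settled_A: "l < 2 * W \<Longrightarrow> settled x l \<in> A"
  using x(2)[of "l div 2"] by (auto simp: accepted_def settled_def)

lemma settled_ne_S: "l < 2 * W \<Longrightarrow> settled x l \<noteq> S"
  using settled_A A_not_S by metis

lemma prun_rung_up:
  "i < 2 * W \<Longrightarrow> p = Start \<or> (\<exists>l s. p = At l s \<and> l < i) \<Longrightarrow> prun p (i # x) = At i (settled x i)"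
  using prun_actions[of x] x(1) by (auto simp: settled_def)

lemma prun_fail_rung: "i \<le> l \<Longrightarrow> prun (At l S) (i # x) = At l S"
  by (rule prun_fail) (use x(1) in auto)

lemma prun_settled_rung:
  "l < 2 * W \<Longrightarrow> i \<le> l \<Longrightarrow> prun (At l (settled x l)) (i # x) = At l (settled x l)"
  using prun_actions[of x] x(1) settled_A[of l] by (auto simp: settled_def)

lemma prun_rung:
  assumes "valid p" "i < 2 * W"
  shows "\<exists>l < 2 * W. i \<le> l \<and> prun p (i # x) \<in> {At l (settled x l), At l S}"
proof (cases "p = Start \<or> (\<exists>l s. p = At l s \<and> l < i)")
  case True
  from prun_rung_up[OF assms(2) this] show ?thesis using assms(2) by auto
next
  case False
  then obtain l s where p: "p = At l s" "i \<le> l" "l < 2 * W"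
    using assms(1) by (cases p) auto
  then have "prun p (i # x) = At l (settled x l) \<or> prun p (i # x) = prun (At l S) x"
    using prun_actions[of x] x(1) by (auto simp: settled_def)
  moreover have "prun (At l S) x = At l S"
    by (rule prun_fail) (use x(1) in auto)
  ultimately show ?thesis using p by auto
qed

lemma ladder_Suc: "ladder x (Suc t) = ladder x t @ Suc t # x"
  by (simp add: ladder_def)

lemma prun_ladder:
  assumes "valid p" "t < 2 * W"
  shows "\<exists>l < 2 * W. t \<le> l \<and> prun p (ladder x t) \<in> {At l (settled x l), At l S}"
  using assms(2)
proof (induction t)
  case 0
  then show ?case using prun_rung[OF assms(1), of 0] W_pos by (simp add: ladder_def del: foldl_Cons)
next
  case (Suc t)
  then show ?case
    using prun_rung[OF valid_prun[OF assms(1)], of "Suc t" "ladder x t"] by (simp only: ladder_Suc foldl_append)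
qed

lemma prun_ladder_stable:
  "l < 2 * W \<Longrightarrow> t \<le> l \<Longrightarrow> p \<in> {At l (settled x l), At l S} \<Longrightarrow> prun p (ladder x t) = p"
proof (induction t)
  case 0
  then show ?case
    using prun_settled_rung[of l 0] prun_fail_rung[of 0 l] by (auto simp: ladder_def)
next
  case (Suc t)
  then have "prun p (ladder x t) = p"
    by simp
  then show ?case
    using Suc.prems prun_settled_rung[of l "Suc t"] prun_fail_rung[of "Suc t" l]
    unfolding ladder_Suc foldl_append by auto
qed

lemma prun_ladder_Start: "t < 2 * W \<Longrightarrow> prun Start (ladder x t) = At t (settled x t)"
proof (induction t)
  case 0
  then show ?case using prun_rung_up[of 0 Start] by (simp add: ladder_def)
next
  case (Suc t)
  then show ?case
    using prun_rung_up[of "Suc t" "At t (settled x t)"] unfolding ladder_Suc foldl_append by simp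
qed

text \<open>One pass through the ladder from any state ends at a level \<open>l \<ge> t\<close> in
  the settled or in the failed state, and further passes change neither. So the exponent 2 serves
  every context \<open>z\<close>.\<close>

lemma ladder_persistent:
  assumes "t < 2 * W"
  shows "persistent (fdfa_of pol) [] (ladder x t)"
proof -
  have "ladder x t \<in> lists {..<m}"
    using x(1) assms m_ge by (auto simp: ladder_def in_lists_conv_set)
  moreover have "ladder x t \<noteq> []"
    by (simp add: ladder_def)
  moreover have "prun (prun Start (ladder x t)) (ladder x t) = prun Start (ladder x t)"
    using prun_ladder_stable[of t t] prun_ladder_Start assms by simp
  moreover have "\<exists>i\<ge>2. reach (pdfa pol) (z @ ladder x t) = reach (pdfa pol) (z @ word_power (ladder x t) i)" for z
  proof -
    obtain l where "l < 2 * W" "t \<le> l"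
      "prun (prun Start z) (ladder x t) \<in> {At l (settled x l), At l S}"
      using prun_ladder[OF valid_prun[of Start z] assms] by auto
    from prun_ladder_stable[OF this] show ?thesis
      unfolding reach_pdfa_eq_iff
      by (intro exI[of _ 2]) (simp add: word_power_def numeral_2_eq_2)
  qed
  ultimately show ?thesis
    unfolding persistent_def duo_normalized_fdfa_of progress_fdfa_of by simp
qed

lemma ladder_chain: "persistent_chain (fdfa_of pol) [] (map (ladder x) [0..<2 * W])"
proof -
  have "fdfa_accepts (fdfa_of pol) [] (ladder x t) \<longleftrightarrow> (even t \<longleftrightarrow> pol)" if "t < 2 * W" for t
    using fdfa_accepts_fdfa_of[OF ladder_persistent[OF that]] prun_ladder_Start[OF that] settled_ne_S[OF that]
    by simp
  moreover have "strict_prefix (ladder x t) (ladder x (Suc t))" for t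
    unfolding ladder_Suc by (simp add: strict_prefix_def)
  ultimately show ?thesis
    unfolding persistent_chain_def using ladder_persistent W_pos by (auto simp del: upt_Suc)
qed

lemma ladder_first: "fdfa_accepts (fdfa_of pol) [] (ladder x 0) \<longleftrightarrow> pol"
  using fdfa_accepts_fdfa_of[OF ladder_persistent[of 0]] prun_ladder_Start[of 0] settled_ne_S[of 0] W_pos
  by simp

end

subsection \<open>A commonly accepted word from a long chain\<close>

text \<open>The common word is the block after the first letter 0. It is completed only in the third
  word of the chain, so that component 0 need not accept it.\<close>

lemma chain_common_word:
  assumes chain: "persistent_chain (fdfa_of pol) u vs" "2 * W \<le> length vs"
    and first: "fdfa_accepts (fdfa_of pol) u (hd vs) \<longleftrightarrow> pol"
  shows "\<exists>x. (\<forall>a \<in> set x. 2 * W \<le> a \<and> a < m) \<and> (\<forall>c. 1 \<le> c \<and> c < W \<longrightarrow> accepted c x)"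
proof -
  define q where "q i = prun Start (vs ! i)" for i
  have pers: "persistent (fdfa_of pol) u (vs ! i)" if "i < 2 * W" for i
    using chain that unfolding persistent_chain_def by simp
  have acc: "fdfa_accepts (fdfa_of pol) u (vs ! i) \<longleftrightarrow> (status (q i) \<longleftrightarrow> pol)" if "i < 2 * W" for i
    using fdfa_accepts_fdfa_of[OF pers[OF that]] by (simp add: q_def)
  have stat: "i < 2 * W \<Longrightarrow> status (q i) \<longleftrightarrow> even i" for i
  proof (induction i)
    case 0
    then show ?case using acc[of 0] first chain W_pos
      by (auto simp: persistent_chain_def hd_conv_nth)
  next
    case (Suc i)
    then have "fdfa_accepts (fdfa_of pol) u (vs ! Suc i) \<longleftrightarrow> \<not> fdfa_accepts (fdfa_of pol) u (vs ! i)"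
      using chain unfolding persistent_chain_def by simp
    then show ?case using Suc acc by auto
  qed
  have duo: "vs ! i \<in> lists {..<m}" "prun (q i) (vs ! i) = q i" if "i < 2 * W" for i
    using pers[OF that] unfolding persistent_def duo_normalized_fdfa_of q_def by auto
  have pre: "i \<le> j \<Longrightarrow> j < 2 * W \<Longrightarrow> prefix (vs ! i) (vs ! j)" for i j
  proof (induction rule: dec_induct)
    case (step j)
    have "strict_prefix (vs ! j) (vs ! Suc j)"
      using chain step.prems unfolding persistent_chain_def by simp
    then show ?case using step by (meson Suc_lessD prefix_order.less_imp_le prefix_order.trans)
  qed simp
  have "\<exists>l s. q (2 * t) = At l s \<and> even l \<and> s \<noteq> S" if "t < W" for t
    using stat[of "2 * t"] that by (cases "q (2 * t)") auto
  then obtain l s where ls: "\<And>t. t < W \<Longrightarrow> q (2 * t) = At (l t) (s t) \<and> even (l t) \<and> s t \<noteq> S"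
    by metis
  have up: "l t + 2 \<le> l (Suc t)" if "Suc t < W" for t
  proof -
    have "prefix (vs ! (2 * t)) (vs ! (2 * t + 1))" "prefix (vs ! (2 * t + 1)) (vs ! (2 * Suc t))"
      by (rule pre; use that in simp)+
    then obtain z z' where z: "vs ! (2 * t + 1) = vs ! (2 * t) @ z" "vs ! (2 * Suc t) = vs ! (2 * t + 1) @ z'"
      unfolding prefix_def by blast
    have q1: "q (2 * t + 1) = prun (At (l t) (s t)) z" and q2: "q (2 * Suc t) = prun (q (2 * t + 1)) z'"
      using z ls[of t] that by (auto simp: q_def)
    obtain l' s' where l': "q (2 * t + 1) = At l' s'" "l t \<le> l'"
      using prun_At_mono[OF q1[symmetric]] by auto
    have At2: "prun (At l' s') z' = At (l (Suc t)) (s (Suc t))"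
      using q2 l' ls[of "Suc t"] that by simp
    have le: "l' \<le> l (Suc t)" and z': "\<forall>a \<in> set z'. a < 2 * W \<longrightarrow> a \<le> l (Suc t)"
      using prun_At_mono[OF At2] by auto
    \<comment> \<open>On an unchanged even level the negative word in between must have failed, and
      a failure is not lifted without a larger priority; the next positive word would be failed as
      well. Both levels are even, so the rise is by at least 2.\<close>
    have "l t \<noteq> l (Suc t)"
    proof
      assume eq: "l t = l (Suc t)"
      then have "l' = l t" using l' le by simp
      moreover have "\<not> status (q (2 * t + 1))"
        using stat[of "2 * t + 1"] that by simp
      ultimately have "s' = S"
        using l' ls[of t] that by simp
      then have "s (Suc t) = S"
        using prun_fail[OF z'] At2 \<open>l' = l t\<close> eq by simp
      then show False using ls[of "Suc t"] that by simp
    qed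
    then show ?thesis
      using l'(2) le ls[of t] ls[of "Suc t"] that by (auto elim!: evenE)
  qed
  have top: "l t < 2 * W" if "t < W" for t
    using prun_Start[of "vs ! (2 * t)"] ls[OF that] by (auto simp: q_def)
  have gap: "l t + 2 * (t' - t) \<le> l t'" if "t \<le> t'" "t' < W" for t t'
    using that
  proof (induction rule: dec_induct)
    case (step n)
    then show ?case using up[of n] by simp
  qed simp
  \<comment> \<open>The \<open>W\<close> even levels below \<open>2 * W\<close> are squeezed:
    counting up from the bottom gives the lower bound \<open>2 * t\<close>, counting down from the
    last one the upper bound \<open>2 * t + 1\<close>.\<close>
  have l: "l t = 2 * t" if t: "t < W" for t
  proof -
    have "2 * t \<le> l t"
      using gap[of 0 t] t by simp
    moreover have "l t + 2 * (W - 1 - t) \<le> l (W - 1)" "l (W - 1) < 2 * W"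
      using gap[of t "W - 1"] top[of "W - 1"] t by simp_all
    then have "l t \<le> 2 * t + 1"
      using t by linarith
    moreover obtain k where "l t = 2 * k"
      using ls[OF t] by blast
    ultimately show ?thesis by simp
  qed
  have "0 \<in> set (vs ! 0)"
    using prun_Start[of "vs ! 0" "l 0" "s 0"] ls[of 0] l[of 0] W_pos by (simp add: q_def)
  then obtain y0 y1 where y: "vs ! 0 = y0 @ 0 # y1"
    by (meson split_list)
  obtain z where z: "vs ! 2 = vs ! 0 @ z"
    using pre[of 0 2] W_pos by (auto simp: prefix_def)
  \<comment> \<open>The third word has level 2 and the first one level 0, so the letter 2 lies in
    the extension \<open>z\<close>; this guarantees a priority that closes the block after the
    0.\<close>
  have "2 \<in> set (vs ! 2)" "2 \<notin> set (vs ! 0)"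
    using prun_Start[of "vs ! 2" "l 1" "s 1"] ls[of 1] l[of 1]
      prun_Start[of "vs ! 0" "l 0" "s 0"] ls[of 0] l[of 0] W_pos by (auto simp: q_def)
  then have "\<exists>a \<in> set (y1 @ z). a < 2 * W"
    using z W_pos by (intro bexI[of _ 2]) auto
  then obtain x b z' where x: "y1 @ z = x @ b # z'" "b < 2 * W" "\<forall>a \<in> set x. \<not> a < 2 * W"
    using split_list_first_prop[of "y1 @ z" "\<lambda>a. a < 2 * W"] by blast
  have v2: "vs ! 2 = y0 @ 0 # x @ b # z'"
    using y z x(1) by simp
  have "accepted c x" if c: "1 \<le> c" "c < W" for c
  proof -
    obtain z'' where v: "vs ! (2 * c) = y0 @ 0 # x @ b # z''"
      using pre[of 2 "2 * c"] c v2 by (auto simp: prefix_def)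
    have q: "q (2 * c) = At (2 * c) (s c)" "s c \<noteq> S"
      using ls[of c] l[of c] c by auto
    have le: "\<forall>a \<in> set (vs ! (2 * c)). a < 2 * W \<longrightarrow> a \<le> 2 * c"
      using prun_Start[of "vs ! (2 * c)" "2 * c" "s c"] q by (simp add: q_def)
    \<comment> \<open>Reading the word once more from its own final state starts on level
      \<open>2 * c\<close>. There the letter 0 closes a block and restarts component
      \<open>c\<close> or fails, and the component reads exactly \<open>x\<close> before
      \<open>b\<close> has it judged.\<close>
    have loop: "prun (At (2 * c) (s c)) (vs ! (2 * c)) = At (2 * c) (s c)"
      using duo(2)[of "2 * c"] q c by simp
    obtain s1 where s1: "prun (At (2 * c) (s c)) y0 = At (2 * c) s1"
      using prun_level[of y0 "2 * c" "s c"] le v by auto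
    define s2 where "s2 = (if s1 \<in> A then \<iota> c else S)"
    define s3 where "s3 = foldl (\<lambda>s a. \<delta> c a s) s2 x"
    define s4 where "s4 = (if s3 \<in> A then \<iota> c else S)"
    have x': "\<forall>a \<in> set x. 2 * W \<le> a"
      using x(3) by auto
    have act: "prun (At (2 * c) r) x = At (2 * c) (foldl (\<lambda>s a. \<delta> c a s) r x)" for r
      using prun_actions[OF x', of "2 * c" r] by simp
    have b: "b \<le> 2 * c"
      using le v x(2) by auto
    have "pstep (At (2 * c) s1) 0 = At (2 * c) s2" "pstep (At (2 * c) s3) b = At (2 * c) s4"
      using b x(2) W_pos by (auto simp: s2_def s4_def)
    then have "prun (At (2 * c) (s c)) (vs ! (2 * c)) = prun (At (2 * c) s4) z''"
      using s1 act[of s2] by (simp add: v s3_def del: pstep.simps)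
    moreover have "prun (At (2 * c) S) z'' = At (2 * c) S"
      by (rule prun_fail) (use le v in auto)
    ultimately have "s4 \<noteq> S"
      using loop q(2) by auto
    then have s3: "s3 \<in> A"
      by (auto simp: s4_def split: if_splits)
    have "prun (At (2 * c) S) x = At (2 * c) S"
      by (rule prun_fail) (use x(3) in auto)
    then have "s2 \<noteq> S"
      using s3 act[of S] A_not_S by (auto simp: s3_def)
    then have "s2 = \<iota> c"
      by (auto simp: s2_def split: if_splits)
    then show ?thesis
      using s3 by (simp add: accepted_def s3_def)
  qed
  moreover have "\<forall>a \<in> set x. 2 * W \<le> a \<and> a < m"
    using duo(1)[of 2] W_pos v2 x(3) by auto
  ultimately show ?thesis by blast
qed

lemma enat_le_SUP_iff: "enat k \<le> (SUP a \<in> X. enat (f a)) \<longleftrightarrow> k = 0 \<or> (\<exists>a \<in> X. k \<le> f a)"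
proof (cases k)
  case (Suc n)
  have "enat (Suc n) \<le> (SUP a \<in> X. enat (f a)) \<longleftrightarrow> enat n < (SUP a \<in> X. enat (f a))"
    by (metis eSuc_enat ileI1 iless_Suc_eq not_le order_less_le_trans eSuc_ile_mono)
  also have "\<dots> \<longleftrightarrow> (\<exists>a \<in> X. n < f a)"
    by (simp add: less_SUP_iff)
  finally show ?thesis by (simp add: Suc Suc_le_eq)
qed (simp add: zero_enat_def[symmetric])

text \<open>The conclusion of the second part leaves out component 0, which the first part requires.
  The gap is closed on the side of the tape columns, where acceptance by the components from 1 on
  already yields an accepting run.\<close>

theorem measure_at_least_fdfa_of:
  defines "\<mu> \<equiv> (\<lambda>pol. if pol then positive_measure else negative_measure)"
  shows "(\<exists>x. (\<forall>a \<in> set x. 2 * W \<le> a \<and> a < m) \<and> (\<forall>c < W. accepted c x)) \<Longrightarrow>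
      measure_at_least (\<mu> pol) (fdfa_of pol, 2 * W)"
    and "measure_at_least (\<mu> pol) (fdfa_of pol, 2 * W) \<Longrightarrow>
      \<exists>x. (\<forall>a \<in> set x. 2 * W \<le> a \<and> a < m) \<and> (\<forall>c. 1 \<le> c \<and> c < W \<longrightarrow> accepted c x)"
proof -
  have meas: "measure_at_least (\<mu> pol) (fdfa_of pol, 2 * W) \<longleftrightarrow>
    (\<exists>u vs. u \<in> lists {..<m} \<and> persistent_chain (fdfa_of pol) u vs \<and>
       (fdfa_accepts (fdfa_of pol) u (hd vs) \<longleftrightarrow> pol) \<and> 2 * W \<le> length vs)"
    using W_pos unfolding measure_at_least_def \<mu>_def positive_measure_def negative_measure_def
    by (cases pol) (auto simp: case_prod_beta enat_le_SUP_iff fdfa_of_def)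
  show "measure_at_least (\<mu> pol) (fdfa_of pol, 2 * W)"
    if ex: "\<exists>x. (\<forall>a \<in> set x. 2 * W \<le> a \<and> a < m) \<and> (\<forall>c < W. accepted c x)"
  proof -
    obtain x where x: "\<forall>a \<in> set x. 2 * W \<le> a \<and> a < m" "\<And>c. c < W \<Longrightarrow> accepted c x"
      using ex by blast
    have "hd (map (ladder x) [0..<2 * W]) = ladder x 0"
      using W_pos by (simp add: hd_map hd_upt)
    then show ?thesis
      unfolding meas using ladder_chain[OF x, of pol] ladder_first[OF x, of pol]
      by (intro exI[of _ "[]"] exI[of _ "map (ladder x) [0..<2 * W]"]) simp
  qed
  show "\<exists>x. (\<forall>a \<in> set x. 2 * W \<le> a \<and> a < m) \<and> (\<forall>c. 1 \<le> c \<and> c < W \<longrightarrow> accepted c x)"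
    if "measure_at_least (\<mu> pol) (fdfa_of pol, 2 * W)"
    using that chain_common_word unfolding meas by blast
qed

end

section \<open>Space-bounded computations as words accepted by all columns\<close>

text \<open>Every column keeps a copy of the control, so that the columns agree on the rule in
  progress although each sees only one cell per tape. A machine step takes one letter per tape
  because the heads may be at different places and a letter names a single one.\<close>

datatype ctrl = Ready nat | Busy nat "nat list" nat | Done

type_synonym column = "ctrl \<times> (nat \<times> bool) list"
type_synonym rule = "nat \<times> nat list \<times> nat"

text \<open>The default for halting rules leaves the tape as it is: halting is spelled out tape by
  tape too, so that the symbols which justify it are verified.\<close>

definition rule_act :: "tm \<Rightarrow> nat \<Rightarrow> nat list \<Rightarrow> nat \<Rightarrow> nat \<times> move" where
  "rule_act M q ss i = (case tm_trans M q ss of Some (_, acts) \<Rightarrow> acts ! i | None \<Rightarrow> (ss ! i, Stay))"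

definition next_ctrl :: "tm \<Rightarrow> nat \<Rightarrow> nat list \<Rightarrow> nat \<Rightarrow> ctrl" where
  "next_ctrl M q ss i = (if Suc i < tm_tapes M then Busy q ss (Suc i)
     else case tm_trans M q ss of Some (q', _) \<Rightarrow> Ready q' | None \<Rightarrow> Done)"

definition enabled :: "tm \<Rightarrow> nat \<Rightarrow> nat list \<Rightarrow> nat \<Rightarrow> ctrl \<Rightarrow> bool" where
  "enabled M q ss i k \<longleftrightarrow> k = (if i = 0 then Ready q else Busy q ss i) \<and>
     (tm_trans M q ss = None \<longrightarrow> q \<in> tm_accepting M)"

text \<open>The position of column \<open>c\<close> relative to the column \<open>h\<close> of the head. Column 0 is excluded,
  because the level automaton does not enforce the constraint of its component 0.\<close>

definition rel :: "nat \<Rightarrow> nat \<Rightarrow> nat" where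
  "rel c h = (if h = 0 then 4 else if c = h then 0 else if c = Suc h then 1 else if Suc c = h then 2 else 3)"

text \<open>Only the column under the head can compare the scanned symbol and confirm the head
  position. The two neighbours adjust their head mark according to the move, and the remaining
  columns just follow the control.\<close>

fun col_step :: "tm \<Rightarrow> rule \<Rightarrow> nat \<Rightarrow> column \<Rightarrow> column option" where
  "col_step M (q, ss, i) d (k, cells) =
     (if \<not> enabled M q ss i k \<or> d = 4 then None
      else let k' = next_ctrl M q ss i; (b, mv) = rule_act M q ss i in
        if d = 0 then if cells ! i = (ss ! i, True) then Some (k', cells[i := (b, mv = Stay)]) else None
        else if d = 1 then Some (k', cells[i := (fst (cells ! i), mv = Right)])
        else if d = 2 then Some (k', cells[i := (fst (cells ! i), mv = Left)])
        else Some (k', cells))"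

definition view :: "nat \<Rightarrow> ctrl \<times> tape list \<Rightarrow> nat \<Rightarrow> column" where
  "view N = (\<lambda>(k, ts) c. (k, map (\<lambda>(t, h). (t (int c - int N), h = int c - int N)) ts))"

lemma col_step_view:
  assumes "enabled M q ss i k" "i < length ts" "0 < h" "snd (ts ! i) = int h - int N"
    "tape_read (ts ! i) = ss ! i"
  shows "col_step M (q, ss, i) (rel c h) (view N (k, ts) c) =
    Some (view N (next_ctrl M q ss i, ts[i := tape_act (rule_act M q ss i) (ts ! i)]) c)"
proof -
  obtain t where t: "ts ! i = (t, int h - int N)"
    using assms(4) by (cases "ts ! i") auto
  obtain b mv where act: "rule_act M q ss i = (b, mv)"
    by (cases "rule_act M q ss i")
  let ?f = "\<lambda>(t, h). (t (int c - int N) :: nat, h = int c - int N)"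
  have nth: "map ?f ts ! i = (t (int c - int N), h = c)"
    using t assms(2) by auto
  have upd: "map ?f (ts[i := tape_act (b, mv) (ts ! i)]) = (map ?f ts)[i := ?f (tape_act (b, mv) (ts ! i))]"
    by (simp add: map_update)
  have same: "(map ?f ts)[i := (t (int c - int N), h = c)] = map ?f ts"
    using nth list_update_id[of "map ?f ts" i] by simp
  have "?f (tape_act (b, mv) (ts ! i)) = (if rel c h = 0 then (b, mv = Stay)
      else if rel c h = 1 then (t (int c - int N), mv = Right)
      else if rel c h = 2 then (t (int c - int N), mv = Left) else (t (int c - int N), h = c))"
    using assms(3) by (cases mv) (auto simp: t rel_def)
  moreover have "t (int h - int N) = ss ! i"
    using assms(5) t by simp
  ultimately show ?thesis
    using assms(1,3) nth upd same by (auto simp: view_def act rel_def Let_def)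
qed

text \<open>With both arguments of \<open>rel\<close> equal, the named column itself is asked
  whether it carries the head. Its consent certifies the head position and the guessed symbol on
  tape \<open>i\<close>.\<close>

lemma col_step_viewD:
  assumes "col_step M (q, ss, i) (rel h h) (view N (k, ts) h) \<noteq> None" "i < length ts"
  shows "0 < h" "enabled M q ss i k" "snd (ts ! i) = int h - int N" "tape_read (ts ! i) = ss ! i"
proof -
  obtain t p where t: "ts ! i = (t, p)"
    by (cases "ts ! i")
  show "0 < h" "enabled M q ss i k" "snd (ts ! i) = int h - int N" "tape_read (ts ! i) = ss ! i"
    using assms t by (auto simp: view_def rel_def Let_def split: if_splits prod.splits)
qed

lemma col_step_enabled: "col_step M (q, ss, i) (rel c h) (k, cells) \<noteq> None \<Longrightarrow> 0 < h \<and> enabled M q ss i k"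
  by (auto simp: rel_def split: if_splits)

subsection \<open>Numbering rules and columns\<close>

definition symbol_lists :: "tm \<Rightarrow> nat list set" where
  "symbol_lists M = {ss. set ss \<subseteq> {..<tm_symbols M} \<and> length ss = tm_tapes M}"

definition rules :: "tm \<Rightarrow> rule set" where
  "rules M = {..<tm_states M} \<times> symbol_lists M \<times> {..<tm_tapes M}"

text \<open>Depends on the machine only. The number of column states, their enumeration and
  \<open>tau\<close> are therefore constants of the reduction, and the arbitrary choice in the
  enumeration does no harm.\<close>

definition columns :: "tm \<Rightarrow> column set" where
  "columns M = (Ready ` {..<tm_states M} \<union> (\<lambda>(q, ss, i). Busy q ss i) ` rules M \<union> {Done}) \<times>
     {cells. set cells \<subseteq> {..<tm_symbols M} \<times> UNIV \<and> length cells = tm_tapes M}"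

lemma finite_rules: "finite (rules M)"
  by (simp add: rules_def symbol_lists_def finite_lists_length_eq)

lemma finite_columns: "finite (columns M)"
  using finite_rules by (simp add: columns_def finite_lists_length_eq)

definition enum :: "'a set \<Rightarrow> nat \<Rightarrow> 'a" where
  "enum X = (SOME f. bij_betw f {0..<card X} X)"

definition index_in :: "'a set \<Rightarrow> 'a \<Rightarrow> nat" where
  "index_in X = the_inv_into {0..<card X} (enum X)"

lemma enum: "finite X \<Longrightarrow> bij_betw (enum X) {0..<card X} X"
  unfolding enum_def
  by (rule someI_ex[of "\<lambda>f. bij_betw f {0..<card X} X"]) (rule ex_bij_betw_nat_finite)

lemma enum_in: "finite X \<Longrightarrow> i < card X \<Longrightarrow> enum X i \<in> X"
  using enum[of X] by (auto simp: bij_betw_def)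

lemma enum_index: "finite X \<Longrightarrow> x \<in> X \<Longrightarrow> enum X (index_in X x) = x"
  using enum[of X] unfolding index_in_def by (metis bij_betw_def f_the_inv_into_f)

lemma index_less: "finite X \<Longrightarrow> x \<in> X \<Longrightarrow> index_in X x < card X"
  using enum[of X] the_inv_into_into[of "enum X" "{0..<card X}" x "{0..<card X}"]
  unfolding index_in_def by (auto simp: bij_betw_def)

abbreviation "ncols M \<equiv> card (columns M)"
abbreviation "nrules M \<equiv> card (rules M)"

definition tau :: "tm \<Rightarrow> nat \<Rightarrow> nat \<Rightarrow> nat \<Rightarrow> nat" where
  "tau M r d s = (if s < ncols M then
     case col_step M (enum (rules M) r) d (enum (columns M) s) of
       None \<Rightarrow> ncols M
     | Some l \<Rightarrow> if l \<in> columns M then index_in (columns M) l else ncols M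
     else ncols M)"

definition final_cols :: "tm \<Rightarrow> nat set" where
  "final_cols M = {s. s < ncols M \<and> fst (enum (columns M) s) = Done}"

definition init_col :: "tm \<Rightarrow> nat \<Rightarrow> bool \<Rightarrow> nat" where
  "init_col M b here = index_in (columns M) (Ready 0, (b, here) # replicate (tm_tapes M - 1) (0, here))"

lemma tau_index:
  assumes "l \<in> columns M" "r \<in> rules M"
  shows "tau M (index_in (rules M) r) d (index_in (columns M) l) = (case col_step M r d l of
     None \<Rightarrow> ncols M | Some l' \<Rightarrow> if l' \<in> columns M then index_in (columns M) l' else ncols M)"
  using assms index_less[OF finite_columns assms(1)] enum_index[OF finite_columns assms(1)]
    enum_index[OF finite_rules assms(2)] by (simp add: tau_def)

lemma tau_le: "tau M r d s \<le> ncols M"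
  using index_less[OF finite_columns] by (auto simp: tau_def less_imp_le split: option.split)

lemma tau_fail: "tau M r d (ncols M) = ncols M"
  by (simp add: tau_def)

subsection \<open>Space-bounded runs\<close>

locale bounded_run =
  fixes M :: tm and w :: "bool list" and N :: nat
  assumes wf: "wf_tm M"
    and bounded: "\<And>i. i < tm_tapes M \<Longrightarrow> finite (tm_visited M w i) \<and> card (tm_visited M w i) \<le> N"
begin

abbreviation "K \<equiv> tm_tapes M"
abbreviation "G \<equiv> tm_symbols M"

abbreviation "run \<equiv> tm_run M w"

lemma wfD: "1 \<le> K" "3 \<le> G" "1 \<le> tm_states M"
  using wf by (auto simp: wf_tm_def)

lemma wf_trans:
  assumes "q < tm_states M" "ss \<in> symbol_lists M" "tm_trans M q ss = Some (q', acts)"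
  shows "q' < tm_states M" "length acts = K" "\<And>i. i < K \<Longrightarrow> fst (acts ! i) < G"
proof -
  have "q' < tm_states M \<and> length acts = K \<and> (\<forall>(s, d) \<in> set acts. s < G)"
    using wf assms unfolding wf_tm_def symbol_lists_def by blast
  then show "q' < tm_states M" "length acts = K" "\<And>i. i < K \<Longrightarrow> fst (acts ! i) < G"
    using nth_mem[of _ acts] by (auto simp: case_prod_beta)
qed

lemma symbol_nth: "ss \<in> symbol_lists M \<Longrightarrow> i < K \<Longrightarrow> ss ! i < G"
  using nth_mem[of i ss] by (auto simp: symbol_lists_def simp del: nth_mem)

lemma rule_act_less: "(q, ss, i) \<in> rules M \<Longrightarrow> fst (rule_act M q ss i) < G"
  using wf_trans[of q ss] symbol_nth[of ss i]
  by (auto simp: rule_act_def rules_def split: option.split)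

definition good :: "tape list \<Rightarrow> bool" where
  "good ts \<longleftrightarrow> length ts = K \<and> (\<forall>i < K. \<forall>j. fst (ts ! i) j < G)"

lemma good_read: "good ts \<Longrightarrow> map tape_read ts \<in> symbol_lists M"
proof -
  assume g: "good ts"
  have "tape_read (ts ! i) < G" if "i < K" for i
    using g that by (cases "ts ! i") (fastforce simp: good_def)
  then have "x < G" if "x \<in> set (map tape_read ts)" for x
    using that g unfolding in_set_conv_nth good_def by (metis length_map nth_map)
  then have "set (map tape_read ts) \<subseteq> {..<G}"
    by blast
  then show ?thesis
    using g by (simp add: symbol_lists_def good_def)
qed

lemma good_act: "good ts \<Longrightarrow> b < G \<Longrightarrow> good (ts[i := tape_act (b, d) (ts ! i)])"
proof -
  assume a: "good ts" "b < G"
  have "fst (ts[i := tape_act (b, d) (ts ! i)] ! k) j < G" if k: "k < K" for k j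
  proof (cases "k = i")
    case True
    obtain t h where t: "ts ! i = (t, h)"
      by (cases "ts ! i")
    have "t j < G"
      using a(1) k True t unfolding good_def by (metis fst_conv)
    then show ?thesis
      using a k True t by (simp add: good_def)
  qed (use a(1) k in \<open>simp add: good_def\<close>)
  then show ?thesis
    using a(1) by (simp add: good_def)
qed

lemma good_initial: "good (snd (run 0))"
  using wfD by (auto simp: good_def tm_initial_def nth_Cons tape_contents_def split: nat.split)

lemma run_step:
  assumes "tm_trans M (fst (run n)) (map tape_read (snd (run n))) = Some (q', acts)"
  shows "run (Suc n) = (q', map2 tape_act acts (snd (run n)))"
  using assms by (cases "run n") simp

lemma run_halt:
  assumes "tm_trans M (fst (run n)) (map tape_read (snd (run n))) = None"
  shows "run (Suc n) = run n"
  using assms by (cases "run n") simp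

lemma halted_iff: "tm_halted M w n \<longleftrightarrow> tm_trans M (fst (run n)) (map tape_read (snd (run n))) = None"
  unfolding tm_halted_def by (cases "run n") (auto split: option.split)

lemma run_after_halt:
  assumes "n \<le> k" "tm_halted M w n"
  shows "run k = run n"
  using assms(1)
proof (induction k rule: dec_induct)
  case (step k)
  then have "tm_halted M w k"
    using assms(2) by (simp add: halted_iff)
  then show ?case
    using step.IH run_halt[of k] unfolding halted_iff by (simp del: tm_run.simps)
qed simp

lemma run_good: "fst (run n) < tm_states M \<and> good (snd (run n))"
proof (induction n)
  case 0
  then show ?case
    using good_initial wfD by (simp add: tm_initial_def)
next
  case (Suc n)
  show ?case
  proof (cases "tm_trans M (fst (run n)) (map tape_read (snd (run n)))")
    case None
    then show ?thesis using Suc run_halt by simp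
  next
    case (Some x)
    obtain q' acts where tr: "tm_trans M (fst (run n)) (map tape_read (snd (run n))) = Some (q', acts)"
      using Some by (cases x) auto
    note wf' = wf_trans[OF _ good_read tr]
    have "good (map2 tape_act acts (snd (run n)))"
      unfolding good_def
    proof (intro conjI allI impI)
      fix i j assume i: "i < K"
      then have "fst (acts ! i) < G" "fst (snd (run n) ! i) j < G" "length acts = K" "length (snd (run n)) = K"
        using wf' Suc by (auto simp: good_def)
      then show "fst (map2 tape_act acts (snd (run n)) ! i) j < G"
        using i by (cases "acts ! i"; cases "snd (run n) ! i") auto
    qed (use wf' Suc in \<open>auto simp: good_def\<close>)
    then show ?thesis
      using wf' Suc run_step[OF tr] by simp
  qed
qed

definition head :: "nat \<Rightarrow> nat \<Rightarrow> int" where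
  "head n i = snd (snd (run n) ! i)"

lemma head_step: "i < K \<Longrightarrow> \<bar>head (Suc n) i - head n i\<bar> \<le> 1"
proof (cases "tm_trans M (fst (run n)) (map tape_read (snd (run n)))")
  case None
  then show ?thesis using run_halt by (simp add: head_def)
next
  case (Some x)
  assume i: "i < K"
  obtain q' acts where tr: "tm_trans M (fst (run n)) (map tape_read (snd (run n))) = Some (q', acts)"
    using Some by (cases x) auto
  have "length acts = K" "length (snd (run n)) = K"
    using run_good[of n] wf_trans[OF _ good_read tr] by (auto simp: good_def)
  then have "head (Suc n) i = snd (tape_act (acts ! i) (snd (run n) ! i))"
    using i by (simp add: head_def run_step[OF tr] del: tm_run.simps)
  moreover have "\<bar>snd (tape_act (b, d) t) - snd t\<bar> \<le> 1" for b d t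
    by (cases t; cases d) auto
  ultimately show ?thesis
    unfolding head_def by (metis surj_pair)
qed

text \<open>A head moves by at most one cell at a time, so it cannot jump over a cell between the
  origin and its present position.\<close>

lemma visited_interval: "i < K \<Longrightarrow> {min 0 (head n i)..max 0 (head n i)} \<subseteq> tm_visited M w i"
proof (induction n)
  case 0
  have "head 0 i = 0"
    using 0 wfD by (cases i) (auto simp: head_def tm_initial_def)
  moreover have "head 0 i \<in> tm_visited M w i"
    unfolding tm_visited_def head_def by blast
  ultimately show ?case by simp
next
  case (Suc n)
  have "head (Suc n) i \<in> tm_visited M w i"
    unfolding tm_visited_def head_def by blast
  moreover have "{min 0 (head (Suc n) i)..max 0 (head (Suc n) i)} \<subseteq>
      insert (head (Suc n) i) {min 0 (head n i)..max 0 (head n i)}"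
    using head_step[OF Suc.prems, of n] by (auto simp: min_def max_def split: if_splits)
  ultimately show ?case
    using Suc.IH[OF Suc.prems] by auto
qed

text \<open>The visited interval has \<open>\<bar>head n i\<bar> + 1\<close> cells. Heads thus stay
  in the columns 1 to \<open>2 * N - 1\<close>, and forbidding column 0 as a head position loses no
  run.\<close>

lemma head_bound: "i < K \<Longrightarrow> \<bar>head n i\<bar> < int N"
proof -
  assume i: "i < K"
  have "card {min 0 (head n i)..max 0 (head n i)} \<le> N"
    using card_mono[OF _ visited_interval[OF i]] bounded[OF i] le_trans by blast
  then show ?thesis
    by (auto simp: min_def max_def split: if_splits)
qed

lemma N_pos: "0 < N"
  using head_bound[of 0 0] wfD by simp

subsection \<open>Configurations in the middle of a step\<close>

text \<open>The symbols \<open>ss\<close> are guessed when the step starts and compared with the tapes one by one.\<close>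

definition micro :: "nat \<Rightarrow> nat list \<Rightarrow> nat \<Rightarrow> ctrl \<times> tape list" where
  "micro n ss i = (if i = 0 then Ready (fst (run n)) else Busy (fst (run n)) ss i,
     map (\<lambda>j. if j < i then tape_act (rule_act M (fst (run n)) ss j) (snd (run n) ! j) else snd (run n) ! j) [0..<K])"

definition reads :: "nat \<Rightarrow> nat list" where
  "reads n = map tape_read (snd (run n))"

lemma reads_in: "reads n \<in> symbol_lists M"
  unfolding reads_def using good_read run_good by blast

lemma length_run: "length (snd (run n)) = K"
  using run_good[of n] by (simp add: good_def)

lemma micro_0: "micro n ss 0 = (Ready (fst (run n)), snd (run n))"
  using length_run[of n] map_nth[of "snd (run n)"] by (simp add: micro_def)

text \<open>The outcome of one letter: the next intermediate configuration, the first one of the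
  next step, or a \<open>Done\<close> configuration, which \<open>micro\<close> cannot
  express.\<close>

definition after :: "nat \<Rightarrow> nat list \<Rightarrow> nat \<Rightarrow> ctrl \<times> tape list" where
  "after n ss i = (next_ctrl M (fst (run n)) ss i,
     (snd (micro n ss i))[i := tape_act (rule_act M (fst (run n)) ss i) (snd (micro n ss i) ! i)])"

lemma after_mid: "Suc i < K \<Longrightarrow> after n ss i = micro n ss (Suc i)"
  unfolding after_def micro_def next_ctrl_def
  by (auto intro!: nth_equalityI simp: nth_list_update less_Suc_eq)

lemma after_last:
  assumes "Suc i = K" "tm_trans M (fst (run n)) (reads n) = Some (q', acts)"
  shows "after n (reads n) i = micro (Suc n) ss 0"
proof -
  have acts: "length acts = K"
    using wf_trans(2)[OF _ reads_in assms(2)] run_good by blast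
  have "(snd (micro n (reads n) i))[i := tape_act (rule_act M (fst (run n)) (reads n) i) (snd (micro n (reads n) i) ! i)] =
    map2 tape_act acts (snd (run n))"
    using assms acts length_run[of n]
    by (intro nth_equalityI) (auto simp: micro_def nth_list_update rule_act_def less_Suc_eq)
  then show ?thesis
    using assms run_step[of n] unfolding after_def micro_0 next_ctrl_def reads_def
    by (simp del: tm_run.simps)
qed

lemma after_halt:
  "Suc i = K \<Longrightarrow> tm_trans M (fst (run n)) ss = None \<Longrightarrow> fst (after n ss i) = Done"
  by (simp add: after_def next_ctrl_def)

section \<open>Tape columns as components of the level automaton\<close>

abbreviation "W \<equiv> 2 * N + 1"

definition code :: "ctrl \<times> tape list \<Rightarrow> nat \<Rightarrow> nat" where
  "code p c = index_in (columns M) (view N p c)"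

definition fits :: "ctrl \<times> tape list \<Rightarrow> bool" where
  "fits p \<longleftrightarrow> fst p \<in> Ready ` {..<tm_states M} \<union> (\<lambda>(q, ss, i). Busy q ss i) ` rules M \<union> {Done} \<and> good (snd p)"

lemma view_in_columns: "fits p \<Longrightarrow> view N p c \<in> columns M"
proof -
  assume "fits p"
  moreover obtain k ts where "p = (k, ts)" by (cases p)
  moreover have "set (map (\<lambda>(t, h). (t (int c - int N), h = int c - int N)) ts) \<subseteq> {..<G} \<times> UNIV" if "good ts"
    using that unfolding good_def by (fastforce simp: in_set_conv_nth)
  ultimately show ?thesis
    unfolding fits_def columns_def view_def good_def by auto
qed

lemma good_micro: "ss \<in> symbol_lists M \<Longrightarrow> i \<le> K \<Longrightarrow> good (snd (micro n ss i))"
proof -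
  assume ss: "ss \<in> symbol_lists M" and i: "i \<le> K"
  have "fst (tape_act (rule_act M (fst (run n)) ss j) (snd (run n) ! j)) l < G" if "j < K" for j l
    using run_good[of n] rule_act_less[of "fst (run n)" ss j] that ss
    by (cases "rule_act M (fst (run n)) ss j"; cases "snd (run n) ! j") (fastforce simp: good_def rules_def)
  then show ?thesis
    using run_good[of n] by (auto simp: good_def micro_def)
qed

lemma fits_micro: "ss \<in> symbol_lists M \<Longrightarrow> i < K \<Longrightarrow> fits (micro n ss i)"
  using good_micro[of ss i n] run_good[of n]
  by (force simp: fits_def micro_def rules_def)

lemma fits_after: "ss \<in> symbol_lists M \<Longrightarrow> i < K \<Longrightarrow> fits (after n ss i)"
proof -
  assume a: "ss \<in> symbol_lists M" "i < K"
  then have "(fst (run n), ss, i) \<in> rules M"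
    using run_good[of n] by (simp add: rules_def)
  then have "good (snd (after n ss i))"
    using good_act[OF good_micro] rule_act_less a unfolding after_def
    by (cases "rule_act M (fst (run n)) ss i") fastforce
  moreover have "next_ctrl M (fst (run n)) ss i \<in>
      Ready ` {..<tm_states M} \<union> (\<lambda>(q, ss, i). Busy q ss i) ` rules M \<union> {Done}"
    using a run_good[of n] wf_trans(1)[of "fst (run n)" ss]
    by (force simp: next_ctrl_def rules_def split: option.split)
  ultimately show ?thesis
    by (simp add: fits_def after_def)
qed

definition \<delta> :: "nat \<Rightarrow> nat \<Rightarrow> nat \<Rightarrow> nat" where
  "\<delta> c a s = tau M ((a - 2 * W) mod nrules M) (rel c ((a - 2 * W) div nrules M)) s"

definition letter :: "rule \<Rightarrow> nat \<Rightarrow> nat" where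
  "letter r h = 2 * W + h * nrules M + index_in (rules M) r"

lemma nrules_pos: "0 < nrules M"
proof -
  have "(0, replicate K 0, 0) \<in> rules M"
    using wfD by (auto simp: rules_def symbol_lists_def)
  then show ?thesis
    using finite_rules[of M] by (auto simp: card_gt_0_iff)
qed

lemma \<delta>_letter:
  assumes "r \<in> rules M" "fits p"
  shows "\<delta> c (letter r h) (code p c) = (case col_step M r (rel c h) (view N p c) of
     None \<Rightarrow> ncols M | Some l' \<Rightarrow> if l' \<in> columns M then index_in (columns M) l' else ncols M)"
proof -
  have "index_in (rules M) r < nrules M"
    using index_less[OF finite_rules assms(1)] .
  then have "(letter r h - 2 * W) mod nrules M = index_in (rules M) r" "(letter r h - 2 * W) div nrules M = h"
    by (simp_all add: letter_def)
  then show ?thesis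
    unfolding \<delta>_def code_def using tau_index[OF view_in_columns[OF assms(2)] assms(1)] by simp
qed

lemma \<delta>_micro:
  assumes "ss \<in> symbol_lists M" "i < K" "enabled M (fst (run n)) ss i (fst (micro n ss i))"
    and "ss ! i = reads n ! i" "0 < h" "head n i = int h - int N"
  shows "\<delta> c (letter (fst (run n), ss, i) h) (code (micro n ss i) c) = code (after n ss i) c"
proof -
  have nth: "snd (micro n ss i) ! i = snd (run n) ! i" "length (snd (micro n ss i)) = K"
    using assms(2) by (simp_all add: micro_def)
  have "col_step M (fst (run n), ss, i) (rel c h) (view N (fst (micro n ss i), snd (micro n ss i)) c) =
      Some (view N (after n ss i) c)"
    unfolding after_def
    by (rule col_step_view) (use assms nth length_run[of n] in \<open>simp_all add: head_def reads_def\<close>)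
  moreover have "(fst (run n), ss, i) \<in> rules M"
    using run_good[of n] assms by (simp add: rules_def)
  ultimately show ?thesis
    using \<delta>_letter[OF _ fits_micro[OF assms(1,2), of n], of _ c h] view_in_columns[OF fits_after[OF assms(1,2)]]
    by (simp add: code_def)
qed

definition \<iota> :: "nat \<Rightarrow> nat" where
  "\<iota> c = init_col M (tape_contents w (int c - int N)) (c = N)"

lemma \<iota>_code: "\<iota> c = code (micro 0 ss 0) c"
proof -
  have "(0 = int c - int N) = (c = N)" by auto
  then show ?thesis
    unfolding micro_0 by (simp add: \<iota>_def init_col_def code_def view_def tm_initial_def tape_contents_def)
qed

definition "m = 2 * W + W * nrules M"

lemma letter_range: "r \<in> rules M \<Longrightarrow> h < W \<Longrightarrow> 2 * W \<le> letter r h \<and> letter r h < m"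
proof -
  assume a: "r \<in> rules M" "h < W"
  then have "h * nrules M + index_in (rules M) r < Suc h * nrules M" "Suc h * nrules M \<le> W * nrules M"
    using index_less[OF finite_rules a(1)] by (simp, intro mult_right_mono) simp_all
  then show ?thesis
    unfolding letter_def m_def by linarith
qed

lemma letter_cases:
  assumes "2 * W \<le> a" "a < m"
  obtains r h where "a = letter r h" "r \<in> rules M" "h < W"
proof -
  let ?r = "(a - 2 * W) mod nrules M" and ?h = "(a - 2 * W) div nrules M"
  have "?r < nrules M"
    using nrules_pos by simp
  then have "enum (rules M) ?r \<in> rules M" "index_in (rules M) (enum (rules M) ?r) = ?r"
    using enum_in[OF finite_rules] enum[OF finite_rules, of M] unfolding index_in_def
    by (auto simp: bij_betw_def the_inv_into_f_f)
  moreover from this have "a = letter (enum (rules M) ?r) ?h"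
    using assms(1) by (simp add: letter_def)
  moreover have "?h < W"
    using assms nrules_pos by (auto simp: m_def less_mult_imp_div_less)
  ultimately show ?thesis
    using that by blast
qed

sublocale level_automaton W "ncols M" m \<delta> \<iota> "final_cols M"
proof
  show "\<iota> c < ncols M" for c
    unfolding \<iota>_code[of c "reads 0"] code_def
    using index_less[OF finite_columns view_in_columns[OF fits_micro[OF reads_in]]] wfD by simp
qed (use N_pos in \<open>auto simp: \<delta>_def tau_le tau_fail final_cols_def m_def\<close>)

abbreviation "lrun c x \<equiv> foldl (\<lambda>s a. \<delta> c a s) (\<iota> c) x"

definition step_word :: "nat \<Rightarrow> nat list" where
  "step_word n = map (\<lambda>i. letter (fst (run n), reads n, i) (nat (head n i + int N))) [0..<K]"

lemma step_word_range: "a \<in> set (step_word n) \<Longrightarrow> 2 * W \<le> a \<and> a < m"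
proof -
  assume "a \<in> set (step_word n)"
  then obtain i where i: "i < K" "a = letter (fst (run n), reads n, i) (nat (head n i + int N))"
    by (auto simp: step_word_def)
  moreover have "nat (head n i + int N) < W"
    using head_bound[OF i(1), of n] by linarith
  moreover have "(fst (run n), reads n, i) \<in> rules M"
    using run_good[of n] i(1) reads_in by (simp add: rules_def)
  ultimately show ?thesis using letter_range by blast
qed

lemma step_word_prefix:
  assumes "tm_trans M (fst (run n)) (reads n) = None \<longrightarrow> fst (run n) \<in> tm_accepting M"
    and "i < K"
  shows "foldl (\<lambda>s a. \<delta> c a s) (code (micro n (reads n) 0) c)
      (map (\<lambda>i. letter (fst (run n), reads n, i) (nat (head n i + int N))) [0..<Suc i]) = code (after n (reads n) i) c"
  using assms(2)
proof (induction i)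
  have step: "\<delta> c (letter (fst (run n), reads n, i) (nat (head n i + int N))) (code (micro n (reads n) i) c) =
      code (after n (reads n) i) c" if "i < K" for i
    using head_bound[OF that, of n] that assms(1) reads_in
    by (intro \<delta>_micro) (auto simp: enabled_def micro_def)
  {
    case 0
    then show ?case using step[of 0] by simp
  next
    case (Suc i)
    then show ?case
      using step[of "Suc i"] after_mid[of i n "reads n"] by simp
  }
qed

lemma step_word_run:
  assumes "tm_trans M (fst (run n)) (reads n) = None \<longrightarrow> fst (run n) \<in> tm_accepting M"
  shows "foldl (\<lambda>s a. \<delta> c a s) (code (micro n (reads n) 0) c) (step_word n) = code (after n (reads n) (K - 1)) c"
  using step_word_prefix[OF assms, of "K - 1" c] wfD by (simp add: step_word_def)

lemma final_code: "fits p \<Longrightarrow> code p c \<in> final_cols M \<longleftrightarrow> fst p = Done"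
  using index_less[OF finite_columns view_in_columns, of p c] enum_index[OF finite_columns view_in_columns, of p c]
  by (cases p) (auto simp: final_cols_def code_def view_def)

lemma accepting_run_word:
  assumes "tm_halted M w n" "fst (run n) \<in> tm_accepting M"
  shows "\<exists>x. (\<forall>a \<in> set x. 2 * W \<le> a \<and> a < m) \<and> (\<forall>c. accepted c x)"
proof -
  \<comment> \<open>The word stops at the first halting time: before it every rule continues the
    run, and the rule applied there is the one that leads to \<open>Done\<close>.\<close>
  define n0 where "n0 = (LEAST n. tm_halted M w n)"
  have n0: "tm_halted M w n0" "n0 \<le> n" "\<And>k. k < n0 \<Longrightarrow> \<not> tm_halted M w k"
    unfolding n0_def using assms(1) by (auto intro: LeastI Least_le dest: not_less_Least)
  have acc: "fst (run n0) \<in> tm_accepting M"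
    using assms(2) run_after_halt[OF n0(2,1)] by simp
  have "k \<le> n0 \<Longrightarrow> lrun c (concat (map step_word [0..<k])) = code (micro k (reads k) 0) c" for k c
  proof (induction k)
    case 0
    then show ?case using \<iota>_code by simp
  next
    case (Suc k)
    then obtain q' acts where tr: "tm_trans M (fst (run k)) (reads k) = Some (q', acts)"
      using n0(3)[of k] unfolding halted_iff reads_def by auto
    show ?case
      using Suc step_word_run[of k c] after_last[OF _ tr, of "K - 1"] wfD tr by simp
  qed
  from this[of n0] have "lrun c (concat (map step_word [0..<Suc n0])) = code (after n0 (reads n0) (K - 1)) c" for c
    using step_word_run[of n0 c] acc by simp
  moreover have "fst (after n0 (reads n0) (K - 1)) = Done"
    using after_halt[of "K - 1" n0 "reads n0"] n0(1) wfD unfolding halted_iff reads_def by simp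
  ultimately have "accepted c (concat (map step_word [0..<Suc n0]))" for c
    unfolding accepted_def using final_code[OF fits_after[OF reads_in, of "K - 1" n0]] wfD by simp
  moreover have "\<forall>a \<in> set (concat (map step_word [0..<Suc n0])). 2 * W \<le> a \<and> a < m"
    using step_word_range by auto
  ultimately show ?thesis by blast
qed

text \<open>Invariant for the columns from 1 on: they show a true configuration of the run, with the
  tapes below \<open>i\<close> already processed and the guess \<open>ss\<close> checked on those
  tapes only.\<close>

definition midway :: "(nat \<Rightarrow> nat) \<Rightarrow> bool" where
  "midway f \<longleftrightarrow> (\<exists>n ss i. i < K \<and> ss \<in> symbol_lists M \<and> (\<forall>j < i. ss ! j = reads n ! j) \<and>
     (\<forall>c. 1 \<le> c \<and> c < W \<longrightarrow> f c = code (micro n ss i) c))"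

definition finished :: "(nat \<Rightarrow> nat) \<Rightarrow> bool" where
  "finished f \<longleftrightarrow> (\<exists>n p. tm_halted M w n \<and> fst (run n) \<in> tm_accepting M \<and> fits p \<and> fst p = Done \<and>
     (\<forall>c. 1 \<le> c \<and> c < W \<longrightarrow> f c = code p c))"

lemma midway_step:
  assumes "midway f" "2 * W \<le> a" "a < m" "\<And>c. 1 \<le> c \<Longrightarrow> c < W \<Longrightarrow> \<delta> c a (f c) \<noteq> ncols M"
  shows "midway (\<lambda>c. \<delta> c a (f c)) \<or> finished (\<lambda>c. \<delta> c a (f c))"
proof -
  obtain n ss i where i: "i < K" and ss: "ss \<in> symbol_lists M" "\<forall>j < i. ss ! j = reads n ! j"
    and f: "\<And>c. 1 \<le> c \<Longrightarrow> c < W \<Longrightarrow> f c = code (micro n ss i) c"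
    using assms(1) unfolding midway_def by blast
  obtain q ss' i' h where a: "a = letter (q, ss', i') h" and r: "(q, ss', i') \<in> rules M" and h: "h < W"
    using letter_cases[OF assms(2,3)] by (metis prod_cases3)
  have step: "col_step M (q, ss', i') (rel c h) (view N (micro n ss i) c) \<noteq> None" if "1 \<le> c" "c < W" for c
    using assms(4)[OF that] \<delta>_letter[OF r fits_micro[OF ss(1) i], of c h n] f[OF that]
    by (auto simp: a split: option.splits)
  have len: "length (snd (micro n ss i)) = K"
    by (simp add: micro_def)
  obtain k cells where k: "view N (micro n ss i) 1 = (k, cells)"
    by (cases "view N (micro n ss i) 1")
  \<comment> \<open>Column 1 would fail on any letter that names column 0. So \<open>h\<close> is
    one of the columns known to survive the letter, and it can be asked whether the head is
    there.\<close>
  have "col_step M (q, ss', i') (rel 1 h) (k, cells) \<noteq> None"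
    using step[of 1] N_pos unfolding k by simp
  then have "0 < h"
    using col_step_enabled by blast
  then have "col_step M (q, ss', i') (rel h h) (view N (fst (micro n ss i), snd (micro n ss i)) h) \<noteq> None"
    using step[of h] h by simp
  note D = col_step_viewD[OF this]
  have i': "i' < K" and ss': "ss' \<in> symbol_lists M"
    using r by (auto simp: rules_def)
  have en: "enabled M q ss' i' (fst (micro n ss i))"
    and hd: "snd (snd (micro n ss i) ! i') = int h - int N" and rd: "tape_read (snd (micro n ss i) ! i') = ss' ! i'"
    using D i' len by auto
  \<comment> \<open>At tape 0 the control does not record the old guess, so the letter may bring a
    new one; the configuration is the same, since no tape has been processed under the old guess. At
    later tapes \<open>Busy\<close> forces \<open>ss' = ss\<close>.\<close>
  have eq: "i' = i" "q = fst (run n)" "micro n ss' i = micro n ss i" "\<forall>j < i. ss' ! j = reads n ! j"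
    using en ss(2) by (auto simp: enabled_def micro_def split: if_splits)
  have nth: "snd (micro n ss i) ! i = snd (run n) ! i"
    using i by (simp add: micro_def)
  have rdi: "ss' ! i = reads n ! i"
    using rd i nth length_run[of n] unfolding eq(1) by (simp add: reads_def)
  have nxt: "\<delta> c a (f c) = code (after n ss' i) c" if "1 \<le> c" "c < W" for c
    unfolding f[OF that] a eq(1,2) eq(3)[symmetric]
    by (rule \<delta>_micro[OF ss' i _ rdi \<open>0 < h\<close>])
      (use en hd nth in \<open>simp_all add: eq head_def\<close>)
  have prefix: "\<forall>j < Suc i. ss' ! j = reads n ! j"
    using eq(4) rdi by (simp add: less_Suc_eq)
  show ?thesis
  proof (cases "Suc i < K")
    case True
    then show ?thesis
      unfolding midway_def using nxt after_mid[OF True] ss' prefix by auto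
  next
    case False
    then have last: "Suc i = K" using i by simp
    \<comment> \<open>With the last tape the guess has been verified completely.\<close>
    then have full: "ss' = reads n"
      using prefix ss' reads_in[of n] by (auto simp: symbol_lists_def intro!: nth_equalityI)
    show ?thesis
    proof (cases "tm_trans M (fst (run n)) (reads n)")
      case None
      then have "fst (after n ss' i) = Done" "tm_halted M w n" "fst (run n) \<in> tm_accepting M"
        using after_halt[OF last] en full eq unfolding halted_iff reads_def enabled_def by auto
      then show ?thesis
        unfolding finished_def using nxt fits_after[OF ss' i] by blast
    next
      case (Some x)
      then obtain q' acts where "tm_trans M (fst (run n)) (reads n) = Some (q', acts)"
        by (cases x) auto
      from after_last[OF last this, of "reads n"] have "midway (\<lambda>c. \<delta> c a (f c))"
        unfolding midway_def using nxt wfD reads_in full by (intro exI[of _ "Suc n"] exI[of _ "reads n"] exI[of _ 0]) auto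
      then show ?thesis ..
    qed
  qed
qed

text \<open>No rule is enabled in \<open>Done\<close>, so an accepted word cannot go on after the
  halting rule.\<close>

lemma finished_step:
  assumes "finished f" "2 * W \<le> a" "a < m"
  shows "\<delta> 1 a (f 1) = ncols M"
proof -
  obtain p where p: "fits p" "fst p = Done" "f 1 = code p 1"
    using assms(1) N_pos unfolding finished_def by auto
  obtain q ss i h where a: "a = letter (q, ss, i) h" and r: "(q, ss, i) \<in> rules M"
    using letter_cases[OF assms(2,3)] by (metis prod_cases3)
  have "col_step M (q, ss, i) (rel 1 h) (view N p 1) = None"
    using p(2) by (cases p) (auto simp: view_def enabled_def)
  then show ?thesis
    unfolding a p(3) using \<delta>_letter[OF r p(1), of 1 h] by simp
qed

text \<open>Failure is absorbing, so no prefix of an accepted word leads one of these columns into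
  it, and the invariant is kept letter by letter. An intermediate configuration is not final,
  because its control is never \<open>Done\<close>; hence the run has finished.\<close>

lemma common_word_accepting_run:
  assumes x: "\<forall>a \<in> set x. 2 * W \<le> a \<and> a < m" and acc: "\<forall>c. 1 \<le> c \<and> c < W \<longrightarrow> accepted c x"
  shows "\<exists>n. tm_halted M w n \<and> fst (run n) \<in> tm_accepting M"
proof -
  have "(\<forall>c. 1 \<le> c \<and> c < W \<longrightarrow> lrun c x \<noteq> ncols M) \<Longrightarrow>
      midway (\<lambda>c. lrun c x) \<or> finished (\<lambda>c. lrun c x)"
    using x
  proof (induction x rule: rev_induct)
    case Nil
    have "midway (\<lambda>c. lrun c [])"
      unfolding midway_def using wfD reads_in \<iota>_code by (intro exI[of _ 0] exI[of _ "reads 0"]) auto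
    then show ?case ..
  next
    case (snoc a x)
    have ne: "lrun c x \<noteq> ncols M" if "1 \<le> c" "c < W" for c
      using snoc.prems(1) that \<delta>_fail by auto
    then have "midway (\<lambda>c. lrun c x) \<or> finished (\<lambda>c. lrun c x)"
      using snoc by auto
    moreover have "\<not> finished (\<lambda>c. lrun c x)"
      using finished_step[of "\<lambda>c. lrun c x" a] snoc.prems N_pos by auto
    ultimately show ?case
      using midway_step[of "\<lambda>c. lrun c x" a] snoc.prems by simp
  qed
  moreover have "\<forall>c. 1 \<le> c \<and> c < W \<longrightarrow> lrun c x \<noteq> ncols M"
    using acc A_not_S unfolding accepted_def by metis
  ultimately consider "midway (\<lambda>c. lrun c x)" | "finished (\<lambda>c. lrun c x)"
    by blast
  then show ?thesis
  proof cases
    case 1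
    then obtain n ss i where i: "i < K" "ss \<in> symbol_lists M" and "lrun 1 x = code (micro n ss i) 1"
      using N_pos unfolding midway_def by auto
    moreover have "lrun 1 x \<in> final_cols M"
      using acc N_pos unfolding accepted_def by auto
    ultimately have "fst (micro n ss i) = Done"
      using final_code[OF fits_micro[OF i(2,1)]] by simp
    then show ?thesis
      by (simp add: micro_def split: if_splits)
  next
    case 2
    then show ?thesis
      unfolding finished_def by blast
  qed
qed

end

section \<open>Writing the instance in polynomial time\<close>

lemma concat_upt_mult:
  "concat (map f [0..<a * b]) = concat (map (\<lambda>i. concat (map (\<lambda>j. f (i * b + j)) [0..<b])) [0..<a])"
proof (induction a)
  case (Suc a)
  have "[0..<Suc a * b] = [0..<a * b] @ map (\<lambda>j. a * b + j) [0..<b]"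
    using upt_add_eq_append[of 0 "a * b" b] map_add_upt[of "a * b" b] by (simp add: add.commute)
  then show ?case
    using Suc by (simp add: comp_def)
qed simp

lemma concat_upt_add:
  "concat (map f [0..<a + b]) = concat (map f [0..<a]) @ concat (map (\<lambda>j. f (a + j)) [0..<b])"
  using upt_add_eq_append[of 0 a b] map_add_upt[of a b, symmetric] by (simp add: comp_def add.commute)

lemma concat_concat_map: "concat (concat (map (\<lambda>q. map (h q) ys) xs)) = concat (map (\<lambda>q. concat (map (h q) ys)) xs)"
  by (induction xs) auto

lemma concat_map_upt_cong: "(\<And>i. i < n \<Longrightarrow> f i = g i) \<Longrightarrow> concat (map f [0..<n]) = concat (map g [0..<n])"
  by (rule arg_cong[where f = concat], rule map_cong) auto

lemma map_as_concat: "map f xs = concat (map (\<lambda>x. [f x]) xs)"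
  by (induction xs) auto

context level_automaton
begin

definition row :: "nat \<Rightarrow> pstate \<Rightarrow> bool list" where
  "row R q = concat (map (\<lambda>c. concat (map (\<lambda>b. unary (scode (pstep q (2 * c + b)))) [0..<2])) [0..<W]) @
     concat (map (\<lambda>h. concat (map (\<lambda>r. unary (scode (pstep q (2 * W + h * R + r)))) [0..<R])) [0..<W])"

lemma row_eq:
  assumes "m = 2 * W + W * R"
  shows "concat (map (\<lambda>a. unary (scode (pstep q a))) [0..<m]) = row R q"
  unfolding assms concat_upt_add row_def mult.commute[of 2 W] concat_upt_mult
  by (simp add: mult.commute add.assoc del: upt_Suc)

lemma concat_states:
  "concat (map f [0..<Suc (2 * W * Suc S)]) =
   concat (map (\<lambda>c. concat (map (\<lambda>b. concat (map (\<lambda>s. f (scode (At (2 * c + b) s))) [0..<Suc S])) [0..<2])) [0..<W]) @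
   f (scode Start)"
proof -
  have "concat (map f [0..<2 * W * Suc S]) =
      concat (map (\<lambda>c. concat (map (\<lambda>b. concat (map (\<lambda>s. f ((c * 2 + b) * Suc S + s)) [0..<Suc S])) [0..<2])) [0..<W])"
    unfolding mult.commute[of 2 W] by (subst concat_upt_mult, subst concat_upt_mult) (rule HOL.refl)
  moreover have "concat (map f [0..<Suc (2 * W * Suc S)]) = concat (map f [0..<2 * W * Suc S]) @ f (2 * W * Suc S)"
    by (simp del: mult_Suc mult_Suc_right)
  ultimately show ?thesis
    by (simp add: scode_def mult.commute[of _ 2] del: upt_Suc mult_Suc mult_Suc_right)
qed

text \<open>The loops over \<open>[0..<W]\<close> and \<open>[0..<m]\<close> depend on the input;
  those over \<open>[0..<2]\<close>, \<open>[0..<Suc S]\<close> and, inside \<open>row\<close>,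
  \<open>[0..<R]\<close> have a fixed length for a fixed machine and will be unrolled in the program
  text.\<close>

lemma encode_fdfa_of:
  assumes "m = 2 * W + W * R"
  shows "encode_instance (fdfa_of pol, k) =
    unary m @ unary 1 @ unary 0 @ concat (map (\<lambda>_. unary 0) [0..<m]) @
    unary (Suc (2 * W * Suc S)) @ unary (2 * W * Suc S) @
    concat (map (\<lambda>c. concat (map (\<lambda>b. concat (map (\<lambda>s. row R (At (2 * c + b) s)) [0..<Suc S])) [0..<2])) [0..<W]) @
    row R Start @
    concat (map (\<lambda>c. concat (map (\<lambda>b. concat (map (\<lambda>s. [(b = 0 \<and> s \<noteq> S) = pol]) [0..<Suc S])) [0..<2])) [0..<W]) @
    [\<not> pol] @ binary k"
proof -
  have valid: "valid (At (2 * c + b) s)" if "c < W" "b < 2" "s < Suc S" for c b s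
    using that by simp
  have table: "concat (concat (map (\<lambda>q. map (\<lambda>a. unary (transition (pdfa pol) q a)) [0..<m]) [0..<Suc (2 * W * Suc S)])) =
    concat (map (\<lambda>c. concat (map (\<lambda>b. concat (map (\<lambda>s. row R (At (2 * c + b) s)) [0..<Suc S])) [0..<2])) [0..<W]) @
    row R Start"
  proof (subst concat_concat_map, subst concat_states, rule arg_cong2[where f = append])
    have tr: "concat (map (\<lambda>a. unary (transition (pdfa pol) (scode q) a)) [0..<m]) = row R q" if "valid q" for q
      using that by (simp add: pdfa_def sdecode_scode row_eq[OF assms] del: pstep.simps)
    then show "concat (map (\<lambda>a. unary (transition (pdfa pol) (scode Start) a)) [0..<m]) = row R Start"
      by simp
    show "concat (map (\<lambda>c. concat (map (\<lambda>b. concat (map (\<lambda>s.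
        concat (map (\<lambda>a. unary (transition (pdfa pol) (scode (At (2 * c + b) s)) a)) [0..<m]))
        [0..<Suc S])) [0..<2])) [0..<W]) =
      concat (map (\<lambda>c. concat (map (\<lambda>b. concat (map (\<lambda>s. row R (At (2 * c + b) s)) [0..<Suc S])) [0..<2])) [0..<W])"
      by (intro concat_map_upt_cong tr valid)
  qed
  have acc: "map (\<lambda>q. q \<in> accepting (pdfa pol)) [0..<Suc (2 * W * Suc S)] =
    concat (map (\<lambda>c. concat (map (\<lambda>b. concat (map (\<lambda>s. [(b = 0 \<and> s \<noteq> S) = pol]) [0..<Suc S])) [0..<2])) [0..<W]) @
    [\<not> pol]"
  proof -
    have acc1: "scode (At (2 * c + b) s) \<in> accepting (pdfa pol) \<longleftrightarrow> ((b = 0 \<and> s \<noteq> S) = pol)"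
      if "c < W" "b < 2" "s < Suc S" for c b s
    proof -
      have "scode (At (2 * c + b) s) < Suc (2 * W * Suc S)"
        by (rule scode_le[OF valid[OF that]])
      moreover have "even (2 * c + b) \<longleftrightarrow> b = 0"
        using that by (cases b) auto
      ultimately show ?thesis
        using sdecode_scode[OF valid[OF that]] by (simp add: pdfa_def)
    qed
    have acc2: "scode Start \<in> accepting (pdfa pol) \<longleftrightarrow> \<not> pol"
      using scode_le[of Start] sdecode_scode[of Start] by (simp add: pdfa_def)
    show ?thesis
      by (subst map_as_concat, subst concat_states, rule arg_cong2[where f = append])
        (intro concat_map_upt_cong, simp_all only: acc1 acc2)
  qed
  have "encode_automaton m (pdfa pol) = unary (Suc (2 * W * Suc S)) @ unary (2 * W * Suc S) @
      concat (concat (map (\<lambda>q. map (\<lambda>a. unary (transition (pdfa pol) q a)) [0..<m]) [0..<Suc (2 * W * Suc S)]))"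
    by (simp add: encode_automaton_def pdfa_def del: upt_Suc)
  moreover have "encode_automaton m (leading (fdfa_of pol)) = unary 1 @ unary 0 @ concat (map (\<lambda>_. unary 0) [0..<m])"
    by (simp add: encode_automaton_def fdfa_of_def)
  moreover have "card (states (pdfa pol)) = Suc (2 * W * Suc S)"
    by (simp add: pdfa_def)
  ultimately have "encode_dfa m (pdfa pol) = unary (Suc (2 * W * Suc S)) @ unary (2 * W * Suc S) @
    concat (map (\<lambda>c. concat (map (\<lambda>b. concat (map (\<lambda>s. row R (At (2 * c + b) s)) [0..<Suc S])) [0..<2])) [0..<W]) @
    row R Start @
    concat (map (\<lambda>c. concat (map (\<lambda>b. concat (map (\<lambda>s. [(b = 0 \<and> s \<noteq> S) = pol]) [0..<Suc S])) [0..<2])) [0..<W]) @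
    [\<not> pol]" and "encode_automaton m (leading (fdfa_of pol)) = unary 1 @ unary 0 @ concat (map (\<lambda>_. unary 0) [0..<m])"
    unfolding encode_dfa_def using table acc by (simp_all del: upt_Suc)
  moreover have "encode_instance (fdfa_of pol, k) =
      unary m @ encode_automaton m (leading (fdfa_of pol)) @ encode_dfa m (pdfa pol) @ binary k"
    by (simp add: encode_instance_def encode_fdfa_def fdfa_of_def Let_def)
  ultimately show ?thesis
    by (simp only: append_assoc)
qed

end

subsection \<open>The program that writes the instance\<close>

text \<open>Horner's scheme; register 0 holds the length of the input.\<close>

definition poly_exp :: "nat poly \<Rightarrow> exp" where
  "poly_exp p = foldr (\<lambda>a e. Add (Const a) (Mul (Var 0) e)) (coeffs p) (Const 0)"

lemma eval_poly_exp: "eval (poly_exp p) g = poly p (g 0)"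
proof -
  have "eval (foldr (\<lambda>a e. Add (Const a) (Mul (Var 0) e)) cs (Const 0)) g = poly (Poly cs) (g 0)" for cs
    by (induction cs) auto
  from this[of "coeffs p"] show ?thesis
    by (simp add: poly_exp_def)
qed

lemma vars_poly_exp: "vars (poly_exp p) \<subseteq> {0}"
proof -
  have "vars (foldr (\<lambda>a e. Add (Const a) (Mul (Var 0) e)) cs (Const 0)) \<subseteq> {0}" for cs
    by (induction cs) auto
  then show ?thesis
    unfolding poly_exp_def .
qed

definition cats :: "prog list \<Rightarrow> prog" where
  "cats ps = foldr Cat ps (Emit [])"

lemma out_cats: "out (cats ps) w k g = concat (map (\<lambda>p. out p w k g) ps)"
  by (induction ps) (simp_all add: cats_def)

lemma scoped_cats: "scoped k (cats ps) \<longleftrightarrow> (\<forall>p \<in> set ps. scoped k p)"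
  by (induction ps) (simp_all add: cats_def)

definition emit_unary :: "exp \<Rightarrow> prog" where
  "emit_unary e = Cat (Loop e (Emit [True])) (Emit [False])"

lemma out_emit_unary: "out (emit_unary e) w k g = unary (eval e g)"
proof -
  have "concat (map (\<lambda>i. [True]) [0..<n]) = replicate n True" for n
    by (induction n) (simp_all add: replicate_append_same)
  then show ?thesis
    by (simp add: emit_unary_def unary_def)
qed

lemma scoped_emit_unary: "scoped k (emit_unary e) \<longleftrightarrow> vars e \<subseteq> {..<k}"
  by (simp add: emit_unary_def)

definition width_exp :: "nat poly \<Rightarrow> exp" where
  "width_exp p = Add (Mul (Const 2) (poly_exp p)) (Const 1)"

definition level_exp :: "nat \<Rightarrow> nat \<Rightarrow> exp" where
  "level_exp v b = Add (Mul (Const 2) (Var v)) (Const b)"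

definition emit_state :: "tm \<Rightarrow> nat \<Rightarrow> nat \<Rightarrow> nat \<Rightarrow> prog" where
  "emit_state M v b s = emit_unary (Add (Mul (level_exp v b) (Const (Suc (ncols M)))) (Const s))"

text \<open>The initial state takes finitely many values, so the program text contains
  \<open>F\<close> for each of them and selects one by comparing column \<open>v\<close> with the
  origin column \<open>N\<close>: to its left everything is blank, at it the heads are present, and
  otherwise the input symbol at position \<open>v - N\<close> decides.\<close>

definition case_init :: "tm \<Rightarrow> nat poly \<Rightarrow> nat \<Rightarrow> (nat \<Rightarrow> prog) \<Rightarrow> prog" where
  "case_init M p v F =
     (let on_symbol = (\<lambda>here. IfSym (Sub (Var v) (poly_exp p))
        (F (init_col M 0 here)) (F (init_col M 1 here)) (F (init_col M 2 here)))
      in IfZero (Sub (poly_exp p) (Var v))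
        (IfZero (Sub (Var v) (poly_exp p)) (on_symbol True) (on_symbol False))
        (F (init_col M 0 False)))"

text \<open>Register 1 is the component index of the row and register 3 that of the letter;
  registers 2 and 4 count down the two loops. The outer test is zero iff the priority does not
  exceed the level.\<close>

definition emit_priority :: "tm \<Rightarrow> nat poly \<Rightarrow> nat \<Rightarrow> nat \<Rightarrow> nat \<Rightarrow> prog" where
  "emit_priority M p b s b' = IfZero (Sub (level_exp 3 b') (level_exp 1 b))
     (if s \<in> final_cols M then case_init M p 1 (emit_state M 1 b) else emit_state M 1 b (ncols M))
     (case_init M p 3 (emit_state M 3 b'))"

text \<open>The component state and the rule are unrolled, so \<open>tau\<close> enters as
  constants; only the relative position is computed at run time, by comparing registers 1 and 3 with
  truncated subtraction.\<close>

definition emit_action :: "tm \<Rightarrow> nat \<Rightarrow> nat \<Rightarrow> nat \<Rightarrow> prog" where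
  "emit_action M b s r = (let on_rel = (\<lambda>d. emit_state M 1 b (tau M r d s)) in
     IfZero (Var 3) (on_rel 4)
       (IfZero (Sub (Var 1) (Var 3))
         (IfZero (Sub (Var 3) (Var 1)) (on_rel 0)
           (IfZero (Sub (Var 3) (Add (Var 1) (Const 1))) (on_rel 2) (on_rel 3)))
         (IfZero (Sub (Var 1) (Add (Var 3) (Const 1))) (on_rel 1) (on_rel 3))))"

definition alphabet_exp :: "tm \<Rightarrow> nat poly \<Rightarrow> exp" where
  "alphabet_exp M p = Add (Mul (Const 2) (width_exp p)) (Mul (width_exp p) (Const (nrules M)))"

definition start_exp :: "tm \<Rightarrow> nat poly \<Rightarrow> exp" where
  "start_exp M p = Mul (Mul (Const 2) (width_exp p)) (Const (Suc (ncols M)))"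

definition emit_instance :: "tm \<Rightarrow> nat poly \<Rightarrow> bool \<Rightarrow> prog" where
  "emit_instance M p pol = cats [
     emit_unary (alphabet_exp M p), emit_unary (Const 1), emit_unary (Const 0),
     Loop (alphabet_exp M p) (emit_unary (Const 0)),
     emit_unary (Add (start_exp M p) (Const 1)), emit_unary (start_exp M p),
     Loop (width_exp p) (cats (map (\<lambda>b. cats (map (\<lambda>s. Cat
       (Loop (width_exp p) (cats (map (emit_priority M p b s) [0..<2])))
       (Loop (width_exp p) (cats (map (emit_action M b s) [0..<nrules M]))))
       [0..<Suc (ncols M)])) [0..<2])),
     Loop (width_exp p) (cats (map (\<lambda>b. case_init M p 1 (emit_state M 1 b)) [0..<2])),
     Loop (width_exp p) (cats (map (\<lambda>_. emit_unary (start_exp M p)) [0..<nrules M])),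
     Loop (width_exp p) (cats (map (\<lambda>b. cats (map (\<lambda>s. Emit [(b = 0 \<and> s \<noteq> ncols M) = pol])
       [0..<Suc (ncols M)])) [0..<2])),
     Emit [\<not> pol], Bin (Mul (Const 2) (width_exp p))]"

lemma scoped_emit_instance: "scoped 1 (emit_instance M p pol)"
proof -
  have v: "vars (poly_exp p) \<subseteq> {..<k}" if "0 < k" for k
    using vars_poly_exp[of p] that by auto
  have st: "scoped k (emit_state M v b s)" if "v < k" for k v b s
    using that by (simp add: emit_state_def scoped_emit_unary level_exp_def)
  have ci: "scoped k (case_init M p v F)" if "v < k" "\<And>s. scoped k (F s)" for k v F
    using that v[of k] by (simp add: case_init_def Let_def)
  have "scoped 5 (emit_priority M p b s b')" for b s b'
    by (simp add: emit_priority_def ci st level_exp_def)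
  moreover have "scoped 5 (emit_action M b s r)" for b s r
    by (simp add: emit_action_def Let_def st)
  moreover have "scoped 3 (case_init M p 1 (emit_state M 1 b))" for b
    by (simp add: ci st)
  ultimately show ?thesis
    using v[of 1] v[of 3]
    by (simp add: emit_instance_def scoped_cats scoped_emit_unary width_exp_def alphabet_exp_def start_exp_def
        numeral_eq_Suc del: upt_Suc)
qed

locale encoded_run = level_automaton W S m \<delta> \<iota> A
  for W S m :: nat and \<delta> :: "nat \<Rightarrow> nat \<Rightarrow> nat \<Rightarrow> nat" and \<iota> :: "nat \<Rightarrow> nat" and A :: "nat set" +
  fixes M :: tm and p :: "nat poly" and w :: "bool list"
  assumes W: "W = 2 * poly p (length w) + 1"
    and S: "S = ncols M"
    and m: "m = 2 * W + W * nrules M"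
    and \<delta>: "\<delta> c a s = tau M ((a - 2 * W) mod nrules M) (rel c ((a - 2 * W) div nrules M)) s"
    and \<iota>: "\<iota> c = init_col M (tape_contents w (int c - int (poly p (length w)))) (c = poly p (length w))"
    and A: "A = final_cols M"
begin

abbreviation "N \<equiv> poly p (length w)"

lemma out_case_init:
  assumes "g 0 = length w"
  shows "out (case_init M p v F) w k g = out (F (\<iota> (g v))) w k g"
proof -
  have sym: "tape_contents w j = 0 \<or> tape_contents w j = 1 \<or> tape_contents w j = 2" for j
    by (auto simp: tape_contents_def)
  show ?thesis
  proof (cases "g v < N")
    case True
    then have "tape_contents w (int (g v) - int N) = 0"
      by (simp add: tape_contents_def)
    then show ?thesis
      using True assms by (simp add: case_init_def eval_poly_exp Let_def \<iota>)
  next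
    case False
    then have "int (g v) - int N = int (g v - N)"
      by simp
    then show ?thesis
      using False assms sym[of "int (g v - N)"]
      by (auto simp: case_init_def eval_poly_exp Let_def \<iota>)
  qed
qed

lemma out_emit_state: "out (emit_state M v b s) w k g = unary (scode (At (2 * g v + b) s))"
  by (simp add: emit_state_def out_emit_unary level_exp_def scode_def S[symmetric])

lemma out_emit_priority:
  assumes "g 0 = length w" "g 3 < W" "b < 2" "b' < 2"
  shows "out (emit_priority M p b s b') w k g = unary (scode (pstep (At (2 * g 1 + b) s) (2 * g 3 + b')))"
proof -
  have "2 * g 3 + b' < 2 * W" "(2 * g 3 + b') div 2 = g 3" "(2 * g 1 + b) div 2 = g 1"
    using assms by auto
  then show ?thesis
    using out_case_init[of g, OF assms(1)]
    by (auto simp: emit_priority_def level_exp_def out_emit_state not_less A[symmetric] S[symmetric])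
qed

lemma out_emit_action:
  assumes "b < 2" "r < nrules M"
  shows "out (emit_action M b s r) w k g =
    unary (scode (pstep (At (2 * g 1 + b) s) (2 * W + g 3 * nrules M + r)))"
proof -
  have "(2 * g 1 + b) div 2 = g 1"
    using assms by auto
  then have "pstep (At (2 * g 1 + b) s) (2 * W + g 3 * nrules M + r) = At (2 * g 1 + b) (tau M r (rel (g 1) (g 3)) s)"
    using assms(2) by (simp add: \<delta>)
  then show ?thesis
    by (auto simp: emit_action_def Let_def out_emit_state rel_def)
qed

lemma out_row:
  assumes "g 0 = length w" "b < 2"
  shows "out (Cat (Loop (width_exp p) (cats (map (emit_priority M p b s) [0..<2])))
       (Loop (width_exp p) (cats (map (emit_action M b s) [0..<nrules M])))) w 3 g =
    row (nrules M) (At (2 * g 1 + b) s)"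
proof -
  have width: "eval (width_exp p) g = W"
    using assms by (simp add: width_exp_def eval_poly_exp W)
  have pri: "out (cats (map (emit_priority M p b s) [0..<2])) w (3 + 2) (g(3 := c, 3 + 1 := W - c)) =
      concat (map (\<lambda>b'. unary (scode (pstep (At (2 * g 1 + b) s) (2 * c + b')))) [0..<2])" if "c < W" for c
    unfolding out_cats map_map comp_def
  proof (intro arg_cong[where f = concat] map_cong)
    fix b' assume "b' \<in> set [0..<2]"
    then show "out (emit_priority M p b s b') w (3 + 2) (g(3 := c, 3 + 1 := W - c)) =
        unary (scode (pstep (At (2 * g 1 + b) s) (2 * c + b')))"
      using that assms by (subst out_emit_priority) (simp_all del: pstep.simps)
  qed simp
  have act: "out (cats (map (emit_action M b s) [0..<nrules M])) w (3 + 2) (g(3 := h, 3 + 1 := W - h)) =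
      concat (map (\<lambda>r. unary (scode (pstep (At (2 * g 1 + b) s) (2 * W + h * nrules M + r)))) [0..<nrules M])" for h
    unfolding out_cats map_map comp_def
  proof (intro arg_cong[where f = concat] map_cong)
    fix r assume "r \<in> set [0..<nrules M]"
    then show "out (emit_action M b s r) w (3 + 2) (g(3 := h, 3 + 1 := W - h)) =
        unary (scode (pstep (At (2 * g 1 + b) s) (2 * W + h * nrules M + r)))"
      using assms by (subst out_emit_action) (simp_all del: pstep.simps)
  qed simp
  show ?thesis
    unfolding out.simps(2,3) width row_def
    by (intro arg_cong2[where f = append] concat_map_upt_cong pri act)
qed

lemma out_emit_instance:
  "out (emit_instance M p pol) w 1 ((\<lambda>_. 0)(0 := length w)) = encode_instance (fdfa_of pol, 2 * W)"
proof -
  define g where "g = (\<lambda>_ :: nat. 0 :: nat)(0 := length w)"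
  have g0: "g 0 = length w"
    by (simp add: g_def)
  have width: "eval (width_exp p) h = W" if "h 0 = length w" for h
    using that by (simp add: width_exp_def eval_poly_exp W)
  have start: "eval (start_exp M p) h = 2 * W * Suc S" if "h 0 = length w" for h
    using width[of h, OF that] by (simp add: start_exp_def S[symmetric] del: mult_Suc_right)
  have alph: "eval (alphabet_exp M p) g = m"
    using width[of g, OF g0] m by (simp add: alphabet_exp_def)
  define h where "h c = g(1 := c, 1 + 1 := W - c)" for c
  have h: "h c 0 = length w" "h c 1 = c" for c
    by (simp_all add: h_def g0)
  have rows: "out (Loop (width_exp p) (cats (map (\<lambda>b. cats (map (\<lambda>s. Cat
       (Loop (width_exp p) (cats (map (emit_priority M p b s) [0..<2])))
       (Loop (width_exp p) (cats (map (emit_action M b s) [0..<nrules M]))))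
       [0..<Suc S])) [0..<2]))) w 1 g =
     concat (map (\<lambda>c. concat (map (\<lambda>b. concat (map (\<lambda>s. row (nrules M) (At (2 * c + b) s)) [0..<Suc S])) [0..<2])) [0..<W])"
    unfolding out.simps(3) width[of g, OF g0] out_cats map_map comp_def h_def[symmetric]
  proof (intro concat_map_upt_cong)
    fix c b s assume "b < (2 :: nat)"
    from out_row[of "h c", OF h(1) this]
    show "out (Cat (Loop (width_exp p) (cats (map (emit_priority M p b s) [0..<2])))
       (Loop (width_exp p) (cats (map (emit_action M b s) [0..<nrules M])))) w (1 + 2) (h c) =
      row (nrules M) (At (2 * c + b) s)"
      unfolding h(2) by (simp only: one_plus_numeral semiring_norm)
  qed
  have start_pri: "out (Loop (width_exp p) (cats (map (\<lambda>b. case_init M p 1 (emit_state M 1 b)) [0..<2]))) w 1 g =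
      concat (map (\<lambda>c. concat (map (\<lambda>b. unary (scode (pstep Start (2 * c + b)))) [0..<2])) [0..<W])"
    unfolding out.simps(3) width[of g, OF g0] out_cats map_map comp_def h_def[symmetric]
  proof (intro concat_map_upt_cong)
    fix c b assume "c < W" "b < (2 :: nat)"
    then have "(2 * c + b) div 2 = c" "2 * c + b < 2 * W"
      by auto
    then show "out (case_init M p 1 (emit_state M 1 b)) w (1 + 2) (h c) = unary (scode (pstep Start (2 * c + b)))"
      unfolding out_case_init[of "h _", OF h(1)] out_emit_state h(2) by simp
  qed
  have start_act: "out (Loop (width_exp p) (cats (map (\<lambda>_. emit_unary (start_exp M p)) [0..<nrules M]))) w 1 g =
      concat (map (\<lambda>h. concat (map (\<lambda>r. unary (scode (pstep Start (2 * W + h * nrules M + r)))) [0..<nrules M])) [0..<W])"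
    unfolding out.simps(3) width[of g, OF g0] out_cats map_map comp_def h_def[symmetric] out_emit_unary start[of "h _", OF h(1)]
    by (simp add: scode_def)
  have acc: "out (Loop (width_exp p) (cats (map (\<lambda>b. cats (map (\<lambda>s. Emit [(b = 0 \<and> s \<noteq> S) = pol])
       [0..<Suc S])) [0..<2]))) w 1 g =
     concat (map (\<lambda>c. concat (map (\<lambda>b. concat (map (\<lambda>s. [(b = 0 \<and> s \<noteq> S) = pol]) [0..<Suc S])) [0..<2])) [0..<W])"
    unfolding out.simps(3) width[of g, OF g0] out_cats map_map comp_def out.simps(1) ..
  have lead: "out (Loop (alphabet_exp M p) (emit_unary (Const 0))) w 1 g = concat (map (\<lambda>_. unary 0) [0..<m])"
    by (simp add: alph out_emit_unary)
  have "eval (Add (start_exp M p) (Const 1)) g = Suc (2 * W * Suc S)" "eval (Mul (Const 2) (width_exp p)) g = 2 * W"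
    using start[of g, OF g0] width[of g, OF g0] by simp_all
  then show ?thesis
    unfolding encode_fdfa_of[OF m] emit_instance_def g_def[symmetric] S[symmetric] out_cats
      list.map concat.simps rows start_pri start_act acc lead row_def[of _ Start]
    by (simp only: out_emit_unary alph start[of g, OF g0] out.simps(1,6) append_assoc append_Nil2 eval.simps(1))
qed

end

lemma bounded_run_encoded:
  assumes "bounded_run M w (poly p (length w))"
  shows "encoded_run (2 * poly p (length w) + 1) (ncols M) (bounded_run.m M (poly p (length w)))
    (bounded_run.\<delta> M (poly p (length w))) (bounded_run.\<iota> M w (poly p (length w))) (final_cols M) M p w"
proof -
  interpret bounded_run M w "poly p (length w)" by (rule assms)
  show ?thesis
    by unfold_locales (simp_all add: m_def \<delta>_def \<iota>_def)
qed

theorem PSPACE_hard_measure: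
  "PSPACE_hard diameter_instances encode_instance
     (measure_at_least (if pol then positive_measure else negative_measure))"
  unfolding PSPACE_hard_def
proof
  fix L assume "L \<in> PSPACE"
  then obtain M and p :: "nat poly" where M: "wf_tm M" "tm_decides M L" "tm_space_bounded M (poly p)"
    unfolding PSPACE_def by blast
  let ?f = "\<lambda>w. out (emit_instance M p pol) w 1 ((\<lambda>_. 0)(0 := length w))"
  have "\<exists>x \<in> diameter_instances. ?f w = encode_instance x \<and>
      (w \<in> L \<longleftrightarrow> measure_at_least (if pol then positive_measure else negative_measure) x)" for w
  proof -
    let ?N = "poly p (length w)"
    have b: "bounded_run M w ?N"
      using M unfolding tm_space_bounded_def by unfold_locales auto
    interpret bounded_run M w ?N by (rule b)
    interpret encoded_run W "ncols M" m \<delta> \<iota> "final_cols M" M p w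
      by (rule bounded_run_encoded[OF b])
    have L: "w \<in> L \<longleftrightarrow> (\<exists>n. tm_halted M w n \<and> fst (run n) \<in> tm_accepting M)"
    proof
      assume "w \<in> L"
      then show "\<exists>n. tm_halted M w n \<and> fst (run n) \<in> tm_accepting M"
        using M(2) unfolding tm_decides_def by blast
    next
      assume "\<exists>n. tm_halted M w n \<and> fst (run n) \<in> tm_accepting M"
      then obtain n where n: "tm_halted M w n" "fst (run n) \<in> tm_accepting M" by blast
      obtain n' where n': "tm_halted M w n'" "fst (run n') \<in> tm_accepting M \<longleftrightarrow> w \<in> L"
        using M(2) unfolding tm_decides_def by blast
      \<comment> \<open>A decider promises its verdict at one halting time only; as halted
        configurations stay put, the verdict is the same at any other.\<close>
      have "run (max n n') = run n" "run (max n n') = run n'"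
        using run_after_halt n(1) n'(1) by simp_all
      then show "w \<in> L"
        using n(2) n'(2) by simp
    qed
    have "w \<in> L \<longleftrightarrow> measure_at_least (if pol then positive_measure else negative_measure) (fdfa_of pol, 2 * W)"
    proof
      assume "w \<in> L"
      then obtain n where "tm_halted M w n" "fst (run n) \<in> tm_accepting M"
        unfolding L by blast
      then obtain x where "\<forall>a \<in> set x. 2 * W \<le> a \<and> a < m" "\<forall>c. accepted c x"
        using accepting_run_word by blast
      then show "measure_at_least (if pol then positive_measure else negative_measure) (fdfa_of pol, 2 * W)"
        by (intro measure_at_least_fdfa_of(1)) blast
    next
      assume "measure_at_least (if pol then positive_measure else negative_measure) (fdfa_of pol, 2 * W)"
      from measure_at_least_fdfa_of(2)[OF this]
      obtain x where "\<forall>a \<in> set x. 2 * W \<le> a \<and> a < m" "\<forall>c. 1 \<le> c \<and> c < W \<longrightarrow> accepted c x"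
        by blast
      from common_word_accepting_run[OF this] show "w \<in> L"
        unfolding L .
    qed
    then show ?thesis
      using fdfa_of_instance[of "2 * W" pol] out_emit_instance[of pol]
      by (intro bexI[of _ "(fdfa_of pol, 2 * W)"]) simp_all
  qed
  then show "\<exists>f. poly_time_computable f \<and> (\<forall>w. \<exists>x \<in> diameter_instances. f w = encode_instance x \<and>
      (w \<in> L \<longleftrightarrow> measure_at_least (if pol then positive_measure else negative_measure) x))"
    using prog_poly_time_computable[OF scoped_emit_instance[of M p pol]] by (intro exI[of _ ?f] conjI allI) simp_all
qed

theorem theorem18:
  shows "PSPACE_hard diameter_instances encode_instance (measure_at_least positive_measure) \<and>
    PSPACE_hard diameter_instances encode_instance (measure_at_least negative_measure)"
  using PSPACE_hard_measure[of True] PSPACE_hard_measure[of False] by simp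

end
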